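(* Suppose $(W,S)$ is a finitely generated Coxeter system and $W=A\ast_C B$ is a non-trivial splitting of $W$. Then there exist $D\subset S$ and $w\in W$ such that $\langle D\rangle\in M(W)$, $D$ separates $\Gamma(W,S)$, and $w\langle E_W(D)\rangle w^{-1}\subset C$ (so $w\langle D\rangle w^{-1}\cap C$ has finite index in $w\langle D\rangle w^{-1}$). Furthermore, if $C\in M(W)$, then $w\langle E_W(D)\rangle w^{-1}$ has finite index in $C$.
   Context: A group $G$ splits non-trivially over a subgroup $H$ if $G$ is an HNN extension $A\ast_H$ or an amalgamated product $A\ast_H B$ with $A\neq H\neq B$; then $H$ is a splitting subgroup of $G$. For subgroups $H,K$ of $G$, $H$ is smaller than $K$ if $H\cap K$ has finite index in $H$ and infinite index in $K$. $M(G)$ (minimal splitting subgroups of $G$) is the set of subgroups $H$ of $G$ such that $G$ splits non-trivially over $H$ and no splitting subgroup of $G$ is smaller than $H$. For a Coxeter system $(W,S)$ with Coxeter matrix $m$, the presentation diagram $\Gamma(W,S)$ is the graph with vertex set $S$ and an edge labeled $m(s,t)$ joining distinct $s,t$ whenever $m(s,t)<\infty$. A subset $D\subset S$ separates $\Gamma$ if $\Gamma-D$ has at least two components. For $A\subset S$ there is a unique largest subset $T_W(A)\subset A$ such that $\langle T_W(A)\rangle$ is finite and $\langle A\rangle=\langle A-T_W(A)\rangle\times\langle T_W(A)\rangle$ (i.e. $T_W(A)$ commutes with $A-T_W(A)$); set $E_W(A)=A-T_W(A)$. The symbol $\subset$ allows equality. *)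

theory Defs
  imports "HOL-Algebra.Generated_Groups" "HOL-Library.Extended_Nat"
begin

section \<open>Group presentations\<close>

text \<open>
  A word over \<open>X\<close> is a list of signed letters: \<open>(x, True)\<close> stands for \<open>x\<close> and
  \<open>(x, False)\<close> for its formal inverse.
\<close>

type_synonym 'x word = "('x \<times> bool) list"

abbreviation words :: "'x set \<Rightarrow> 'x word set" where
  "words X \<equiv> lists (X \<times> UNIV)"

fun word_val :: "('a, 'b) monoid_scheme \<Rightarrow> ('x \<Rightarrow> 'a) \<Rightarrow> 'x word \<Rightarrow> 'a" where
  "word_val G f [] = \<one>\<^bsub>G\<^esub>"
| "word_val G f ((x, e) # w) = (if e then f x else inv\<^bsub>G\<^esub> (f x)) \<otimes>\<^bsub>G\<^esub> word_val G f w"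

text \<open>
  \<open>word_eq X R u v\<close> says that \<open>u\<close> and \<open>v\<close> represent the same element of the group
  \<open>\<langle>X | R\<rangle>\<close>, that is, of the free group on \<open>X\<close> modulo the normal closure of \<open>R\<close>.
\<close>

inductive word_eq :: "'x set \<Rightarrow> 'x word set \<Rightarrow> 'x word \<Rightarrow> 'x word \<Rightarrow> bool"
  for X :: "'x set" and R :: "'x word set" where
  refl: "w \<in> words X \<Longrightarrow> word_eq X R w w"
| sym: "word_eq X R u v \<Longrightarrow> word_eq X R v u"
| trans: "word_eq X R u v \<Longrightarrow> word_eq X R v w \<Longrightarrow> word_eq X R u w"
| cancel: "u \<in> words X \<Longrightarrow> v \<in> words X \<Longrightarrow> x \<in> X \<Longrightarrow>
    word_eq X R (u @ [(x, e), (x, \<not> e)] @ v) (u @ v)"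
| relator: "u \<in> words X \<Longrightarrow> v \<in> words X \<Longrightarrow> r \<in> R \<Longrightarrow> word_eq X R (u @ r @ v) (u @ v)"

text \<open>\<open>f\<close> induces an isomorphism from \<open>\<langle>X | R\<rangle>\<close> onto \<open>G\<close>.\<close>

definition presents :: "('a, 'b) monoid_scheme \<Rightarrow> ('x \<Rightarrow> 'a) \<Rightarrow> 'x set \<Rightarrow> 'x word set \<Rightarrow> bool" where
  "presents G f X R \<longleftrightarrow>
     group G \<and> R \<subseteq> words X \<and> f \<in> X \<rightarrow> carrier G \<and> generate G (f ` X) = carrier G \<and>
     (\<forall>w \<in> words X. word_val G f w = \<one>\<^bsub>G\<^esub> \<longleftrightarrow> word_eq X R w [])"


section \<open>Amalgamated products and HNN extensions\<close>

definition mult_table_relators :: "('a, 'b) monoid_scheme \<Rightarrow> ('a \<Rightarrow> 'x) \<Rightarrow> 'a set \<Rightarrow> 'x word set" where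
  "mult_table_relators G i A =
     {[(i a, True), (i b, True), (i (a \<otimes>\<^bsub>G\<^esub> b), False)] | a b. a \<in> A \<and> b \<in> A}"

text \<open>
  \<open>G = A *\<^sub>C B\<close> for subgroups \<open>A\<close>, \<open>B\<close>, \<open>C\<close> of \<open>G\<close>: the group obtained from the disjoint
  union of \<open>A\<close> and \<open>B\<close> by identifying the two copies of \<open>C\<close> maps isomorphically onto \<open>G\<close>.
\<close>

definition amalgamated_product ::
  "('a, 'b) monoid_scheme \<Rightarrow> 'a set \<Rightarrow> 'a set \<Rightarrow> 'a set \<Rightarrow> bool" where
  "amalgamated_product G A C B \<longleftrightarrow>
     subgroup A G \<and> subgroup B G \<and> subgroup C G \<and> C \<subseteq> A \<and> C \<subseteq> B \<and>
     presents G (case_sum id id) (A <+> B)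
       (mult_table_relators G Inl A \<union> mult_table_relators G Inr B \<union>
        {[(Inl c, True), (Inr c, False)] | c. c \<in> C})"

text \<open>
  \<open>G\<close> is the HNN extension \<open>A*\<^sub>C\<close> with base \<open>A\<close>, stable letter \<open>t\<close> and associated
  monomorphism \<open>\<phi>: C \<rightarrow> A\<close>, the defining relations being \<open>t\<^sup>-\<^sup>1 c t = \<phi>(c)\<close>.
  The generator \<open>Inr ()\<close> of the presentation is the stable letter.
\<close>

definition HNN_extension ::
  "('a, 'b) monoid_scheme \<Rightarrow> 'a set \<Rightarrow> 'a set \<Rightarrow> ('a \<Rightarrow> 'a) \<Rightarrow> 'a \<Rightarrow> bool" where
  "HNN_extension G A C \<phi> t \<longleftrightarrow>
     subgroup A G \<and> subgroup C G \<and> C \<subseteq> A \<and>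
     \<phi> \<in> mon (G\<lparr>carrier := C\<rparr>) (G\<lparr>carrier := A\<rparr>) \<and> t \<in> carrier G \<and>
     presents G (case_sum id (\<lambda>_. t)) (A <+> {()})
       (mult_table_relators G Inl A \<union>
        {[(Inr (), False), (Inl c, True), (Inr (), True), (Inl (\<phi> c), False)] | c. c \<in> C})"

definition splits_over :: "('a, 'b) monoid_scheme \<Rightarrow> 'a set \<Rightarrow> bool" where
  "splits_over G H \<longleftrightarrow>
     (\<exists>A \<phi> t. HNN_extension G A H \<phi> t) \<or>
     (\<exists>A B. amalgamated_product G A H B \<and> A \<noteq> H \<and> H \<noteq> B)"


section \<open>Minimal splitting subgroups\<close>

text \<open>Meaningful for subgroups \<open>H \<subseteq> K\<close> of \<open>G\<close>: the index of \<open>H\<close> in \<open>K\<close> is finite.\<close>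

definition finite_index :: "('a, 'b) monoid_scheme \<Rightarrow> 'a set \<Rightarrow> 'a set \<Rightarrow> bool" where
  "finite_index G H K \<longleftrightarrow> finite (rcosets\<^bsub>G\<lparr>carrier := K\<rparr>\<^esub> H)"

definition smaller :: "('a, 'b) monoid_scheme \<Rightarrow> 'a set \<Rightarrow> 'a set \<Rightarrow> bool" where
  "smaller G H K \<longleftrightarrow> finite_index G (H \<inter> K) H \<and> \<not> finite_index G (H \<inter> K) K"

definition minimal_splitting_subgroups :: "('a, 'b) monoid_scheme \<Rightarrow> 'a set set" where
  "minimal_splitting_subgroups G =
     {H. splits_over G H \<and> \<not> (\<exists>K. splits_over G K \<and> smaller G K H)}"


section \<open>Coxeter systems\<close>

definition coxeter_matrix :: "'a set \<Rightarrow> ('a \<Rightarrow> 'a \<Rightarrow> enat) \<Rightarrow> bool" where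
  "coxeter_matrix S m \<longleftrightarrow>
     (\<forall>s\<in>S. m s s = 1) \<and>
     (\<forall>s\<in>S. \<forall>t\<in>S. m s t = m t s \<and> (s \<noteq> t \<longrightarrow> 2 \<le> m s t))"

definition coxeter_relators :: "'a set \<Rightarrow> ('a \<Rightarrow> 'a \<Rightarrow> enat) \<Rightarrow> 'a word set" where
  "coxeter_relators S m =
     {concat (replicate n [(s, True), (t, True)]) | s t n. s \<in> S \<and> t \<in> S \<and> m s t = enat n}"

definition coxeter_system ::
  "('a, 'b) monoid_scheme \<Rightarrow> 'a set \<Rightarrow> ('a \<Rightarrow> 'a \<Rightarrow> enat) \<Rightarrow> bool" where
  "coxeter_system W S m \<longleftrightarrow>
     S \<subseteq> carrier W \<and> coxeter_matrix S m \<and> presents W id S (coxeter_relators S m)"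

definition diagram_edges :: "'a set \<Rightarrow> ('a \<Rightarrow> 'a \<Rightarrow> enat) \<Rightarrow> ('a \<times> 'a) set" where
  "diagram_edges S m = {(s, t). s \<in> S \<and> t \<in> S \<and> s \<noteq> t \<and> m s t < \<infinity>}"

text \<open>The vertex sets of the connected components of the subgraph induced on \<open>V\<close>.\<close>

definition components_on :: "'a set \<Rightarrow> ('a \<times> 'a) set \<Rightarrow> 'a set set" where
  "components_on V E = V // ((E \<inter> V \<times> V)\<^sup>* \<inter> V \<times> V)"

definition separates_diagram :: "'a set \<Rightarrow> ('a \<Rightarrow> 'a \<Rightarrow> enat) \<Rightarrow> 'a set \<Rightarrow> bool" where
  "separates_diagram S m D \<longleftrightarrow>
     D \<subseteq> S \<and>
     (\<exists>X \<in> components_on (S - D) (diagram_edges S m).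
      \<exists>Y \<in> components_on (S - D) (diagram_edges S m). X \<noteq> Y)"

definition internal_direct_product ::
  "('a, 'b) monoid_scheme \<Rightarrow> 'a set \<Rightarrow> 'a set \<Rightarrow> 'a set \<Rightarrow> bool" where
  "internal_direct_product G L H K \<longleftrightarrow>
     (\<lambda>(x, y). x \<otimes>\<^bsub>G\<^esub> y) \<in>
       iso (G\<lparr>carrier := H\<rparr> \<times>\<times> G\<lparr>carrier := K\<rparr>) (G\<lparr>carrier := L\<rparr>)"

text \<open>
  \<open>finite_part W A\<close> is \<open>T\<^sub>W(A)\<close> and \<open>essential_part W A\<close> is \<open>E\<^sub>W(A)\<close>; the greatest
  element is taken with respect to inclusion.
\<close>

definition finite_part :: "('a, 'b) monoid_scheme \<Rightarrow> 'a set \<Rightarrow> 'a set" where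
  "finite_part W A =
     (GREATEST T. T \<subseteq> A \<and> finite (generate W T) \<and>
        internal_direct_product W (generate W A) (generate W (A - T)) (generate W T))"

definition essential_part :: "('a, 'b) monoid_scheme \<Rightarrow> 'a set \<Rightarrow> 'a set" where
  "essential_part W A = A - finite_part W A"

definition conjugate :: "('a, 'b) monoid_scheme \<Rightarrow> 'a \<Rightarrow> 'a set \<Rightarrow> 'a set" where
  "conjugate G g H = g <#\<^bsub>G\<^esub> H #>\<^bsub>G\<^esub> inv\<^bsub>G\<^esub> g"

end

theory Submission
  imports Defs
begin

text \<open>
  Let \<open>W = A *\<^sub>C B\<close> act on its Bass-Serre tree. If for some edge \<open>e\<close> there are generators in \<open>S\<close> moving \<open>e\<close>
  whose fixed trees lie on different sides of \<open>e\<close>, then two such generators have a product of infinite order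
  (ping-pong), so the set \<open>D\<close> of generators fixing \<open>e\<close> separates the diagram, and \<open>\<langle>D\<rangle>\<close> is conjugate into \<open>C\<close>.
  If there is no such edge, a vertex of minimal total displacement is fixed by all of \<open>S\<close>, which is excluded
  because the splitting is non-trivial. Conversely, \<open>W\<close> splits over \<open>\<langle>D\<rangle>\<close> for every separating \<open>D\<close>.

  Among the separating \<open>D\<close> such that \<open>w\<langle>E(D)\<rangle>w\<^sup>-\<^sup>1 \<subseteq> C\<close> for some \<open>w\<close>, choose one with \<open>E(D)\<close> of least
  cardinality. If a splitting subgroup \<open>K\<close> were smaller than \<open>\<langle>D\<rangle>\<close>, it would contain a conjugate of \<open>\<langle>D'\<rangle>\<close>
  with \<open>D'\<close> separating. Two rigidity properties of Coxeter groups, both proved by counting inversions, then give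
  a contradiction: a parabolic subgroup which meets \<open>\<langle>D'\<rangle>\<close> in finite index contains \<open>\<langle>E(D')\<rangle>\<close>, and if a
  conjugate of \<open>\<langle>I\<rangle>\<close> is contained in \<open>\<langle>J\<rangle>\<close>, then \<open>|I| \<le> |J|\<close>, with equality only if it is \<open>\<langle>J\<rangle>\<close>.
\<close>

section \<open>Words and presentations\<close>

text \<open>Amalgams and Coxeter groups enter only through presentations, so telling elements apart
  requires invariants of words. Apart from the exponent sum that rules out HNN extensions, one
  device supplies them: a crossed homomorphism into the Boolean functions on a \<open>G\<close>-set
  exists as soon as its prescribed values on generators cancel along every relator. For a Coxeter
  group acting on itself by conjugation, with \<open>s\<close> sent to the indicator of
  \<open>s\<close>, it records the walls between two chambers; for an amalgam acting on itself by
  left translation it records the edges between two vertices of the tree. The tree is never built as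
  a graph: an element \<open>g\<close> stands for \<open>gA\<close>, \<open>gB\<close> or
  \<open>gC\<close>, depending on the predicate applied to it.

  Minimality is measured on \<open>E(D)\<close> and not on \<open>D\<close>, because finite index
  cannot see the finite factor \<open>T(D)\<close>. On the essential parts, virtual containment in a
  conjugate becomes actual containment, and there a comparison of cardinalities decides
  equality.\<close>

context group
begin

lemma inv_cancel_left [simp]:
  "x \<in> carrier G \<Longrightarrow> y \<in> carrier G \<Longrightarrow> inv x \<otimes> (x \<otimes> y) = y"
  "x \<in> carrier G \<Longrightarrow> y \<in> carrier G \<Longrightarrow> x \<otimes> (inv x \<otimes> y) = y"
  by (simp_all flip: m_assoc)

lemma word_val_closed [simp]:
  "f \<in> X \<rightarrow> carrier G \<Longrightarrow> w \<in> words X \<Longrightarrow> word_val G f w \<in> carrier G"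
  by (induction w) (auto simp: Pi_iff)

lemma word_val_append:
  "f \<in> X \<rightarrow> carrier G \<Longrightarrow> u \<in> words X \<Longrightarrow> v \<in> words X \<Longrightarrow>
   word_val G f (u @ v) = word_val G f u \<otimes> word_val G f v"
proof (induction u)
  case (Cons l u)
  then have "word_val G f u \<in> carrier G" "word_val G f v \<in> carrier G" by auto
  with Cons show ?case by (cases l) (auto simp: Pi_iff m_assoc)
qed simp

lemma word_val_cancel:
  "f \<in> X \<rightarrow> carrier G \<Longrightarrow> x \<in> X \<Longrightarrow> word_val G f [(x, e), (x, \<not> e)] = \<one>"
  by (auto simp: Pi_iff)

end

definition inv_word :: "'x word \<Rightarrow> 'x word" where
  "inv_word w = rev (map (\<lambda>(x, e). (x, \<not> e)) w)"

lemma inv_word_in_words [simp]: "w \<in> words X \<Longrightarrow> inv_word w \<in> words X"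
  by (auto simp: inv_word_def)

lemma word_eq_common: "word_eq X R p u \<Longrightarrow> word_eq X R p v \<Longrightarrow> word_eq X R u v"
  by (rule word_eq.trans[OF word_eq.sym])

lemma word_eq_context:
  assumes "word_eq X R u v" and "p \<in> words X" and "q \<in> words X"
  shows "word_eq X R (p @ u @ q) (p @ v @ q)"
  using assms(1)
proof induction
  case (refl w)
  then show ?case using assms by (intro word_eq.refl) auto
next
  case (sym u v)
  then show ?case by (blast intro: word_eq.sym)
next
  case (trans u v w)
  then show ?case by (blast intro: word_eq.trans)
next
  case (cancel u v x e)
  have "word_eq X R ((p @ u) @ [(x, e), (x, \<not> e)] @ (v @ q)) ((p @ u) @ (v @ q))"
    using cancel assms by (intro word_eq.cancel) auto
  then show ?case by simp
next
  case (relator u v r)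
  have "word_eq X R ((p @ u) @ r @ (v @ q)) ((p @ u) @ (v @ q))"
    using relator assms by (intro word_eq.relator) auto
  then show ?case by simp
qed

lemma word_eq_inv_word:
  "w \<in> words X \<Longrightarrow> word_eq X R (w @ inv_word w) []"
  "w \<in> words X \<Longrightarrow> word_eq X R (inv_word w @ w) []"
proof (induction w)
  case Nil
  {
    case 1 then show ?case by (auto simp: inv_word_def intro: word_eq.refl)
  next
    case 2 then show ?case by (auto simp: inv_word_def intro: word_eq.refl)
  }
next
  case (Cons l w)
  obtain x e where l: "l = (x, e)" by (cases l)
  {
    case 1
    then have wx: "w \<in> words X" "x \<in> X" using l by auto
    have "word_eq X R ([(x, e)] @ (w @ inv_word w) @ [(x, \<not> e)]) ([(x, e)] @ [] @ [(x, \<not> e)])"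
      using wx Cons by (intro word_eq_context) auto
    moreover have "word_eq X R ([] @ [(x, e), (x, \<not> e)] @ []) ([] @ [])"
      using wx by (intro word_eq.cancel) auto
    ultimately show ?case
      using l by (auto simp: inv_word_def intro: word_eq.trans)
  next
    case 2
    then have wx: "w \<in> words X" "x \<in> X" using l by auto
    have "word_eq X R (inv_word w @ [(x, \<not> e), (x, \<not> \<not> e)] @ w) (inv_word w @ w)"
      using wx by (intro word_eq.cancel) auto
    with Cons(2)[OF wx(1)] show ?case
      using l by (auto simp: inv_word_def intro: word_eq.trans)
  }
qed

lemma (in group) word_val_cong:
  assumes "word_eq X R u v" and f: "f \<in> X \<rightarrow> carrier G" and R: "R \<subseteq> words X"
    and one: "\<And>r. r \<in> R \<Longrightarrow> word_val G f r = \<one>"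
  shows "word_val G f u = word_val G f v"
  using assms(1)
proof induction
  case (cancel u v x e)
  note val = word_val_append[OF f]
  show ?case
    using word_val_cancel[OF f, of x e] f cancel
    by (subst val, simp, simp, subst val) (auto simp: val)
next
  case (relator u v r)
  then show ?case
    using one R f by (auto simp: word_val_append[OF f] subset_iff)
qed auto

text \<open>\<open>presents\<close> only decides which words are trivial; comparing two words is
  reduced to this by moving \<open>v\<close> to the other side as \<open>inv_word v\<close>.\<close>

lemma presents_word_eq_iff:
  assumes "presents G f X R" and u: "u \<in> words X" and v: "v \<in> words X"
  shows "word_val G f u = word_val G f v \<longleftrightarrow> word_eq X R u v"
proof
  interpret group G using assms by (simp add: presents_def)
  have f: "f \<in> X \<rightarrow> carrier G" and R: "R \<subseteq> words X"
    and one: "\<And>w. w \<in> words X \<Longrightarrow> word_val G f w = \<one>\<^bsub>G\<^esub> \<longleftrightarrow> word_eq X R w []"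
    using assms by (auto simp: presents_def)
  note val = word_val_append[OF f]
  have "word_val G f r = \<one>\<^bsub>G\<^esub>" if "r \<in> R" for r
  proof -
    have "word_eq X R ([] @ r @ []) ([] @ [])"
      using that R by (intro word_eq.relator) auto
    then show ?thesis using one that R by auto
  qed
  then show "word_val G f u = word_val G f v" if "word_eq X R u v"
    using word_val_cong[OF that f R] by blast
  show "word_eq X R u v" if eq: "word_val G f u = word_val G f v"
  proof -
    have "word_val G f (v @ inv_word v) = \<one>\<^bsub>G\<^esub>"
      using v one by (auto intro: word_eq_inv_word)
    then have "word_val G f (u @ inv_word v) = \<one>\<^bsub>G\<^esub>"
      using u v eq by (simp add: val)
    then have "word_eq X R (u @ inv_word v) []" using one u v by auto
    from word_eq_context[OF this, of "[]" v] have "word_eq X R (u @ inv_word v @ v) v"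
      using u v by auto
    moreover have "word_eq X R (u @ (inv_word v @ v) @ []) (u @ [] @ [])"
      using u v by (intro word_eq_context word_eq_inv_word) auto
    ultimately show ?thesis by (auto intro: word_eq.trans word_eq.sym)
  qed
qed

lemma (in group) generate_word_val:
  assumes f: "f \<in> X \<rightarrow> carrier G" and "g \<in> generate G (f ` X)"
  obtains w where "w \<in> words X" "word_val G f w = g"
proof -
  from assms(2) have "\<exists>w \<in> words X. word_val G f w = g"
  proof induction
    case one
    then show ?case by (intro bexI[of _ "[]"]) auto
  next
    case (incl h)
    then obtain x where x: "x \<in> X" "h = f x" by auto
    have "f x \<in> carrier G" using f x(1) by (rule funcset_mem)
    then show ?case using x by (intro bexI[of _ "[(x, True)]"]) auto
  next
    case (inv h)
    then obtain x where x: "x \<in> X" "h = f x" by auto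
    have "f x \<in> carrier G" using f x(1) by (rule funcset_mem)
    then show ?case using x by (intro bexI[of _ "[(x, False)]"]) auto
  next
    case (eng g h)
    then obtain u v where "u \<in> words X" "v \<in> words X" "word_val G f u = g" "word_val G f v = h"
      by blast
    then show ?case using word_val_append[OF f, of u v] by (intro bexI[of _ "u @ v"]) auto
  qed
  then show ?thesis using that by auto
qed

lemma presents_surj:
  assumes "presents G f X R" and "g \<in> carrier G"
  obtains w where "w \<in> words X" "word_val G f w = g"
proof -
  interpret group G using assms by (simp add: presents_def)
  show ?thesis
    using assms that generate_word_val[of f X g] by (auto simp: presents_def)
qed

text \<open>Cocycles take values in the Boolean functions on a set with an action of \<open>G\<close>, added by
  exclusive or. The value at the inverse of a letter is forced by the cocycle identity.\<close>

fun word_cocycle ::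
  "('a, 'b) monoid_scheme \<Rightarrow> ('x \<Rightarrow> 'a) \<Rightarrow> ('a \<Rightarrow> 'm \<Rightarrow> 'm) \<Rightarrow> ('x \<Rightarrow> 'm \<Rightarrow> bool) \<Rightarrow>
   'x word \<Rightarrow> 'm \<Rightarrow> bool" where
  "word_cocycle G f act n [] y = False"
| "word_cocycle G f act n ((x, e) # w) y =
     (n x (if e then y else act (f x) y) \<noteq>
      word_cocycle G f act n w (act (if e then inv\<^bsub>G\<^esub> (f x) else f x) y))"

text \<open>A cocycle amounts to a homomorphism from \<open>G\<close> into the semidirect product of
  the Boolean functions on \<open>M\<close> with \<open>G\<close> that lifts the identity, so it can
  be prescribed on generators subject to the relators. On words: a concatenation follows the cocycle
  rule, a pair of inverse letters contributes nothing, and a relator contributes nothing and acts as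
  the identity.\<close>

lemma presents_cocycle:
  assumes pres: "presents G f X R"
    and act: "\<And>g y. g \<in> carrier G \<Longrightarrow> y \<in> M \<Longrightarrow> act g y \<in> M"
      "\<And>g h y. g \<in> carrier G \<Longrightarrow> h \<in> carrier G \<Longrightarrow> y \<in> M \<Longrightarrow>
        act (g \<otimes>\<^bsub>G\<^esub> h) y = act g (act h y)"
      "\<And>y. y \<in> M \<Longrightarrow> act \<one>\<^bsub>G\<^esub> y = y"
    and rel: "\<And>r y. r \<in> R \<Longrightarrow> y \<in> M \<Longrightarrow> \<not> word_cocycle G f act n r y"
  obtains N where
    "\<And>g h y. g \<in> carrier G \<Longrightarrow> h \<in> carrier G \<Longrightarrow> y \<in> M \<Longrightarrow>
      N (g \<otimes>\<^bsub>G\<^esub> h) y = (N g y \<noteq> N h (act (inv\<^bsub>G\<^esub> g) y))"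
    "\<And>x y. x \<in> X \<Longrightarrow> y \<in> M \<Longrightarrow> N (f x) y = n x y"
proof -
  interpret group G using assms by (simp add: presents_def)
  have f: "f \<in> X \<rightarrow> carrier G" and R: "R \<subseteq> words X"
    using pres by (auto simp: presents_def)
  let ?c = "word_cocycle G f act n"
  have app: "?c (u @ v) y = (?c u y \<noteq> ?c v (act (inv\<^bsub>G\<^esub> (word_val G f u)) y))"
    if "u \<in> words X" "y \<in> M" for u v y
    using that
  proof (induction u arbitrary: y)
    case (Cons l u)
    obtain x e where l: "l = (x, e)" by (cases l)
    have x: "x \<in> X" "f x \<in> carrier G" "u \<in> words X" using Cons l f by auto
    then have "act (inv\<^bsub>G\<^esub> (word_val G f (l # u))) y =
      act (inv\<^bsub>G\<^esub> (word_val G f u)) (act (if e then inv\<^bsub>G\<^esub> (f x) else f x) y)"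
      using f l Cons.prems by (auto simp: inv_mult_group act)
    moreover have "act (if e then inv\<^bsub>G\<^esub> (f x) else f x) y \<in> M"
      using x Cons.prems by (auto simp: act)
    ultimately show ?case using Cons.IH x l by auto
  qed (simp add: act)
  have canc: "\<not> ?c [(x, e), (x, \<not> e)] y" if "x \<in> X" "y \<in> M" for x e y
  proof -
    have x: "f x \<in> carrier G" using f \<open>x \<in> X\<close> by (rule funcset_mem)
    have "act (f x) (act (inv\<^bsub>G\<^esub> (f x)) y) = y" "act (inv\<^bsub>G\<^esub> (f x)) (act (f x) y) = y"
      using x \<open>y \<in> M\<close> act(2)[of "f x" "inv\<^bsub>G\<^esub> (f x)" y] act(2)[of "inv\<^bsub>G\<^esub> (f x)" "f x" y]
      by (simp_all add: act(3))
    then show ?thesis by (cases e) simp_all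
  qed
  have eq: "?c u y = ?c v y" if "word_eq X R u v" "y \<in> M" for u v y
    using that
  proof (induction arbitrary: y)
    case (cancel u v x e)
    let ?y = "act (inv\<^bsub>G\<^esub> (word_val G f u)) y"
    have y: "?y \<in> M"
      using act(1)[OF inv_closed[OF word_val_closed[OF f cancel(1)]]] cancel.prems by blast
    have "?c (u @ [(x, e), (x, \<not> e)] @ v) y = (?c u y \<noteq> ?c ([(x, e), (x, \<not> e)] @ v) ?y)"
      using app cancel by blast
    also have "?c ([(x, e), (x, \<not> e)] @ v) ?y = ?c v ?y"
      using app[of "[(x, e), (x, \<not> e)]" ?y v] canc[OF _ y] cancel y
        word_val_cancel[OF f, of x e] by (auto simp: act)
    finally show ?case using app cancel by blast
  next
    case (relator u v r)
    let ?y = "act (inv\<^bsub>G\<^esub> (word_val G f u)) y"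
    have y: "?y \<in> M"
      using act(1)[OF inv_closed[OF word_val_closed[OF f relator(1)]]] relator.prems by blast
    have r: "r \<in> words X" using relator R by auto
    have "word_eq X R ([] @ r @ []) ([] @ [])"
      using relator R by (intro word_eq.relator) auto
    then have "word_val G f r = \<one>\<^bsub>G\<^esub>" using presents_word_eq_iff[OF pres, of r "[]"] r by auto
    then have "?c (r @ v) ?y = ?c v ?y"
      using app[OF r y, of v] y rel[OF relator(3) y] by (auto simp: act)
    then show ?case using app relator by blast
  qed auto
  \<comment> \<open>Any word for \<open>g\<close> will do: by \<open>eq\<close> the cocycle agrees
    on equivalent words.\<close>
  define N where "N g = ?c (SOME w. w \<in> words X \<and> word_val G f w = g)" for g
  have N: "N (word_val G f w) y = ?c w y" if "w \<in> words X" "y \<in> M" for w y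
  proof -
    let ?w = "SOME v. v \<in> words X \<and> word_val G f v = word_val G f w"
    have "?w \<in> words X \<and> word_val G f ?w = word_val G f w"
      using someI[of "\<lambda>v. v \<in> words X \<and> word_val G f v = word_val G f w" w] that by auto
    then show ?thesis
      unfolding N_def using presents_word_eq_iff[OF pres, of ?w w] that eq[of ?w w y] by blast
  qed
  show ?thesis
  proof (rule that)
    fix g h y assume "g \<in> carrier G" "h \<in> carrier G" "y \<in> M"
    obtain u v where uv: "u \<in> words X" "v \<in> words X" "word_val G f u = g" "word_val G f v = h"
      using presents_surj[OF pres] \<open>g \<in> carrier G\<close> \<open>h \<in> carrier G\<close> by metis
    have "g \<otimes>\<^bsub>G\<^esub> h = word_val G f (u @ v)" using uv word_val_append[OF f] by simp
    moreover have "act (inv\<^bsub>G\<^esub> g) y \<in> M" using \<open>g \<in> carrier G\<close> \<open>y \<in> M\<close> act by auto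
    ultimately show "N (g \<otimes>\<^bsub>G\<^esub> h) y = (N g y \<noteq> N h (act (inv\<^bsub>G\<^esub> g) y))"
      using N[of "u @ v" y] N[of u y] N[of v "act (inv\<^bsub>G\<^esub> g) y"] app[of u y v] uv \<open>y \<in> M\<close> by auto
  next
    fix x y assume "x \<in> X" "y \<in> M"
    have "f x \<in> carrier G" using f \<open>x \<in> X\<close> by (rule funcset_mem)
    then show "N (f x) y = n x y" using N[of "[(x, True)]" y] \<open>x \<in> X\<close> \<open>y \<in> M\<close> by auto
  qed
qed

section \<open>Amalgamated products from presentations\<close>

context
  fixes G :: "('a, 'b) monoid_scheme" and i :: "'a \<Rightarrow> 'x" and A :: "'a set"
    and X :: "'x set" and R :: "'x word set"
  assumes G: "group G" and A: "subgroup A G" and i: "i ` A \<subseteq> X"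
    and R: "mult_table_relators G i A \<subseteq> R"
begin

interpretation group G by (rule G)

lemma mult_table_mult:
  assumes ab: "a \<in> A" "b \<in> A"
  shows "word_eq X R [(i a, True), (i b, True)] [(i (a \<otimes>\<^bsub>G\<^esub> b), True)]"
proof -
  let ?c = "i (a \<otimes>\<^bsub>G\<^esub> b)"
  have X: "i a \<in> X" "i b \<in> X" "?c \<in> X"
    using i ab subgroup.m_closed[OF A ab] by blast+
  have "[(i a, True), (i b, True), (?c, False)] \<in> R"
    using R ab by (auto simp: mult_table_relators_def)
  then have "word_eq X R ([] @ [(i a, True), (i b, True), (?c, False)] @ [(?c, True)])
      ([] @ [(?c, True)])"
    using X by (intro word_eq.relator) auto
  moreover have "word_eq X R ([(i a, True), (i b, True)] @ [(?c, False), (?c, \<not> False)] @ [])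
      ([(i a, True), (i b, True)] @ [])"
    using X by (intro word_eq.cancel) auto
  ultimately show ?thesis by simp (rule word_eq_common)
qed

lemma mult_table_one: "word_eq X R [(i \<one>\<^bsub>G\<^esub>, True)] []"
proof -
  let ?e = "i \<one>\<^bsub>G\<^esub>"
  have e: "\<one>\<^bsub>G\<^esub> \<in> A" using A by (rule subgroup.one_closed)
  then have X: "?e \<in> X" using i by auto
  have "word_eq X R [(?e, True), (?e, True)] [(?e, True)]"
    using mult_table_mult[OF e e] by simp
  then have "word_eq X R ([] @ [(?e, True), (?e, True)] @ [(?e, False)]) ([] @ [(?e, True)] @ [(?e, False)])"
    by (rule word_eq_context) (use X in auto)
  moreover have "word_eq X R ([] @ [(?e, True), (?e, \<not> True)] @ []) ([] @ [])"
    using X by (intro word_eq.cancel) auto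
  moreover have "word_eq X R ([(?e, True)] @ [(?e, True), (?e, \<not> True)] @ []) ([(?e, True)] @ [])"
    using X by (intro word_eq.cancel) auto
  ultimately show ?thesis by simp (metis word_eq_common)
qed

lemma mult_table_inv:
  assumes a: "a \<in> A"
  shows "word_eq X R [(i a, False)] [(i (inv\<^bsub>G\<^esub> a), True)]"
proof -
  let ?b = "i (inv\<^bsub>G\<^esub> a)"
  have b: "inv\<^bsub>G\<^esub> a \<in> A" using A a by (rule subgroup.m_inv_closed)
  have X: "i a \<in> X" "?b \<in> X" using i a b by auto
  have "a \<otimes>\<^bsub>G\<^esub> inv\<^bsub>G\<^esub> a = \<one>\<^bsub>G\<^esub>" using a A by (simp add: subgroup.mem_carrier)
  then have "word_eq X R [(i a, True), (?b, True)] []"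
    using word_eq.trans[OF mult_table_mult[OF a b]] mult_table_one by simp
  then have "word_eq X R ([(i a, False)] @ [(i a, True), (?b, True)] @ []) ([(i a, False)] @ [] @ [])"
    by (rule word_eq_context) (use X in auto)
  moreover have "word_eq X R ([] @ [(i a, False), (i a, \<not> False)] @ [(?b, True)]) ([] @ [(?b, True)])"
    using X by (intro word_eq.cancel) auto
  ultimately show ?thesis by simp (rule word_eq_common)
qed

text \<open>The multiplication table contracts a word from the right into one letter. The map
  \<open>\<tau>\<close> allows the letters of the word to differ from the copies under
  \<open>i\<close> of the elements they stand for: a generator common to both factors of an amalgam
  is spelled with the left copy but sometimes has to be read in the right one.\<close>

lemma mult_table_word_val:
  assumes f: "f \<in> Y \<rightarrow> A"
    and \<tau>: "\<tau> ` Y \<subseteq> X" "\<And>y. y \<in> Y \<Longrightarrow> word_eq X R [(\<tau> y, True)] [(i (f y), True)]"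
    and w: "w \<in> words Y"
  shows "word_eq X R (map (\<lambda>(y, e). (\<tau> y, e)) w) [(i (word_val G f w), True)]"
  using w
proof (induction w)
  case Nil
  then show ?case using mult_table_one by (auto intro: word_eq.sym)
next
  case (Cons l w)
  obtain y e where l: "l = (y, e)" by (cases l)
  have y: "y \<in> Y" "w \<in> words Y" using Cons l by auto
  have fy: "f y \<in> A" "inv\<^bsub>G\<^esub> (f y) \<in> A"
    using f y A by (auto intro: subgroup.m_inv_closed)
  have "set w \<subseteq> Y \<times> UNIV" using y by auto
  then have val: "word_val G f w \<in> A"
  proof (induction w)
    case (Cons l w)
    then have "f (fst l) \<in> A" using f by auto
    then show ?case
      using Cons A by (cases l) (auto intro: subgroup.m_closed subgroup.m_inv_closed)
  qed (simp add: A subgroup.one_closed)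
  have X: "\<tau> y \<in> X" "i (f y) \<in> X" "i (inv\<^bsub>G\<^esub> (f y)) \<in> X" "i (word_val G f w) \<in> X"
    using y \<tau>(1) fy i val by auto
  let ?g = "if e then f y else inv\<^bsub>G\<^esub> (f y)"
  have l': "word_eq X R [(\<tau> y, e)] [(i ?g, True)]"
  proof (cases e)
    case False
    let ?p = "[(\<tau> y, False), (\<tau> y, True), (i (f y), False)]"
    let ?q = "[(\<tau> y, False), (i (f y), True), (i (f y), False)]"
    have "word_eq X R ([(\<tau> y, False)] @ [(\<tau> y, True)] @ [(i (f y), False)])
        ([(\<tau> y, False)] @ [(i (f y), True)] @ [(i (f y), False)])"
      using \<tau>(2)[OF y(1)] by (rule word_eq_context) (use X in auto)
    then have pq: "word_eq X R ?p ?q" by simp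
    have "word_eq X R ([] @ [(\<tau> y, False), (\<tau> y, \<not> False)] @ [(i (f y), False)])
       ([] @ [(i (f y), False)])"
      using X by (intro word_eq.cancel) auto
    then have p: "word_eq X R ?p [(i (f y), False)]" by simp
    have "word_eq X R ([(\<tau> y, False)] @ [(i (f y), True), (i (f y), \<not> True)] @ [])
       ([(\<tau> y, False)] @ [])"
      using X by (intro word_eq.cancel) auto
    then have q: "word_eq X R ?q [(\<tau> y, False)]" by simp
    have "word_eq X R [(\<tau> y, False)] [(i (f y), False)]"
      by (rule word_eq.trans[OF word_eq.sym[OF q] word_eq.trans[OF word_eq.sym[OF pq] p]])
    then show ?thesis using word_eq.trans[OF _ mult_table_inv[OF fy(1)]] False by simp
  qed (use \<tau> y in auto)
  let ?v = "i (word_val G f w)"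
  have "word_eq X R ([(\<tau> y, e)] @ map (\<lambda>(y, e). (\<tau> y, e)) w @ []) ([(\<tau> y, e)] @ [(?v, True)] @ [])"
    using Cons.IH by (rule word_eq_context) (use X in auto)
  then have 1: "word_eq X R (map (\<lambda>(y, e). (\<tau> y, e)) (l # w)) [(\<tau> y, e), (?v, True)]"
    using l by simp
  have "word_eq X R ([] @ [(\<tau> y, e)] @ [(?v, True)]) ([] @ [(i ?g, True)] @ [(?v, True)])"
    using l' by (rule word_eq_context) (use X in auto)
  then have 2: "word_eq X R [(\<tau> y, e), (?v, True)] [(i ?g, True), (?v, True)]"
    by simp
  have "?g \<in> A" using fy by simp
  then have "word_eq X R [(i ?g, True), (?v, True)] [(i (?g \<otimes>\<^bsub>G\<^esub> word_val G f w), True)]"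
    using val by (rule mult_table_mult)
  with 1 2 have "word_eq X R (map (\<lambda>(y, e). (\<tau> y, e)) (l # w)) [(i (?g \<otimes>\<^bsub>G\<^esub> word_val G f w), True)]"
    using word_eq.trans by meson
  then show ?case using l by simp
qed

end

text \<open>Every relator involves letters of one side only, hence follows from the multiplication
  table of the subgroup generated by that side. Since this table contains all relations holding in
  the subgroup, the two factors enter without presentations of their own.\<close>

lemma amalgamated_product_of_presentation:
  assumes pres: "presents G f (X1 \<union> X2) R" and R: "R \<subseteq> words X1 \<union> words X2"
  shows "amalgamated_product G (generate G (f ` X1)) (generate G (f ` (X1 \<inter> X2))) (generate G (f ` X2))"
proof -
  let ?X = "X1 \<union> X2"
  interpret group G using assms by (simp add: presents_def)
  have f: "f \<in> ?X \<rightarrow> carrier G" and RX: "R \<subseteq> words ?X" and gen: "generate G (f ` ?X) = carrier G"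
    using pres by (auto simp: presents_def)
  have fX: "f ` ?X \<subseteq> carrier G" "f ` X1 \<subseteq> carrier G" "f ` X2 \<subseteq> carrier G" "f ` (X1 \<inter> X2) \<subseteq> carrier G"
    using f by auto
  define A where "A = generate G (f ` X1)"
  define B where "B = generate G (f ` X2)"
  define C where "C = generate G (f ` (X1 \<inter> X2))"
  have A: "subgroup A G" and B: "subgroup B G" and C: "subgroup C G"
    unfolding A_def B_def C_def using fX by (auto intro: generate_is_subgroup)
  have CA: "C \<subseteq> A" and CB: "C \<subseteq> B"
    unfolding A_def B_def C_def by (auto intro!: mono_generate)
  have fA: "f \<in> X1 \<rightarrow> A" and fB: "f \<in> X2 \<rightarrow> B" and fC: "f \<in> X1 \<inter> X2 \<rightarrow> C"
    unfolding A_def B_def C_def by (auto intro: generate.incl)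
  define Y where "Y = A <+> B"
  define Q where "Q = mult_table_relators G Inl A \<union> mult_table_relators G Inr B \<union>
        {[(Inl c, True), (Inr c, False)] | c. c \<in> C}"
  let ?g = "case_sum id id"
  have QY: "Q \<subseteq> words Y"
    unfolding Q_def Y_def mult_table_relators_def using CA CB
    by (auto intro: subgroup.m_closed[OF A] subgroup.m_closed[OF B])
  have g: "?g \<in> Y \<rightarrow> carrier G"
    unfolding Y_def using A B by (auto simp: subgroup.mem_carrier)
  have Qone: "word_val G ?g q = \<one>\<^bsub>G\<^esub>" if "q \<in> Q" for q
    using that A B C unfolding Q_def mult_table_relators_def
    by (auto simp: subgroup.mem_carrier m_assoc[symmetric])
  have sound: "word_val G ?g u = word_val G ?g v" if "word_eq Y Q u v" for u v
    using word_val_cong[OF that g QY Qone] .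
  \<comment> \<open>A generator in \<open>X1 \<inter> X2\<close> is spelled with the left copy;
    \<open>InlC\<close> transfers it to the right copy when a word in \<open>X2\<close> is
    read.\<close>
  define \<tau> where "\<tau> x = (if x \<in> X1 then Inl (f x) else Inr (f x))" for x
  let ?t = "map (\<lambda>(x, e). (\<tau> x, e))"
  have tY: "\<tau> ` ?X \<subseteq> Y" unfolding \<tau>_def Y_def using fA fB by auto
  have tw: "?t w \<in> words Y" if "w \<in> words ?X" for w
    using that tY by fastforce
  have tval: "word_val G ?g (?t w) = word_val G f w" if "w \<in> words ?X" for w
    using that by (induction w) (auto simp: \<tau>_def)
  have InlC: "word_eq Y Q [(Inl c, True)] [(Inr c, True)]" if "c \<in> C" for c
  proof -
    have cY: "Inl c \<in> Y" "Inr c \<in> Y" using that CA CB by (auto simp: Y_def)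
    have "word_eq Y Q ([] @ [(Inl c, True), (Inr c, False)] @ [(Inr c, True)]) ([] @ [(Inr c, True)])"
      using that cY by (intro word_eq.relator) (auto simp: Q_def)
    moreover have "word_eq Y Q ([(Inl c, True)] @ [(Inr c, False), (Inr c, \<not> False)] @ []) ([(Inl c, True)] @ [])"
      using cY by (intro word_eq.cancel) auto
    ultimately show ?thesis by simp (rule word_eq_common)
  qed
  have t1: "word_eq Y Q (?t w) [(Inl (word_val G f w), True)]" if "w \<in> words X1" for w
  proof (rule mult_table_word_val[OF is_group A _ _ fA _ _ that])
    fix x assume "x \<in> X1"
    then have "Inl (f x) \<in> Y" using fA by (auto simp: Y_def)
    then show "word_eq Y Q [(\<tau> x, True)] [(Inl (f x), True)]"
      using \<open>x \<in> X1\<close> by (auto simp: \<tau>_def intro: word_eq.refl)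
  qed (use tY in \<open>auto simp: Y_def Q_def\<close>)
  have t2: "word_eq Y Q (?t w) [(Inr (word_val G f w), True)]" if "w \<in> words X2" for w
  proof (rule mult_table_word_val[OF is_group B _ _ fB _ _ that])
    fix x assume "x \<in> X2"
    then have "Inr (f x) \<in> Y" using fB by (auto simp: Y_def)
    then show "word_eq Y Q [(\<tau> x, True)] [(Inr (f x), True)]"
      using \<open>x \<in> X2\<close> fC by (auto simp: \<tau>_def intro: word_eq.refl InlC)
  qed (use tY in \<open>auto simp: Y_def Q_def\<close>)
  have one1: "word_eq Y Q [(Inl \<one>\<^bsub>G\<^esub>, True)] []"
    by (rule mult_table_one[OF is_group A]) (auto simp: Y_def Q_def)
  have one2: "word_eq Y Q [(Inr \<one>\<^bsub>G\<^esub>, True)] []"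
    by (rule mult_table_one[OF is_group B]) (auto simp: Y_def Q_def)
  have tcong: "word_eq Y Q (?t u) (?t v)" if "word_eq ?X R u v" for u v
    using that
  proof induction
    case (refl w)
    then show ?case using tw by (blast intro: word_eq.refl)
  next
    case (cancel u v x e)
    have "word_eq Y Q (?t u @ [(\<tau> x, e), (\<tau> x, \<not> e)] @ ?t v) (?t u @ ?t v)"
      using cancel tw tY by (intro word_eq.cancel) blast+
    then show ?case by simp
  next
    case (relator u v r)
    have r: "word_val G f r = \<one>\<^bsub>G\<^esub>"
    proof -
      have "word_eq ?X R ([] @ r @ []) ([] @ [])"
        using relator RX by (intro word_eq.relator) auto
      then show ?thesis using presents_word_eq_iff[OF pres, of r "[]"] relator RX by auto
    qed
    have "word_eq Y Q (?t r) []"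
    proof (cases "r \<in> words X1")
      case True
      then have "word_eq Y Q (?t r) [(Inl \<one>\<^bsub>G\<^esub>, True)]" using t1[of r] r by simp
      then show ?thesis using one1 by (rule word_eq.trans)
    next
      case False
      then have "r \<in> words X2" using relator R by auto
      then have "word_eq Y Q (?t r) [(Inr \<one>\<^bsub>G\<^esub>, True)]" using t2[of r] r by simp
      then show ?thesis using one2 by (rule word_eq.trans)
    qed
    then have "word_eq Y Q (?t u @ ?t r @ ?t v) (?t u @ [] @ ?t v)"
      by (rule word_eq_context) (use relator tw in blast)+
    then show ?case by simp
  qed (blast intro: word_eq.sym word_eq.trans)+
  \<comment> \<open>Each element of \<open>A\<close> or \<open>B\<close> is a word in its
    generators, so up to \<open>word_eq\<close> the translation \<open>?t\<close> is onto. Hence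
    triviality only has to be decided for translated words.\<close>
  have letter: "\<exists>v \<in> words ?X. word_eq Y Q [(y, e)] (?t v)" if "y \<in> Y" for y e
  proof -
    have pos: "\<exists>v \<in> words ?X. word_eq Y Q [(y, True)] (?t v)" if "y \<in> Y" for y
    proof (cases y)
      case (Inl a)
      then have "a \<in> generate G (f ` X1)" using that by (auto simp: Y_def A_def)
      then obtain v where v: "v \<in> words X1" "word_val G f v = a"
        using generate_word_val[of f X1 a] f by auto
      then have "v \<in> words ?X" by auto
      then show ?thesis using v t1[of v] Inl by (auto intro: word_eq.sym)
    next
      case (Inr a)
      then have "a \<in> generate G (f ` X2)" using that by (auto simp: Y_def B_def)
      then obtain v where v: "v \<in> words X2" "word_val G f v = a"
        using generate_word_val[of f X2 a] f by auto
      then have "v \<in> words ?X" by auto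
      then show ?thesis using v t2[of v] Inr by (auto intro: word_eq.sym)
    qed
    show ?thesis
    proof (cases e)
      case False
      have "\<exists>z \<in> Y. word_eq Y Q [(y, False)] [(z, True)]"
      proof (cases y)
        case (Inl a)
        then have "a \<in> A" using \<open>y \<in> Y\<close> by (auto simp: Y_def)
        then have "word_eq Y Q [(Inl a, False)] [(Inl (inv\<^bsub>G\<^esub> a), True)]"
          by (intro mult_table_inv[OF is_group A]) (auto simp: Y_def Q_def)
        moreover have "inv\<^bsub>G\<^esub> a \<in> A" using A \<open>a \<in> A\<close> by (rule subgroup.m_inv_closed)
        ultimately show ?thesis using Inl by (auto simp: Y_def)
      next
        case (Inr a)
        then have "a \<in> B" using \<open>y \<in> Y\<close> by (auto simp: Y_def)
        then have "word_eq Y Q [(Inr a, False)] [(Inr (inv\<^bsub>G\<^esub> a), True)]"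
          by (intro mult_table_inv[OF is_group B]) (auto simp: Y_def Q_def)
        moreover have "inv\<^bsub>G\<^esub> a \<in> B" using B \<open>a \<in> B\<close> by (rule subgroup.m_inv_closed)
        ultimately show ?thesis using Inr by (auto simp: Y_def)
      qed
      then obtain z where z: "z \<in> Y" "word_eq Y Q [(y, False)] [(z, True)]" by blast
      from pos[OF z(1)] obtain v where "v \<in> words ?X" "word_eq Y Q [(z, True)] (?t v)" by blast
      moreover from this have "word_eq Y Q [(y, e)] (?t v)"
        using word_eq.trans[OF z(2)] False by simp
      ultimately show ?thesis by blast
    qed (use pos that in auto)
  qed
  have trans: "\<exists>v \<in> words ?X. word_eq Y Q w (?t v)" if "w \<in> words Y" for w
    using that
  proof (induction w)
    case Nil
    then show ?case by (auto intro!: bexI[of _ "[]"] word_eq.refl)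
  next
    case (Cons l w)
    obtain y e where l: "l = (y, e)" by (cases l)
    then obtain u v where u: "u \<in> words ?X" "word_eq Y Q [(y, e)] (?t u)"
      and v: "v \<in> words ?X" "word_eq Y Q w (?t v)"
      using Cons letter[of y e] by auto
    have "word_eq Y Q ([] @ [(y, e)] @ w) ([] @ ?t u @ w)"
      using u(2) by (rule word_eq_context) (use Cons in auto)
    moreover have "word_eq Y Q (?t u @ w @ []) (?t u @ ?t v @ [])"
      using v(2) by (rule word_eq_context) (use tw u in auto)
    ultimately have "word_eq Y Q (l # w) (?t (u @ v))"
      using l word_eq.trans by fastforce
    then show ?case using u v by (intro bexI[of _ "u @ v"]) auto
  qed
  have "word_val G ?g w = \<one>\<^bsub>G\<^esub> \<longleftrightarrow> word_eq Y Q w []" if "w \<in> words Y" for w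
  proof
    assume w: "word_val G ?g w = \<one>\<^bsub>G\<^esub>"
    obtain v where v: "v \<in> words ?X" "word_eq Y Q w (?t v)" using trans \<open>w \<in> words Y\<close> by blast
    then have "word_val G f v = \<one>\<^bsub>G\<^esub>" using sound[OF v(2)] tval w by simp
    then have "word_eq ?X R v []" using pres v(1) by (simp add: presents_def)
    then have "word_eq Y Q (?t v) []" using tcong[of v "[]"] by simp
    with v(2) show "word_eq Y Q w []" by (rule word_eq.trans)
  next
    assume "word_eq Y Q w []"
    from sound[OF this] show "word_val G ?g w = \<one>\<^bsub>G\<^esub>" by simp
  qed
  moreover have "generate G (?g ` Y) = carrier G"
  proof -
    have "f ` ?X \<subseteq> ?g ` Y"
    proof
      fix z assume "z \<in> f ` ?X"
      then obtain x where x: "x \<in> ?X" "z = f x" by auto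
      then have "z = ?g (\<tau> x)" by (auto simp: \<tau>_def)
      then show "z \<in> ?g ` Y" using tY x by blast
    qed
    then have "carrier G \<subseteq> generate G (?g ` Y)" using mono_generate gen by metis
    moreover have "?g ` Y \<subseteq> carrier G" using g by auto
    ultimately show ?thesis using generate_incl by blast
  qed
  ultimately have "presents G ?g Y Q"
    unfolding presents_def using QY g is_group by auto
  then show ?thesis
    unfolding amalgamated_product_def using A B C CA CB
    by (simp add: Y_def Q_def flip: A_def B_def C_def)
qed

section \<open>Conjugation and finite index\<close>

lemma (in group) conjugate_eq_image: "conjugate G g H = (\<lambda>x. g \<otimes> x \<otimes> inv g) ` H"
  by (auto simp: conjugate_def l_coset_def r_coset_def)

lemma (in group) mem_conjugate_iff:
  assumes "g \<in> carrier G" and "H \<subseteq> carrier G" and "x \<in> carrier G"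
  shows "x \<in> conjugate G g H \<longleftrightarrow> inv g \<otimes> x \<otimes> g \<in> H"
proof
  assume "x \<in> conjugate G g H"
  then obtain h where "h \<in> H" "x = g \<otimes> h \<otimes> inv g" by (auto simp: conjugate_eq_image)
  moreover from this have "h \<in> carrier G" using assms by auto
  ultimately show "inv g \<otimes> x \<otimes> g \<in> H" using assms by (simp add: m_assoc)
next
  assume "inv g \<otimes> x \<otimes> g \<in> H"
  moreover have "x = g \<otimes> (inv g \<otimes> x \<otimes> g) \<otimes> inv g" using assms by (simp add: m_assoc)
  ultimately show "x \<in> conjugate G g H" by (auto simp: conjugate_eq_image)
qed

lemma (in group) group_hom_conjugation:
  "g \<in> carrier G \<Longrightarrow> group_hom G G (\<lambda>x. g \<otimes> x \<otimes> inv g)"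
  by unfold_locales (auto simp: hom_def m_assoc)

lemma (in group) conjugate_generate:
  assumes "g \<in> carrier G" and "A \<subseteq> carrier G"
  shows "conjugate G g (generate G A) = generate G ((\<lambda>x. g \<otimes> x \<otimes> inv g) ` A)"
  using group_hom.generate_img[OF group_hom_conjugation[OF assms(1)] assms(2)]
  by (simp add: conjugate_eq_image)

lemma (in group) subgroup_conjugate:
  assumes "g \<in> carrier G" and "subgroup H G"
  shows "subgroup (conjugate G g H) G"
  using group_hom.subgroup_img_is_subgroup[OF group_hom_conjugation[OF assms(1)] assms(2)]
  by (simp add: conjugate_eq_image)

lemma (in group) conjugate_mult:
  assumes "g \<in> carrier G" and "h \<in> carrier G" and "H \<subseteq> carrier G"
  shows "conjugate G (g \<otimes> h) H = conjugate G g (conjugate G h H)"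
proof -
  have "g \<otimes> h \<otimes> x \<otimes> inv (g \<otimes> h) = g \<otimes> (h \<otimes> x \<otimes> inv h) \<otimes> inv g" if "x \<in> H" for x
    using assms that by (auto simp: inv_mult_group m_assoc subset_iff)
  then show ?thesis by (auto simp: conjugate_eq_image image_image)
qed

lemma (in group) conjugate_subset_carrier:
  "g \<in> carrier G \<Longrightarrow> H \<subseteq> carrier G \<Longrightarrow> conjugate G g H \<subseteq> carrier G"
  by (auto simp: conjugate_eq_image)

lemma (in group) conjugate_one: "H \<subseteq> carrier G \<Longrightarrow> conjugate G \<one> H = H"
  by (force simp: conjugate_eq_image image_iff)

lemma (in group) conjugate_mono: "H \<subseteq> K \<Longrightarrow> conjugate G g H \<subseteq> conjugate G g K"
  by (auto simp: conjugate_eq_image)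

lemma (in group) conjugate_self:
  assumes "subgroup H G" and "h \<in> H"
  shows "conjugate G h H = H"
proof -
  interpret H: subgroup H G by fact
  have h: "h \<in> carrier G" "inv h \<in> H" using assms by auto
  have "x \<in> conjugate G h H" if "x \<in> H" for x
    using that h assms by (subst mem_conjugate_iff) auto
  moreover have "conjugate G h H \<subseteq> H" using h assms by (auto simp: conjugate_eq_image)
  ultimately show ?thesis by auto
qed

lemma (in group) presents_conjugate:
  assumes pres: "presents G f X R" and g: "g \<in> carrier G"
  shows "presents G (\<lambda>x. g \<otimes> f x \<otimes> inv g) X R"
proof -
  have f: "f \<in> X \<rightarrow> carrier G" using pres by (simp add: presents_def)
  let ?f = "\<lambda>x. g \<otimes> f x \<otimes> inv g"
  have val: "word_val G ?f w = g \<otimes> word_val G f w \<otimes> inv g" if "w \<in> words X" for w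
    using that
  proof (induction w)
    case (Cons l w)
    obtain x e where l: "l = (x, e)" by (cases l)
    have x: "f x \<in> carrier G" using f Cons.hyps(1) l by auto
    have "word_val G f w \<in> carrier G" using word_val_closed[OF f Cons.hyps(2)] .
    then show ?case using Cons.IH x g l by (simp add: m_assoc inv_mult_group)
  qed (use g in simp)
  have "g \<otimes> y \<otimes> inv g = \<one> \<longleftrightarrow> y = \<one>" if "y \<in> carrier G" for y
  proof
    assume "g \<otimes> y \<otimes> inv g = \<one>"
    then have "inv g \<otimes> (g \<otimes> y \<otimes> inv g) \<otimes> g = \<one>" using g by simp
    then show "y = \<one>" using g that by (simp add: m_assoc)
  qed (use g in simp)
  then have "word_val G ?f w = \<one> \<longleftrightarrow> word_val G f w = \<one>" if "w \<in> words X" for w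
    using val[OF that] word_val_closed[OF f that] by simp
  moreover have "generate G (?f ` X) = carrier G"
  proof -
    have "generate G (?f ` X) = conjugate G g (generate G (f ` X))"
      using f by (subst conjugate_generate[OF g]) (auto simp: image_image)
    also have "\<dots> = carrier G"
      using pres conjugate_self[OF subgroup_self g] by (simp add: presents_def)
    finally show ?thesis .
  qed
  ultimately show ?thesis
    using pres f g unfolding presents_def by (simp add: Pi_iff)
qed


text \<open>Cosets are traded for a finite set of representatives, so that indices in different
  subgroups \<open>K\<close> can be compared inside the one group \<open>G\<close>.\<close>

lemma (in group) finite_index_iff:
  assumes H: "subgroup H G" and K: "subgroup K G" and HK: "H \<subseteq> K"
  shows "finite_index G H K \<longleftrightarrow> (\<exists>F. finite F \<and> F \<subseteq> K \<and> (\<forall>k \<in> K. \<exists>a \<in> F. k \<otimes> inv a \<in> H))"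
proof -
  interpret H: subgroup H G by fact
  interpret K: subgroup K G by fact
  have cosets: "rcosets\<^bsub>G\<lparr>carrier := K\<rparr>\<^esub> H = (\<lambda>a. H #> a) ` K"
    by (auto simp: RCOSETS_def r_coset_def)
  have eq: "H #> k = H #> a \<longleftrightarrow> k \<otimes> inv a \<in> H" if "k \<in> K" "a \<in> K" for k a
  proof
    assume "H #> k = H #> a"
    moreover have "k \<in> H #> k" using that by (intro rcos_self H) auto
    ultimately obtain h where "h \<in> H" "k = h \<otimes> a" by (auto simp: r_coset_def)
    then show "k \<otimes> inv a \<in> H" using that by (simp add: m_assoc)
  next
    assume h: "k \<otimes> inv a \<in> H"
    have "k = k \<otimes> inv a \<otimes> a" using that by (simp add: m_assoc)
    then have "k \<in> H #> a" using h by (auto simp: r_coset_def)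
    then show "H #> k = H #> a" using repr_independence[of k H a] H that by auto
  qed
  show ?thesis
  proof
    assume "finite_index G H K"
    then have "finite ((\<lambda>a. H #> a) ` K)" by (simp add: finite_index_def cosets)
    then obtain F where F: "F \<subseteq> K" "finite F" "(\<lambda>a. H #> a) ` K = (\<lambda>a. H #> a) ` F"
      using finite_subset_image[of "(\<lambda>a. H #> a) ` K" "\<lambda>a. H #> a" K] by auto
    have "\<exists>a \<in> F. k \<otimes> inv a \<in> H" if "k \<in> K" for k
    proof -
      have "H #> k \<in> (\<lambda>a. H #> a) ` F" using that F(3) by blast
      then show ?thesis using eq that F(1) by blast
    qed
    then show "\<exists>F. finite F \<and> F \<subseteq> K \<and> (\<forall>k \<in> K. \<exists>a \<in> F. k \<otimes> inv a \<in> H)" using F by blast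
  next
    assume "\<exists>F. finite F \<and> F \<subseteq> K \<and> (\<forall>k \<in> K. \<exists>a \<in> F. k \<otimes> inv a \<in> H)"
    then obtain F where F: "finite F" "F \<subseteq> K" "\<forall>k \<in> K. \<exists>a \<in> F. k \<otimes> inv a \<in> H" by blast
    have "(\<lambda>a. H #> a) ` K \<subseteq> (\<lambda>a. H #> a) ` F"
    proof
      fix c assume "c \<in> (\<lambda>a. H #> a) ` K"
      then obtain k where k: "k \<in> K" "c = H #> k" by auto
      then obtain a where "a \<in> F" "k \<otimes> inv a \<in> H" using F by auto
      then show "c \<in> (\<lambda>a. H #> a) ` F" using eq[of k a] k F(2) by auto
    qed
    then show "finite_index G H K"
      using F(1) finite_subset unfolding finite_index_def cosets by blast
  qed
qed

lemma (in group) finite_indexI: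
  assumes "subgroup H G" "subgroup K G" "H \<subseteq> K" "finite F" "F \<subseteq> K"
    and "\<And>k. k \<in> K \<Longrightarrow> \<exists>a \<in> F. k \<otimes> inv a \<in> H"
  shows "finite_index G H K"
  using assms by (subst finite_index_iff) auto

lemma (in group) finite_indexE:
  assumes "finite_index G H K" "subgroup H G" "subgroup K G" "H \<subseteq> K"
  obtains F where "finite F" "F \<subseteq> K" "\<And>k. k \<in> K \<Longrightarrow> \<exists>a \<in> F. k \<otimes> inv a \<in> H"
  using assms by (subst (asm) finite_index_iff) auto

lemma (in group) finite_index_mono:
  assumes "finite_index G H K" "subgroup H G" "subgroup H' G" "subgroup K G" "H \<subseteq> H'" "H' \<subseteq> K"
  shows "finite_index G H' K"
proof -
  have "H \<subseteq> K" using assms by blast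
  with assms(1,2,4) obtain F where F: "finite F" "F \<subseteq> K"
    "\<And>k. k \<in> K \<Longrightarrow> \<exists>a \<in> F. k \<otimes> inv a \<in> H"
    by (rule finite_indexE) blast
  have "\<exists>a \<in> F. k \<otimes> inv a \<in> H'" if "k \<in> K" for k using F(3)[OF that] assms(5) by blast
  with assms(3,4,6) F(1,2) show ?thesis by (rule finite_indexI)
qed

lemma (in group) finite_index_Int:
  assumes "finite_index G H K" "subgroup H G" "subgroup K G" "subgroup L G" "H \<subseteq> K" "L \<subseteq> K"
  shows "finite_index G (H \<inter> L) L"
proof -
  interpret H: subgroup H G by fact
  interpret L: subgroup L G by fact
  obtain F where F: "finite F" "F \<subseteq> K" "\<And>k. k \<in> K \<Longrightarrow> \<exists>a \<in> F. k \<otimes> inv a \<in> H"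
    using assms(1,2,3,5) by (rule finite_indexE) blast
  have Fc: "F \<subseteq> carrier G" using F(2) assms(3) by (auto simp: subgroup.mem_carrier)
  \<comment> \<open>The representatives in \<open>F\<close> need not lie in \<open>L\<close>; a
    coset that meets \<open>L\<close> gets a new representative \<open>r a\<close> in
    \<open>L\<close>.\<close>
  define r where "r a = (SOME l. l \<in> L \<and> l \<otimes> inv a \<in> H)" for a
  let ?F = "r ` {a \<in> F. \<exists>l \<in> L. l \<otimes> inv a \<in> H}"
  have r: "r a \<in> L \<and> r a \<otimes> inv a \<in> H" if "\<exists>l \<in> L. l \<otimes> inv a \<in> H" for a
    unfolding r_def using someI_ex[of "\<lambda>l. l \<in> L \<and> l \<otimes> inv a \<in> H"] that by blast
  have "\<exists>b \<in> ?F. l \<otimes> inv b \<in> H \<inter> L" if l: "l \<in> L" for l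
  proof -
    obtain a where a: "a \<in> F" "l \<otimes> inv a \<in> H" using F(3) l assms(6) by blast
    then have ra: "r a \<in> L" "r a \<otimes> inv a \<in> H" using r l by blast+
    have "l \<otimes> inv (r a) = (l \<otimes> inv a) \<otimes> inv (r a \<otimes> inv a)"
      using l ra(1) a(1) Fc by (auto simp: m_assoc inv_mult_group subset_iff)
    then have "l \<otimes> inv (r a) \<in> H" using a(2) ra(2) by simp
    then show ?thesis using l ra a by auto
  qed
  moreover have "finite ?F" "?F \<subseteq> L" using F(1) r by auto
  moreover have "subgroup (H \<inter> L) G" using assms by (auto intro: subgroups_Inter_pair)
  ultimately show ?thesis using assms(4) by (intro finite_indexI[where F = ?F]) auto
qed

lemma (in group) finite_index_trans:
  assumes "finite_index G H K" "finite_index G K L" "subgroup H G" "subgroup K G" "subgroup L G"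
    "H \<subseteq> K" "K \<subseteq> L"
  shows "finite_index G H L"
proof -
  interpret H: subgroup H G by fact
  interpret K: subgroup K G by fact
  interpret L: subgroup L G by fact
  obtain E where E: "finite E" "E \<subseteq> K" "\<And>k. k \<in> K \<Longrightarrow> \<exists>a \<in> E. k \<otimes> inv a \<in> H"
    using assms(1,3,4,6) by (rule finite_indexE) blast
  obtain F where F: "finite F" "F \<subseteq> L" "\<And>k. k \<in> L \<Longrightarrow> \<exists>a \<in> F. k \<otimes> inv a \<in> K"
    using assms(2,4,5,7) by (rule finite_indexE) blast
  let ?F = "(\<lambda>(a, b). a \<otimes> b) ` (E \<times> F)"
  have "\<exists>c \<in> ?F. l \<otimes> inv c \<in> H" if l: "l \<in> L" for l
  proof -
    obtain b where b: "b \<in> F" "l \<otimes> inv b \<in> K" using F(3) l by blast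
    then obtain a where a: "a \<in> E" "l \<otimes> inv b \<otimes> inv a \<in> H" using E(3) by blast
    have "l \<otimes> inv (a \<otimes> b) = l \<otimes> inv b \<otimes> inv a"
      using l a(1) b(1) E(2) F(2) by (auto simp: m_assoc inv_mult_group subset_iff)
    then have "l \<otimes> inv (a \<otimes> b) \<in> H" using a by simp
    then show ?thesis using a b by auto
  qed
  moreover have "a \<otimes> b \<in> L" if "a \<in> E" "b \<in> F" for a b
    using that E(2) F(2) assms(7) by (intro L.m_closed) auto
  then have "finite ?F" "?F \<subseteq> L" using E(1) F(1) by auto
  moreover have "H \<subseteq> L" using assms by blast
  ultimately show ?thesis using assms(3,5) by (intro finite_indexI[where F = ?F])
qed

lemma (in group) finite_index_conjugate:
  assumes "finite_index G H K" and H: "subgroup H G" and K: "subgroup K G" and "H \<subseteq> K"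
    and g: "g \<in> carrier G"
  shows "finite_index G (conjugate G g H) (conjugate G g K)"
proof -
  interpret H: subgroup H G by fact
  interpret K: subgroup K G by fact
  obtain F where F: "finite F" "F \<subseteq> K" "\<And>k. k \<in> K \<Longrightarrow> \<exists>a \<in> F. k \<otimes> inv a \<in> H"
    using assms(1-4) by (rule finite_indexE) blast
  let ?F = "conjugate G g F"
  have "\<exists>b \<in> ?F. x \<otimes> inv b \<in> conjugate G g H" if "x \<in> conjugate G g K" for x
  proof -
    from that obtain k where k: "k \<in> K" "x = g \<otimes> k \<otimes> inv g"
      unfolding conjugate_eq_image by (elim imageE)
    obtain a where a: "a \<in> F" "k \<otimes> inv a \<in> H" using F(3) k by blast
    have "a \<in> carrier G" "k \<in> carrier G" using a k F(2) by auto
    then have "x \<otimes> inv (g \<otimes> a \<otimes> inv g) = g \<otimes> (k \<otimes> inv a) \<otimes> inv g"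
      using k(2) g by (simp add: m_assoc inv_mult_group)
    then have "x \<otimes> inv (g \<otimes> a \<otimes> inv g) \<in> conjugate G g H" using a(2) by (simp add: conjugate_eq_image)
    moreover have "g \<otimes> a \<otimes> inv g \<in> ?F" using a(1) by (simp add: conjugate_eq_image)
    ultimately show ?thesis by (rule bexI)
  qed
  moreover have "finite ?F" using F(1) by (simp add: conjugate_eq_image)
  moreover have "?F \<subseteq> conjugate G g K" "conjugate G g H \<subseteq> conjugate G g K"
    by (rule conjugate_mono[OF F(2)], rule conjugate_mono[OF assms(4)])
  ultimately show ?thesis
    using subgroup_conjugate[OF g H] subgroup_conjugate[OF g K]
    by (intro finite_indexI[where F = ?F])
qed

section \<open>Inversions in Coxeter groups\<close>

text \<open>A summand of period \<open>n\<close> makes both halves equal and the sum even; this is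
  applied to the \<open>2n\<close> walls met along a Coxeter relator.\<close>

lemma sum_lessThan_double:
  "(\<Sum>j<2 * n. f j) = (\<Sum>j<n. f j + f (n + j))" for f :: "nat \<Rightarrow> 'c :: comm_monoid_add"
proof -
  have "(\<Sum>j<n + k. f j) = (\<Sum>j<n. f j) + (\<Sum>j<k. f (n + j))" for k
    by (induction k) (auto simp: add.assoc)
  from this[of n] show ?thesis by (simp add: sum.distrib mult_2)
qed

locale coxeter = group W for W (structure) +
  fixes S :: "'a set" and m :: "'a \<Rightarrow> 'a \<Rightarrow> enat"
  assumes coxeter: "coxeter_system W S m"
begin

lemma S_closed: "S \<subseteq> carrier W"
  and pres: "presents W id S (coxeter_relators S m)"
  using coxeter by (auto simp: coxeter_system_def)

lemma gen_closed [simp]: "s \<in> S \<Longrightarrow> s \<in> carrier W"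
  using S_closed by auto

lemma generate_S: "generate W S = carrier W"
  using pres by (simp add: presents_def)

lemma word_val_replicate:
  assumes "s \<in> carrier W" "t \<in> carrier W"
  shows "word_val W id (concat (replicate n [(s, True), (t, True)])) = (s \<otimes> t) [^] n"
  using assms
proof (induction n)
  case (Suc n)
  have "(s \<otimes> t) [^] Suc n = (s \<otimes> t) \<otimes> (s \<otimes> t) [^] n"
    using Suc.prems by (intro nat_pow_Suc2) simp
  then show ?case using Suc by (simp add: m_assoc del: nat_pow_Suc)
qed simp

lemma gen_mult_pow:
  assumes "s \<in> S" "t \<in> S" "m s t = enat n"
  shows "(s \<otimes> t) [^] n = \<one>"
proof -
  let ?r = "concat (replicate n [(s, True), (t, True)])"
  have r: "?r \<in> coxeter_relators S m" using assms by (auto simp: coxeter_relators_def)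
  then have rw: "?r \<in> words S" using pres unfolding presents_def by blast
  have "word_eq S (coxeter_relators S m) ([] @ ?r @ []) ([] @ [])"
    by (rule word_eq.relator) (use r in auto)
  then have "word_eq S (coxeter_relators S m) ?r []" by simp
  then have "word_val W id ?r = word_val W id []"
    using presents_word_eq_iff[OF pres rw] by blast
  then show ?thesis using word_val_replicate assms by simp
qed

lemma gen_sq: "s \<in> S \<Longrightarrow> s \<otimes> s = \<one>"
  using gen_mult_pow[of s s 1] coxeter
  by (auto simp: coxeter_system_def coxeter_matrix_def one_enat_def)

lemma gen_inv [simp]: "s \<in> S \<Longrightarrow> inv s = s"
  using gen_sq[of s] by (simp add: inv_equality)

lemma gen_sq_left [simp]: "s \<in> S \<Longrightarrow> x \<in> carrier W \<Longrightarrow> s \<otimes> (s \<otimes> x) = x"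
  using gen_sq[of s] by (simp flip: m_assoc)

text \<open>The gallery spelled by \<open>(st)^k\<close> crosses in turn the walls of the
  reflections \<open>(st)^j s\<close>, and the cocycle records the parity of the crossings of
  \<open>y\<close>. Removing the first two letters conjugates \<open>y\<close> and moves the index
  \<open>j\<close> by two.\<close>

lemma cocycle_replicate:
  assumes st: "s \<in> S" "t \<in> S" and y: "y \<in> carrier W"
  shows "word_cocycle W id (\<lambda>g y. g \<otimes> y \<otimes> inv g) (\<lambda>x y. y = x)
      (concat (replicate k [(s, True), (t, True)])) y \<longleftrightarrow>
    odd (\<Sum>j<2 * k. of_bool (y = (s \<otimes> t) [^] j \<otimes> s) :: nat)"
  using y
proof (induction k arbitrary: y)
  case (Suc k)
  let ?c = "word_cocycle W id (\<lambda>g y. g \<otimes> y \<otimes> inv g) (\<lambda>x y. y = x)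
      (concat (replicate k [(s, True), (t, True)]))"
  let ?q = "s \<otimes> t"
  define f where "f j = (of_bool (y = ?q [^] j \<otimes> s) :: nat)" for j :: nat
  have q: "?q \<in> carrier W" and s: "s \<in> carrier W" and t: "t \<in> carrier W" using st by auto
  let ?y = "t \<otimes> (s \<otimes> y \<otimes> s) \<otimes> t"
  have y': "?y \<in> carrier W" using Suc s t by simp
  have e1: "s \<otimes> y \<otimes> s = t \<longleftrightarrow> y = ?q [^] Suc 0 \<otimes> s"
  proof
    assume a: "s \<otimes> y \<otimes> s = t"
    have "y = s \<otimes> (s \<otimes> y \<otimes> s) \<otimes> s" using Suc.prems st by (simp add: m_assoc gen_sq)
    then show "y = ?q [^] Suc 0 \<otimes> s" using a st by (simp add: m_assoc)
  qed (use st Suc.prems in \<open>simp add: m_assoc gen_sq\<close>)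
  have e2: "?y = ?q [^] j \<otimes> s \<longleftrightarrow> y = ?q [^] Suc (Suc j) \<otimes> s" for j
  proof -
    have p: "?q [^] j \<in> carrier W" using q by simp
    have c: "?q [^] Suc (Suc j) = ?q \<otimes> (?q [^] j \<otimes> ?q)"
      using nat_pow_Suc2[OF q, of "Suc j"] by simp
    have "?y = ?q [^] j \<otimes> s \<longleftrightarrow> s \<otimes> t \<otimes> ?y \<otimes> t \<otimes> s = s \<otimes> t \<otimes> (?q [^] j \<otimes> s) \<otimes> t \<otimes> s"
      using s t p y' by simp
    also have "s \<otimes> t \<otimes> ?y \<otimes> t \<otimes> s = y" using st Suc.prems by (simp add: m_assoc gen_sq)
    also have "s \<otimes> t \<otimes> (?q [^] j \<otimes> s) \<otimes> t \<otimes> s = ?q [^] Suc (Suc j) \<otimes> s"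
      unfolding c using s t p by (simp add: m_assoc)
    finally show ?thesis .
  qed
  have "word_cocycle W id (\<lambda>g y. g \<otimes> y \<otimes> inv g) (\<lambda>x y. y = x)
      (concat (replicate (Suc k) [(s, True), (t, True)])) y \<longleftrightarrow>
      ((y = s) \<noteq> ((s \<otimes> y \<otimes> s = t) \<noteq> ?c ?y))"
    using st by (simp add: m_assoc)
  also have "?c ?y \<longleftrightarrow> odd (\<Sum>j<2 * k. of_bool (?y = ?q [^] j \<otimes> s) :: nat)"
    using Suc.IH[OF y'] .
  also have "(\<Sum>j<2 * k. of_bool (?y = ?q [^] j \<otimes> s) :: nat) = (\<Sum>j<2 * k. f (Suc (Suc j)))"
    by (simp only: e2 f_def)
  also have "y = s \<longleftrightarrow> odd (f 0)" using s by (simp add: f_def)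
  also have "s \<otimes> y \<otimes> s = t \<longleftrightarrow> odd (f (Suc 0))" unfolding e1 by (simp add: f_def)
  also have "(odd (f 0) \<noteq> (odd (f (Suc 0)) \<noteq> odd (\<Sum>j<2 * k. f (Suc (Suc j))))) \<longleftrightarrow>
      odd (f 0 + (f (Suc 0) + (\<Sum>j<2 * k. f (Suc (Suc j)))))"
    by auto
  also have "f 0 + (f (Suc 0) + (\<Sum>j<2 * k. f (Suc (Suc j)))) = (\<Sum>j<2 * Suc k. f j)"
    by (simp only: mult_Suc_right add_2_eq_Suc sum.lessThan_Suc_shift)
  also have "(\<Sum>j<2 * Suc k. f j) = (\<Sum>j<2 * Suc k. of_bool (y = ?q [^] j \<otimes> s))"
    by (simp only: f_def)
  finally show ?case .
qed simp

text \<open>Since \<open>(st)^n = 1\<close>, the \<open>2n\<close> walls along a relator repeat with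
  period \<open>n\<close>, and each is crossed an even number of times. So the rule sending
  \<open>s\<close> to its own wall extends to a cocycle for conjugation.\<close>

lemma ex_inversion:
  "\<exists>N. (\<forall>g \<in> carrier W. \<forall>h \<in> carrier W. \<forall>t \<in> carrier W.
      N (g \<otimes> h) t = (N g t \<noteq> N h (inv g \<otimes> t \<otimes> g))) \<and>
    (\<forall>s \<in> S. \<forall>t \<in> carrier W. N s t = (t = s))"
proof -
  have rel: "\<not> word_cocycle W id (\<lambda>g y. g \<otimes> y \<otimes> inv g) (\<lambda>x y. y = x) r y"
    if "r \<in> coxeter_relators S m" "y \<in> carrier W" for r y
  proof -
    obtain s t n where r: "r = concat (replicate n [(s, True), (t, True)])" "s \<in> S" "t \<in> S" "m s t = enat n"
      using \<open>r \<in> coxeter_relators S m\<close> unfolding coxeter_relators_def by blast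
    have q: "(s \<otimes> t) [^] n = \<one>" using r by (intro gen_mult_pow)
    have "(s \<otimes> t) [^] (n + j) = (s \<otimes> t) [^] j" for j
      using q r by (simp add: nat_pow_mult[symmetric])
    then have "even (\<Sum>j<2 * n. of_bool (y = (s \<otimes> t) [^] j \<otimes> s) :: nat)"
      unfolding sum_lessThan_double by (intro dvd_sum) simp
    then show ?thesis using cocycle_replicate[OF r(2,3) that(2)] r(1) by simp
  qed
  obtain N where
    "\<And>g h y. g \<in> carrier W \<Longrightarrow> h \<in> carrier W \<Longrightarrow> y \<in> carrier W \<Longrightarrow>
      N (g \<otimes> h) y = (N g y \<noteq> N h (inv g \<otimes> y \<otimes> inv (inv g)))"
    "\<And>x y. x \<in> S \<Longrightarrow> y \<in> carrier W \<Longrightarrow> N (id x) y = (y = x)"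
    by (rule presents_cocycle[OF pres, where act = "\<lambda>g y. g \<otimes> y \<otimes> inv g"
          and n = "\<lambda>x y. y = x" and M = "carrier W"])
      (use rel in \<open>auto simp: m_assoc inv_mult_group\<close>)
  then show ?thesis by (intro exI[of _ N]) simp
qed

text \<open>\<open>inversion w t\<close> says that the wall of the reflection \<open>t\<close> separates the chambers
  \<open>1\<close> and \<open>w\<close>.\<close>

definition inversion :: "'a \<Rightarrow> 'a \<Rightarrow> bool" where
  "inversion = (SOME N. (\<forall>g \<in> carrier W. \<forall>h \<in> carrier W. \<forall>t \<in> carrier W.
      N (g \<otimes> h) t = (N g t \<noteq> N h (inv g \<otimes> t \<otimes> g))) \<and>
    (\<forall>s \<in> S. \<forall>t \<in> carrier W. N s t = (t = s)))"

lemma inversion_mult: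
  "g \<in> carrier W \<Longrightarrow> h \<in> carrier W \<Longrightarrow> t \<in> carrier W \<Longrightarrow>
   inversion (g \<otimes> h) t = (inversion g t \<noteq> inversion h (inv g \<otimes> t \<otimes> g))"
  and inversion_gen: "s \<in> S \<Longrightarrow> t \<in> carrier W \<Longrightarrow> inversion s t \<longleftrightarrow> t = s"
  using someI_ex[OF ex_inversion] unfolding inversion_def by blast+

lemma inversion_one: "t \<in> carrier W \<Longrightarrow> \<not> inversion \<one> t"
  using inversion_mult[of \<one> \<one> t] by simp

lemma inversion_inv:
  "g \<in> carrier W \<Longrightarrow> t \<in> carrier W \<Longrightarrow> inversion (inv g) t = inversion g (g \<otimes> t \<otimes> inv g)"
  using inversion_mult[of "inv g" g t] inversion_one[of t] by simp

lemma gen_ne_one: "s \<in> S \<Longrightarrow> s \<noteq> \<one>"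
  using inversion_gen[of s s] inversion_one[of s] by auto

text \<open>Along the gallery for \<open>g s g^-1\<close> the middle letter crosses the wall of this
  reflection; the crossings in \<open>g\<close> and in its inverse are mirror images and
  cancel.\<close>

lemma inversion_reflection:
  assumes "g \<in> carrier W" "s \<in> S"
  shows "inversion (g \<otimes> s \<otimes> inv g) (g \<otimes> s \<otimes> inv g)"
proof -
  let ?t = "g \<otimes> s \<otimes> inv g"
  have "inversion (g \<otimes> (s \<otimes> inv g)) ?t = (inversion g ?t \<noteq> inversion (s \<otimes> inv g) s)"
    using assms by (subst inversion_mult) (auto simp: m_assoc)
  also have "inversion (s \<otimes> inv g) s = (\<not> inversion (inv g) s)"
    using assms by (subst inversion_mult) (auto simp: inversion_gen gen_sq)
  also have "inversion (inv g) s = inversion g ?t"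
    using assms by (subst inversion_inv) auto
  finally show ?thesis using assms by (simp add: m_assoc)
qed

lemma special_induct [consumes 2, case_names one mult]:
  assumes w: "w \<in> generate W D" and D: "D \<subseteq> S"
    and one: "P \<one>" and mult: "\<And>s w. s \<in> D \<Longrightarrow> w \<in> generate W D \<Longrightarrow> P w \<Longrightarrow> P (s \<otimes> w)"
  shows "P w"
proof -
  have Dc: "D \<subseteq> carrier W" using D S_closed by blast
  note closed = generate_in_carrier[OF Dc]
  \<comment> \<open>Generalised to left multiplication of an arbitrary \<open>v\<close>, because
    \<open>generate\<close> is built from binary products and not letter by letter.\<close>
  have "\<forall>v \<in> generate W D. P v \<longrightarrow> P (w \<otimes> v)"
    using w
  proof induction
    case one
    then show ?case using closed by auto
  next
    case (incl h)
    then show ?case using mult by blast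
  next
    case (inv h)
    then have "inv h = h" using D by auto
    then show ?case using mult inv by auto
  next
    case (eng g h)
    have "P (g \<otimes> h \<otimes> v)" if v: "v \<in> generate W D" "P v" for v
    proof -
      have "P (h \<otimes> v)" using eng v by blast
      moreover have "h \<otimes> v \<in> generate W D" using eng(2) v(1) by (rule generate.eng)
      ultimately have "P (g \<otimes> (h \<otimes> v))" using eng by blast
      then show ?thesis using closed eng(1,2) v(1) by (simp add: m_assoc)
    qed
    then show ?case by blast
  qed
  then have "P (w \<otimes> \<one>)" using one generate.one by blast
  then show ?thesis using closed[OF w] by simp
qed

lemma special_closed: "D \<subseteq> S \<Longrightarrow> w \<in> generate W D \<Longrightarrow> w \<in> carrier W"
  using S_closed by (blast intro: generate_in_carrier)

lemma special_subgroup: "D \<subseteq> S \<Longrightarrow> subgroup (generate W D) W"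
  using S_closed by (intro generate_is_subgroup) blast

section \<open>Length and the exchange condition\<close>

definition inversions :: "'a \<Rightarrow> 'a set" where
  "inversions w = {t \<in> carrier W. inversion w t}"

text \<open>Counts the walls between \<open>1\<close> and \<open>w\<close>; that this is the word
  length is the content of \<open>len_lprod_le\<close> and \<open>reduced_word\<close>.\<close>

abbreviation len :: "'a \<Rightarrow> nat" where
  "len w \<equiv> card (inversions w)"

abbreviation lprod :: "'a list \<Rightarrow> 'a" where
  "lprod ls \<equiv> foldr (\<otimes>) ls \<one>"

lemma inversions_one: "inversions \<one> = {}"
  using inversion_one by (auto simp: inversions_def)

lemma inversions_gen_mult:
  assumes "s \<in> S" "w \<in> carrier W"
  shows "inversions (s \<otimes> w) =
    (if inversion w s then (\<lambda>t. s \<otimes> t \<otimes> s) ` inversions w - {s}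
     else insert s ((\<lambda>t. s \<otimes> t \<otimes> s) ` inversions w))"
proof -
  have mem: "t \<in> (\<lambda>t. s \<otimes> t \<otimes> s) ` inversions w \<longleftrightarrow> inversion w (s \<otimes> t \<otimes> s)"
    if "t \<in> carrier W" for t
  proof
    assume "t \<in> (\<lambda>t. s \<otimes> t \<otimes> s) ` inversions w"
    then obtain r where "r \<in> carrier W" "inversion w r" "t = s \<otimes> r \<otimes> s"
      by (auto simp: inversions_def)
    then show "inversion w (s \<otimes> t \<otimes> s)" using assms by (simp add: m_assoc gen_sq)
  next
    assume "inversion w (s \<otimes> t \<otimes> s)"
    then have "s \<otimes> t \<otimes> s \<in> inversions w" using assms that by (simp add: inversions_def)
    moreover have "t = s \<otimes> (s \<otimes> t \<otimes> s) \<otimes> s" using assms that by (simp add: m_assoc gen_sq)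
    ultimately show "t \<in> (\<lambda>t. s \<otimes> t \<otimes> s) ` inversions w" by (rule image_eqI[rotated])
  qed
  define I where "I = (\<lambda>t. s \<otimes> t \<otimes> s) ` inversions w"
  have Ic: "t \<in> carrier W" if "t \<in> I" for t
    using that assms by (auto simp: I_def inversions_def)
  note mem = mem[folded I_def]
  have inv: "inversion (s \<otimes> w) t \<longleftrightarrow> (t = s) \<noteq> (t \<in> I)" if "t \<in> carrier W" for t
    using assms that mem[OF that] by (simp add: inversion_mult inversion_gen)
  have sI: "s \<in> I \<longleftrightarrow> inversion w s" using mem[of s] assms by (simp add: gen_sq)
  have "inversions (s \<otimes> w) = (if inversion w s then I - {s} else insert s I)"
    using inv Ic sI assms(1) by (auto simp: inversions_def)
  then show ?thesis by (simp add: I_def)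
qed

lemma finite_inversions:
  assumes "w \<in> carrier W"
  shows "finite (inversions w)"
proof -
  have "w \<in> generate W S" using assms generate_S by simp
  then show ?thesis
    using subset_refl
  proof (induction rule: special_induct)
    case one
    then show ?case by (simp add: inversions_one)
  next
    case (mult s w)
    then show ?case using special_closed[OF subset_refl] by (simp add: inversions_gen_mult)
  qed
qed

lemma len_gen_mult:
  assumes "s \<in> S" "w \<in> carrier W"
  shows "if inversion w s then len w = Suc (len (s \<otimes> w)) else len (s \<otimes> w) = Suc (len w)"
proof -
  have "inj_on (\<lambda>t. s \<otimes> t \<otimes> s) (inversions w)"
    using assms by (auto simp: inj_on_def inversions_def)
  then have card: "card ((\<lambda>t. s \<otimes> t \<otimes> s) ` inversions w) = len w" by (rule card_image)
  have fin: "finite ((\<lambda>t. s \<otimes> t \<otimes> s) ` inversions w)" using finite_inversions assms by simp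
  have "s \<in> (\<lambda>t. s \<otimes> t \<otimes> s) ` inversions w \<longleftrightarrow> inversion w s"
  proof
    assume "s \<in> (\<lambda>t. s \<otimes> t \<otimes> s) ` inversions w"
    then obtain t where t: "t \<in> carrier W" "inversion w t" and e: "s = s \<otimes> t \<otimes> s"
      by (auto simp: inversions_def)
    have "s \<otimes> s \<otimes> s = s \<otimes> (s \<otimes> t \<otimes> s) \<otimes> s" by (subst e[symmetric]) (rule HOL.refl)
    then have "t = s" using assms t(1) by (simp add: m_assoc gen_sq)
    then show "inversion w s" using t by simp
  next
    assume "inversion w s"
    then have "s \<in> inversions w" using assms by (simp add: inversions_def)
    then show "s \<in> (\<lambda>t. s \<otimes> t \<otimes> s) ` inversions w"
      using assms by (intro image_eqI[of _ _ s]) (auto simp: gen_sq)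
  qed
  then show ?thesis
    using card_Suc_Diff1[OF fin, of s] card fin assms by (simp add: inversions_gen_mult)
qed

lemma lprod_closed [simp]: "ls \<in> lists S \<Longrightarrow> lprod ls \<in> carrier W"
  by (induction ls) auto

lemma len_lprod_le: "ls \<in> lists S \<Longrightarrow> len (lprod ls) \<le> length ls"
proof (induction ls)
  case Nil
  then show ?case by (simp add: inversions_one)
next
  case (Cons s ls)
  then show ?case using len_gen_mult[of s "lprod ls"] by (auto split: if_splits)
qed

text \<open>The strong exchange condition: reflecting the gallery spelled by \<open>ls\<close> in
  the wall of \<open>t\<close>, up to the point where it first crosses this wall, amounts to
  deleting the letter that crosses it.\<close>

lemma exchange:
  assumes "ls \<in> lists S" "t \<in> carrier W" "inversion (lprod ls) t"
  obtains us s vs where "ls = us @ s # vs" "t \<otimes> lprod ls = lprod (us @ vs)"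
proof -
  have "\<exists>us s vs. ls = us @ s # vs \<and> t \<otimes> lprod ls = lprod (us @ vs)"
    using assms
  proof (induction ls arbitrary: t)
    case Nil
    then show ?case using inversion_one by simp
  next
    case (Cons s ls)
    then have s: "s \<in> S" and ls: "ls \<in> lists S" by auto
    show ?case
    proof (cases "t = s")
      case True
      then show ?thesis using s ls by (intro exI[of _ "[]"] exI[of _ s] exI[of _ ls]) simp
    next
      case False
      have inv: "inversion (lprod ls) (s \<otimes> t \<otimes> s)"
        using Cons.prems False s ls by (simp add: inversion_mult inversion_gen)
      have "s \<otimes> t \<otimes> s \<in> carrier W" using s Cons.prems(1) by simp
      from Cons.IH[OF this inv] obtain us r vs where
        ls': "ls = us @ r # vs" "s \<otimes> t \<otimes> s \<otimes> lprod ls = lprod (us @ vs)"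
        by (elim exE conjE)
      have "lprod ls \<in> carrier W" using ls by (rule lprod_closed)
      then have "t \<otimes> lprod (s # ls) = s \<otimes> (s \<otimes> t \<otimes> s \<otimes> lprod ls)"
        using s Cons.prems(1) by (simp add: m_assoc)
      also have "\<dots> = lprod ((s # us) @ vs)" unfolding ls'(2) by simp
      finally show ?thesis using ls'(1) by (intro exI[of _ "s # us"] exI[of _ r] exI[of _ vs]) simp
    qed
  qed
  then show ?thesis by (elim exE conjE) (rule that)
qed

text \<open>Exchange only deletes letters, so shortening a word never leaves \<open>D\<close>. Hence
  the lengths relative to \<open>D\<close> and to \<open>S\<close> agree.\<close>

lemma reduced_word:
  assumes "w \<in> generate W D" "D \<subseteq> S"
  obtains ls where "ls \<in> lists D" "lprod ls = w" "length ls = len w"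
proof -
  have "\<exists>ls \<in> lists D. lprod ls = w \<and> length ls = len w"
    using assms
  proof (induction rule: special_induct)
    case one
    show ?case by (intro bexI[of _ "[]"]) (auto simp: inversions_one)
  next
    case (mult s w)
    then obtain ls where ls: "ls \<in> lists D" "lprod ls = w" "length ls = len w" by blast
    have s: "s \<in> S" using mult(1) assms by blast
    have lS: "ls \<in> lists S" using ls(1) assms(2) by auto
    then have w: "w \<in> carrier W" using ls(2) lprod_closed by blast
    show ?case
    proof (cases "inversion w s")
      case True
      then have inv: "inversion (lprod ls) s" using ls(2) by simp
      obtain us r vs where uv: "ls = us @ r # vs" "s \<otimes> lprod ls = lprod (us @ vs)"
        by (rule exchange[OF lS gen_closed[OF s] inv])
      have "Suc (length (us @ vs)) = len w" using uv ls(3) by simp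
      then have "length (us @ vs) = len (s \<otimes> w)"
        using len_gen_mult[OF s w] True by simp
      moreover have "us @ vs \<in> lists D" using uv(1) ls(1) by auto
      moreover have "lprod (us @ vs) = s \<otimes> w" using uv(2) ls(2) by simp
      ultimately show ?thesis by blast
    next
      case False
      then have "length (s # ls) = len (s \<otimes> w)" using len_gen_mult[OF s w] ls(3) by simp
      then show ?thesis using ls mult(1) by (intro bexI[of _ "s # ls"]) auto
    qed
  qed
  then show ?thesis by (elim bexE conjE) (rule that)
qed

lemma len_reflect_less:
  assumes "w \<in> carrier W" "t \<in> carrier W" "inversion w t"
  shows "len (t \<otimes> w) < len w"
proof -
  obtain ls where ls: "ls \<in> lists S" "lprod ls = w" "length ls = len w"
    using reduced_word[of w S] assms generate_S by auto
  then have inv: "inversion (lprod ls) t" using assms(3) by simp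
  obtain us s vs where uv: "ls = us @ s # vs" "t \<otimes> lprod ls = lprod (us @ vs)"
    by (rule exchange[OF ls(1) assms(2) inv])
  have "us @ vs \<in> lists S" using uv(1) ls(1) by auto
  then have "len (t \<otimes> w) \<le> length (us @ vs)" using uv(2) ls(2) len_lprod_le[of "us @ vs"] by simp
  also have "\<dots> < len w" using uv(1) ls(3) by simp
  finally show ?thesis .
qed

lemma inversions_empty:
  assumes "w \<in> carrier W" "inversions w = {}"
  shows "w = \<one>"
  using reduced_word[of w S] assms generate_S by auto

text \<open>By the cocycle rule the walls of \<open>x^-1 y\<close> are a translate of the symmetric
  difference of the walls of \<open>x\<close> and \<open>y\<close>, and only \<open>1\<close> has no
  wall. This lets a finite set of walls bound the size of a subgroup.\<close>

lemma inj_inversions: "inj_on inversions (carrier W)"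
proof (rule inj_onI)
  fix x y assume xy: "x \<in> carrier W" "y \<in> carrier W" "inversions x = inversions y"
  have "\<not> inversion (inv x \<otimes> y) t" if t: "t \<in> carrier W" for t
  proof -
    have "inversion x (x \<otimes> t \<otimes> inv x) = inversion y (x \<otimes> t \<otimes> inv x)"
      using xy t by (auto simp: inversions_def set_eq_iff)
    then show ?thesis using xy t by (simp add: inversion_mult inversion_inv)
  qed
  then have "inv x \<otimes> y = \<one>" using xy by (intro inversions_empty) (auto simp: inversions_def)
  then have "x \<otimes> (inv x \<otimes> y) = x" using xy by simp
  then show "x = y" using xy(1,2) by simp
qed

lemma gen_mem_special:
  assumes "s \<in> S" "s \<in> generate W D" "D \<subseteq> S"
  shows "s \<in> D"
proof -
  have "inversions s = {s}" using assms(1) by (auto simp: inversions_def inversion_gen)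
  then obtain ls where ls: "ls \<in> lists D" "lprod ls = s" "length ls = 1"
    using reduced_word[OF assms(2,3)] by auto
  then obtain d where "ls = [d]" by (auto simp: length_Suc_conv)
  then show ?thesis using ls assms(3) by auto
qed

lemma inversion_special:
  assumes "w \<in> generate W D" "D \<subseteq> S" "t \<in> carrier W" "inversion w t"
  obtains u d where "u \<in> generate W D" "d \<in> D" "t = u \<otimes> d \<otimes> inv u"
proof -
  have "\<forall>t \<in> carrier W. inversion w t \<longrightarrow> (\<exists>u \<in> generate W D. \<exists>d \<in> D. t = u \<otimes> d \<otimes> inv u)"
    using assms(1,2)
  proof (induction rule: special_induct)
    case one
    then show ?case using inversion_one by auto
  next
    case (mult s w)
    have s: "s \<in> S" using mult(1) assms by blast
    have w: "w \<in> carrier W" using mult(2) special_closed assms by blast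
    have "\<exists>u \<in> generate W D. \<exists>d \<in> D. t = u \<otimes> d \<otimes> inv u"
      if t: "t \<in> carrier W" "inversion (s \<otimes> w) t" for t
    proof (cases "t = s")
      case True
      then show ?thesis using mult(1) s by (intro bexI[of _ \<one>] bexI[of _ s]) (auto intro: generate.one)
    next
      case False
      then have "inversion w (s \<otimes> t \<otimes> s)" using t s w by (simp add: inversion_mult inversion_gen)
      moreover have "s \<otimes> t \<otimes> s \<in> carrier W" using s t by simp
      ultimately have "\<exists>u \<in> generate W D. \<exists>d \<in> D. s \<otimes> t \<otimes> s = u \<otimes> d \<otimes> inv u"
        using mult(3) by simp
      then obtain u d where u: "u \<in> generate W D" "d \<in> D" "s \<otimes> t \<otimes> s = u \<otimes> d \<otimes> inv u"
        by (elim bexE)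
      have uc: "u \<in> carrier W" "d \<in> S" using special_closed[OF assms(2) u(1)] u(2) assms(2) by auto
      have "t = s \<otimes> (s \<otimes> t \<otimes> s) \<otimes> s" using s t by (simp add: m_assoc gen_sq)
      then have "t = s \<otimes> u \<otimes> d \<otimes> inv (s \<otimes> u)"
        unfolding u(3) using uc s by (simp add: m_assoc inv_mult_group)
      moreover have "s \<otimes> u \<in> generate W D" using mult(1) u(1) by (blast intro: generate.eng generate.incl)
      ultimately show ?thesis using u(2) by (intro bexI)
    qed
    then show ?case by simp
  qed
  with assms(3,4) have "\<exists>u \<in> generate W D. \<exists>d \<in> D. t = u \<otimes> d \<otimes> inv u" by simp
  then show ?thesis by (elim bexE) (rule that)
qed

lemma inversion_special_mem:
  assumes "w \<in> generate W D" "D \<subseteq> S" "t \<in> carrier W" "inversion w t"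
  shows "t \<in> generate W D"
proof -
  obtain u d where u: "u \<in> generate W D" and d: "d \<in> D" and t: "t = u \<otimes> d \<otimes> inv u"
    by (rule inversion_special[OF assms])
  have "inv u \<in> generate W D"
    using special_subgroup[OF assms(2)] u by (rule subgroup.m_inv_closed)
  then show ?thesis unfolding t by (rule generate.eng[OF generate.eng[OF u generate.incl[OF d]]])
qed

section \<open>Products of special subgroups and the finite factor\<close>

lemma special_Int_trivial:
  assumes x: "x \<in> generate W I" "x \<in> generate W J" and IJ: "I \<subseteq> S" "J \<subseteq> S" "I \<inter> J = {}"
  shows "x = \<one>"
proof (rule ccontr)
  assume "x \<noteq> \<one>"
  obtain ls where ls: "ls \<in> lists I" "lprod ls = x" "length ls = len x"
    by (rule reduced_word[OF x(1) IJ(1)])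
  have "ls \<noteq> []" using ls(2) \<open>x \<noteq> \<one>\<close> by auto
  then obtain i r where ir: "ls = i # r" by (cases ls) simp_all
  have iI: "i \<in> I" and rI: "r \<in> lists I" using ls(1) unfolding ir by simp_all
  have i: "i \<in> S" using iI IJ(1) by blast
  have r: "r \<in> lists S" using rI lists_mono[OF IJ(1)] by blast
  have xr: "x = i \<otimes> lprod r" using ls(2) unfolding ir by simp
  have y: "lprod r \<in> carrier W" using r by (rule lprod_closed)
  \<comment> \<open>The first letter of a reduced word for \<open>x\<close> is a wall of
    \<open>x\<close>: otherwise \<open>lprod r\<close> would have more inversions than
    \<open>r\<close> has letters. Being a wall of \<open>x\<close>, it then lies in the other
    special subgroup too.\<close>
  have "\<not> inversion (lprod r) i"
  proof
    assume "inversion (lprod r) i"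
    then have "len (lprod r) = Suc (len x)" unfolding xr using len_gen_mult[OF i y] by simp
    moreover have "len (lprod r) \<le> length r" using r by (rule len_lprod_le)
    moreover have "length ls = Suc (length r)" unfolding ir by simp
    ultimately show False using ls(3) by linarith
  qed
  then have "inversion x i" unfolding xr using i y by (simp add: inversion_mult inversion_gen gen_sq)
  then have "i \<in> generate W J" by (rule inversion_special_mem[OF x(2) IJ(2) gen_closed[OF i]])
  then have "i \<in> J" using gen_mem_special i IJ(2) by blast
  then show False using iI IJ(3) by blast
qed


lemma special_commute:
  assumes com: "\<And>s t. s \<in> I \<Longrightarrow> t \<in> J \<Longrightarrow> s \<otimes> t = t \<otimes> s"
    and IJ: "I \<subseteq> S" "J \<subseteq> S" and x: "x \<in> generate W I" and y: "y \<in> generate W J"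
  shows "x \<otimes> y = y \<otimes> x"
proof -
  have step: "s \<otimes> y = y \<otimes> s" if s: "s \<in> I" and y: "y \<in> generate W J" for s y
    using y IJ(2)
  proof (induction rule: special_induct)
    case one
    then show ?case using s IJ(1) by auto
  next
    case (mult t y)
    have st: "s \<in> carrier W" "t \<in> carrier W" using s mult(1) IJ by auto
    have y: "y \<in> carrier W" using special_closed[OF IJ(2) mult(2)] .
    have "s \<otimes> (t \<otimes> y) = (s \<otimes> t) \<otimes> y" using st y by (simp add: m_assoc)
    also have "\<dots> = t \<otimes> (s \<otimes> y)" unfolding com[OF s mult(1)] using st y by (simp add: m_assoc)
    also have "\<dots> = t \<otimes> y \<otimes> s" unfolding mult(3) using st y by (simp add: m_assoc)
    finally show ?case .
  qed
  have yc: "y \<in> carrier W" using special_closed[OF IJ(2) y] .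
  show ?thesis
    using x IJ(1)
  proof (induction rule: special_induct)
    case one
    then show ?case using yc by simp
  next
    case (mult s x)
    have s: "s \<in> carrier W" using mult(1) IJ(1) by auto
    have x: "x \<in> carrier W" using special_closed[OF IJ(1) mult(2)] .
    have "s \<otimes> x \<otimes> y = s \<otimes> (x \<otimes> y)" using s x yc by (simp add: m_assoc)
    also have "\<dots> = (s \<otimes> y) \<otimes> x" unfolding mult(3) using s x yc by (simp add: m_assoc)
    also have "\<dots> = y \<otimes> (s \<otimes> x)" unfolding step[OF mult(1) y] using s x yc by (simp add: m_assoc)
    finally show ?case .
  qed
qed

text \<open>A letter of \<open>I\<close> outside \<open>J\<close> can be moved to the right past
  everything in \<open>J\<close>. Commutation is asked for such letters only, because
  \<open>I\<close> and \<open>J\<close> may overlap when two finite factors are joined.\<close>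

lemma special_Un_factor:
  assumes com: "\<And>s t. s \<in> J \<Longrightarrow> t \<in> I \<Longrightarrow> t \<notin> J \<Longrightarrow> s \<otimes> t = t \<otimes> s"
    and IJ: "I \<subseteq> S" "J \<subseteq> S" and x: "x \<in> generate W (J \<union> I)"
  obtains y z where "y \<in> generate W J" "z \<in> generate W I" "x = y \<otimes> z"
proof -
  have U: "J \<union> I \<subseteq> S" using IJ by blast
  have "\<exists>y \<in> generate W J. \<exists>z \<in> generate W I. x = y \<otimes> z"
    using x U
  proof (induction rule: special_induct)
    case one
    show ?case by (intro bexI[of _ \<one>]) (auto intro: generate.one)
  next
    case (mult s x)
    from mult(3) obtain y z where y: "y \<in> generate W J" and z: "z \<in> generate W I" and e: "x = y \<otimes> z"
      by (elim bexE)
    have c: "s \<in> carrier W" "y \<in> carrier W" "z \<in> carrier W"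
      using special_closed[OF IJ(2) y] special_closed[OF IJ(1) z] mult(1) U by auto
    show ?case
    proof (cases "s \<in> J")
      case True
      have "s \<otimes> x = (s \<otimes> y) \<otimes> z" unfolding e using c by (simp add: m_assoc)
      moreover have "s \<otimes> y \<in> generate W J" by (rule generate.eng[OF generate.incl[OF True] y])
      ultimately show ?thesis using z by (intro bexI)
    next
      case False
      then have s: "s \<in> I" using mult(1) by blast
      have "y \<otimes> s = s \<otimes> y"
        by (rule special_commute[of J "{s}"])
          (use com[OF _ s False] IJ s y in \<open>auto intro: generate.incl\<close>)
      then have "s \<otimes> x = y \<otimes> (s \<otimes> z)" unfolding e using c by (simp flip: m_assoc)
      moreover have "s \<otimes> z \<in> generate W I" by (rule generate.eng[OF generate.incl[OF s] z])
      ultimately show ?thesis using y by (intro bexI)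
    qed
  qed
  then show ?thesis by (elim bexE) (rule that)
qed

text \<open>Reduces the direct product in the definition of \<open>finite_part\<close> to a
  condition on pairs of generators. Injectivity of the multiplication map comes from
  \<open>special_Int_trivial\<close>, as \<open>A - T\<close> and \<open>T\<close> are
  disjoint.\<close>

lemma internal_direct_product_special_iff:
  assumes A: "A \<subseteq> S" and T: "T \<subseteq> A"
  shows "internal_direct_product W (generate W A) (generate W (A - T)) (generate W T) \<longleftrightarrow>
    (\<forall>s \<in> A - T. \<forall>t \<in> T. s \<otimes> t = t \<otimes> s)"
proof
  assume "internal_direct_product W (generate W A) (generate W (A - T)) (generate W T)"
  then have "\<forall>x \<in> generate W (A - T). \<forall>y \<in> generate W T. \<forall>x' \<in> generate W (A - T).
      \<forall>y' \<in> generate W T. x \<otimes> x' \<otimes> (y \<otimes> y') = x \<otimes> y \<otimes> (x' \<otimes> y')"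
    by (simp add: internal_direct_product_def iso_def hom_def DirProd_def)
  then have hom: "x \<otimes> x' \<otimes> (y \<otimes> y') = x \<otimes> y \<otimes> (x' \<otimes> y')"
    if "x \<in> generate W (A - T)" "x' \<in> generate W (A - T)" "y \<in> generate W T" "y' \<in> generate W T"
    for x x' y y'
    using that by blast
  show "\<forall>s \<in> A - T. \<forall>t \<in> T. s \<otimes> t = t \<otimes> s"
  proof (intro ballI)
    fix s t assume st: "s \<in> A - T" "t \<in> T"
    then have "s \<in> generate W (A - T)" "t \<in> generate W T" by (blast intro: generate.incl)+
    from hom[OF generate.one this generate.one] show "s \<otimes> t = t \<otimes> s"
      using st A T S_closed by (auto simp: subset_iff)
  qed
next
  assume com: "\<forall>s \<in> A - T. \<forall>t \<in> T. s \<otimes> t = t \<otimes> s"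
  have TS: "T \<subseteq> S" and ES: "A - T \<subseteq> S" using A T by auto
  let ?E = "generate W (A - T)" and ?T = "generate W T"
  interpret E: subgroup ?E W using special_subgroup[OF ES] .
  interpret T: subgroup ?T W using special_subgroup[OF TS] .
  have comm: "x \<otimes> y = y \<otimes> x" if "x \<in> ?E" "y \<in> ?T" for x y
    by (rule special_commute[OF _ ES TS that]) (use com in auto)
  have EA: "?E \<subseteq> generate W A" and TA: "?T \<subseteq> generate W A"
    using T by (auto intro!: mono_generate)
  have inj: "inj_on (\<lambda>(x, y). x \<otimes> y) (?E \<times> ?T)"
  proof (rule inj_onI, clarify)
    fix x y x' y' assume xy: "x \<in> ?E" "y \<in> ?T" "x' \<in> ?E" "y' \<in> ?T" and eq: "x \<otimes> y = x' \<otimes> y'"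
    have c: "x \<in> carrier W" "y \<in> carrier W" "x' \<in> carrier W" "y' \<in> carrier W"
      using xy by auto
    have "inv x' \<otimes> x = inv x' \<otimes> (x \<otimes> y) \<otimes> inv y" using c by (simp add: m_assoc)
    also have "\<dots> = y' \<otimes> inv y" unfolding eq using c by (simp add: m_assoc)
    finally have e: "inv x' \<otimes> x = y' \<otimes> inv y" .
    moreover have "inv x' \<otimes> x \<in> ?E" "y' \<otimes> inv y \<in> ?T" using xy by auto
    ultimately have "inv x' \<otimes> x = \<one>"
      using special_Int_trivial[of "inv x' \<otimes> x" "A - T" T] ES TS by auto
    then have "x' \<otimes> (inv x' \<otimes> x) = x'" using c by simp
    then have "x = x'" using c by simp
    moreover from this have "y = y'" using eq c by simp
    ultimately show "x = x' \<and> y = y'" ..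
  qed
  have "x \<in> (\<lambda>(x, y). x \<otimes> y) ` (?E \<times> ?T)" if "x \<in> generate W A" for x
  proof -
    have "A = (A - T) \<union> T" using T by blast
    then have x: "x \<in> generate W ((A - T) \<union> T)" using that by simp
    obtain y z where yz: "y \<in> ?E" "z \<in> ?T" "x = y \<otimes> z"
      by (rule special_Un_factor[OF _ TS ES x]) (use com in auto)
    then show ?thesis by (intro image_eqI[of _ _ "(y, z)"]) auto
  qed
  moreover have "x \<otimes> y \<in> generate W A" if "x \<in> ?E" "y \<in> ?T" for x y
    using that EA TA by (blast intro: generate.eng)
  ultimately have bij: "bij_betw (\<lambda>(x, y). x \<otimes> y) (?E \<times> ?T) (generate W A)"
    using inj unfolding bij_betw_def by auto
  have "x \<otimes> x' \<otimes> (y \<otimes> y') = x \<otimes> y \<otimes> (x' \<otimes> y')"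
    if "x \<in> ?E" "x' \<in> ?E" "y \<in> ?T" "y' \<in> ?T" for x x' y y'
  proof -
    have "x \<otimes> x' \<otimes> (y \<otimes> y') = x \<otimes> (x' \<otimes> y) \<otimes> y'" using that by (simp add: m_assoc)
    also have "\<dots> = x \<otimes> y \<otimes> (x' \<otimes> y')" unfolding comm[OF that(2,3)] using that by (simp add: m_assoc)
    finally show ?thesis .
  qed
  moreover have "x \<otimes> y \<in> generate W A" if "x \<in> ?E" "y \<in> ?T" for x y
    using that EA TA by (blast intro: generate.eng)
  ultimately have "(\<lambda>(x, y). x \<otimes> y) \<in> hom (W\<lparr>carrier := ?E\<rparr> \<times>\<times> W\<lparr>carrier := ?T\<rparr>) (W\<lparr>carrier := generate W A\<rparr>)"
    unfolding hom_def DirProd_def by auto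
  then show "internal_direct_product W (generate W A) ?E ?T"
    using bij unfolding internal_direct_product_def iso_def by (simp add: DirProd_def)
qed

text \<open>The greatest element in the definition of \<open>finite_part\<close> exists because the admissible
  sets \<open>T\<close> are closed under unions.\<close>

lemma finite_part_greatest:
  assumes A: "A \<subseteq> S" and fin: "finite A"
  defines "P \<equiv> \<lambda>T. T \<subseteq> A \<and> finite (generate W T) \<and> (\<forall>s \<in> A - T. \<forall>t \<in> T. s \<otimes> t = t \<otimes> s)"
  shows "P (finite_part W A)" and "\<And>T. P T \<Longrightarrow> T \<subseteq> finite_part W A"
proof -
  have eq: "finite_part W A = (GREATEST T. P T)"
  proof -
    have "T \<subseteq> A \<and> finite (generate W T) \<and>
        internal_direct_product W (generate W A) (generate W (A - T)) (generate W T) \<longleftrightarrow> P T" for T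
      by (cases "T \<subseteq> A") (simp_all add: P_def internal_direct_product_special_iff[OF A])
    then show ?thesis unfolding finite_part_def by presburger
  qed
  have un: "P (T \<union> U)" if T: "P T" and U: "P U" for T U
  proof -
    have TS: "T \<subseteq> S" and US: "U \<subseteq> S" using T U A unfolding P_def by blast+
    have "generate W (T \<union> U) \<subseteq> (\<lambda>(x, y). x \<otimes> y) ` (generate W T \<times> generate W U)"
    proof
      fix x assume x: "x \<in> generate W (T \<union> U)"
      have com: "s \<otimes> t = t \<otimes> s" if "s \<in> T" "t \<in> U" "t \<notin> T" for s t
      proof -
        have "t \<in> A - T" using that U unfolding P_def by blast
        then have "t \<otimes> s = s \<otimes> t" using T that(1) unfolding P_def by simp
        then show ?thesis by (rule HOL.sym)
      qed
      obtain y z where "y \<in> generate W T" "z \<in> generate W U" "x = y \<otimes> z"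
        by (rule special_Un_factor[OF com US TS x])
      then show "x \<in> (\<lambda>(x, y). x \<otimes> y) ` (generate W T \<times> generate W U)"
        by (intro image_eqI[of _ _ "(y, z)"]) auto
    qed
    moreover have "finite (generate W T \<times> generate W U)" using T U unfolding P_def by blast
    ultimately have "finite (generate W (T \<union> U))" by (rule finite_surj[rotated])
    moreover have "T \<union> U \<subseteq> A" using T U by (simp add: P_def)
    moreover have "s \<otimes> t = t \<otimes> s" if "s \<in> A - (T \<union> U)" "t \<in> T \<union> U" for s t
      using T U that unfolding P_def by blast
    ultimately show ?thesis unfolding P_def by blast
  qed
  have "P {}" by (simp add: P_def generate_empty)
  moreover have "\<forall>U. P U \<longrightarrow> card U < Suc (card A)"
    using fin by (simp add: P_def card_mono less_Suc_eq_le)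
  ultimately have "\<exists>T. P T \<and> (\<forall>U. P U \<longrightarrow> card U \<le> card T)"
    by (rule ex_has_greatest_nat)
  then obtain T where T: "P T" and max: "\<forall>U. P U \<longrightarrow> card U \<le> card T"
    by (elim exE conjE)
  have great: "U \<subseteq> T" if "P U" for U
  proof -
    have "T \<union> U \<subseteq> A" using T that by (simp add: P_def)
    then have "finite (T \<union> U)" using fin by (rule finite_subset)
    moreover have "card (T \<union> U) \<le> card T" using max un[OF T that] by simp
    ultimately have "T = T \<union> U" by (intro card_seteq) auto
    then show ?thesis by blast
  qed
  have "finite_part W A = T"
    unfolding eq using T great by (intro Greatest_equality) auto
  then show "P (finite_part W A)" and "\<And>T. P T \<Longrightarrow> T \<subseteq> finite_part W A"
    using T great by simp_all
qed

text \<open>The elements of the finite group generated by \<open>finite_part W A\<close> represent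
  all cosets.\<close>

lemma essential_part_finite_index:
  assumes A: "A \<subseteq> S" and fin: "finite A"
  shows "finite_index W (generate W (essential_part W A)) (generate W A)"
proof -
  let ?T = "finite_part W A" and ?E = "essential_part W A"
  note P = finite_part_greatest(1)[OF A fin]
  have TS: "?T \<subseteq> S" and ES: "?E \<subseteq> S" and U: "A = ?E \<union> ?T" using P A by (auto simp: essential_part_def)
  have "\<exists>a \<in> generate W ?T. k \<otimes> inv a \<in> generate W ?E" if "k \<in> generate W A" for k
  proof -
    have k: "k \<in> generate W (?E \<union> ?T)" using that U by simp
    obtain y z where yz: "y \<in> generate W ?E" "z \<in> generate W ?T" "k = y \<otimes> z"
      by (rule special_Un_factor[OF _ TS ES k]) (use P in \<open>auto simp: essential_part_def\<close>)
    have "y \<in> carrier W" "z \<in> carrier W"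
      using special_closed[OF ES yz(1)] special_closed[OF TS yz(2)] by auto
    then have "k \<otimes> inv z = y" using yz(3) by (simp add: m_assoc)
    then show ?thesis using yz(1,2) by auto
  qed
  moreover have "finite (generate W ?T)" using P by blast
  moreover have "generate W ?T \<subseteq> generate W A" "generate W ?E \<subseteq> generate W A"
    using U by (auto intro!: mono_generate)
  ultimately show ?thesis
    using special_subgroup[OF A] special_subgroup[OF ES] by (intro finite_indexI)
qed

section \<open>Rigidity of special subgroups\<close>

lemma special_inv_closed: "D \<subseteq> S \<Longrightarrow> x \<in> generate W D \<Longrightarrow> inv x \<in> generate W D"
  using special_subgroup[of D] by (simp add: subgroup.m_inv_closed)

text \<open>A wall which does not cut the residue \<open>h\<langle>J\<rangle>\<close> has all of it on one side.\<close>

lemma inversion_residue: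
  assumes J: "J \<subseteq> S" and h: "h \<in> carrier W" and t: "t \<in> carrier W" and j: "j \<in> generate W J"
    and nt: "t \<notin> conjugate W h (generate W J)"
  shows "inversion (h \<otimes> j) t = inversion h t"
proof -
  have jc: "j \<in> carrier W" using special_closed[OF J j] .
  have Jc: "generate W J \<subseteq> carrier W" using special_closed[OF J] by blast
  have "\<not> inversion j (inv h \<otimes> t \<otimes> h)"
  proof
    assume "inversion j (inv h \<otimes> t \<otimes> h)"
    then have "inv h \<otimes> t \<otimes> h \<in> generate W J"
      using h t by (intro inversion_special_mem[OF j J]) simp_all
    then show False using nt mem_conjugate_iff[OF h Jc t] by simp
  qed
  then show ?thesis using h t jc by (simp add: inversion_mult)
qed

lemma inversion_same_residue:
  assumes J: "J \<subseteq> S" and h: "h \<in> carrier W" and t: "t \<in> carrier W"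
    and nt: "t \<notin> conjugate W h (generate W J)"
    and xy: "x \<in> (\<lambda>j. h \<otimes> j) ` generate W J" "y \<in> (\<lambda>j. h \<otimes> j) ` generate W J"
  shows "inversion x t = inversion y t"
proof -
  have "inversion z t = inversion h t" if "z \<in> (\<lambda>j. h \<otimes> j) ` generate W J" for z
    using that inversion_residue[OF J h t _ nt] by (elim imageE) simp
  then show ?thesis using xy by simp
qed

lemma residue_stable:
  assumes J: "J \<subseteq> S" and h: "h \<in> carrier W" and q: "q \<in> conjugate W h (generate W J)"
    and x: "x \<in> (\<lambda>j. h \<otimes> j) ` generate W J"
  shows "q \<otimes> x \<in> (\<lambda>j. h \<otimes> j) ` generate W J"
proof -
  obtain i where i: "i \<in> generate W J" "q = h \<otimes> i \<otimes> inv h"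
    using q unfolding conjugate_eq_image by (elim imageE)
  obtain j where j: "j \<in> generate W J" "x = h \<otimes> j" using x by (elim imageE)
  have c: "i \<in> carrier W" "j \<in> carrier W" using special_closed[OF J] i(1) j(1) by simp_all
  have "q \<otimes> x = h \<otimes> (i \<otimes> j)" unfolding i(2) j(2) using h c by (simp add: m_assoc)
  moreover have "i \<otimes> j \<in> generate W J" using i(1) j(1) by (rule generate.eng)
  ultimately show ?thesis by (rule image_eqI)
qed

text \<open>If the walls of \<open>u\<close> and \<open>sus\<close> cut the residue \<open>h\<langle>J\<rangle>\<close> but the wall of \<open>s\<close> does not, then
  \<open>s\<close> and \<open>u\<close> commute: otherwise the translates of the residue under \<open>u\<close> and \<open>sus\<close>,
  projected to the dihedral group \<open>\<langle>s, u\<rangle>\<close>, lie on both sides of the wall of \<open>s\<close>.\<close>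

lemma commute_of_residue:
  assumes J: "J \<subseteq> S" and h: "h \<in> carrier W" and s: "s \<in> S" and u: "u \<in> S"
    and ns: "s \<notin> conjugate W h (generate W J)"
    and hu: "u \<in> conjugate W h (generate W J)" and hsus: "s \<otimes> u \<otimes> s \<in> conjugate W h (generate W J)"
  shows "s \<otimes> u = u \<otimes> s"
proof (rule ccontr)
  assume ne: "s \<otimes> u \<noteq> u \<otimes> s"
  have sc: "s \<in> carrier W" and uc: "u \<in> carrier W" using s u by simp_all
  let ?R = "(\<lambda>j. h \<otimes> j) ` generate W J"
  let ?D = "generate W {s, u}"
  have DS: "{s, u} \<subseteq> S" using s u by simp
  have sD: "s \<in> ?D" and uD: "u \<in> ?D" by (simp_all add: generate.incl)
  have hR: "h \<in> ?R" using h by (intro image_eqI[of _ _ \<one>]) (simp_all add: generate.one)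
  \<comment> \<open>\<open>u\<close> and \<open>sus\<close> preserve the residue, so every translate
    of \<open>h\<close> under the dihedral group lies in it up to a factor \<open>s\<close>.\<close>
  have dich: "n \<otimes> h \<in> ?R \<or> s \<otimes> (n \<otimes> h) \<in> ?R" if "n \<in> ?D" for n
    using that DS
  proof (induction rule: special_induct)
    case one
    then show ?case using hR h by simp
  next
    case (mult t n)
    have n: "n \<in> carrier W" using special_closed[OF DS mult(2)] .
    have nh: "n \<otimes> h \<in> carrier W" using n h by simp
    consider "t = s" | "t = u" using mult(1) by blast
    then show ?case
    proof cases
      case 1
      have "s \<otimes> (s \<otimes> n \<otimes> h) = n \<otimes> h" "s \<otimes> n \<otimes> h = s \<otimes> (n \<otimes> h)"
        using s sc n h by (simp_all add: m_assoc)
      then show ?thesis using mult(3) unfolding 1 by metis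
    next
      case 2
      have e1: "u \<otimes> n \<otimes> h = u \<otimes> (n \<otimes> h)" using uc n h by (simp add: m_assoc)
      have e2: "s \<otimes> (u \<otimes> n \<otimes> h) = (s \<otimes> u \<otimes> s) \<otimes> (s \<otimes> (n \<otimes> h))"
        using s sc uc n h by (simp add: m_assoc)
      show ?thesis
        using mult(3)
      proof
        assume "n \<otimes> h \<in> ?R"
        then have "u \<otimes> (n \<otimes> h) \<in> ?R" by (rule residue_stable[OF J h hu])
        then show ?thesis unfolding 2 e1 by simp
      next
        assume "s \<otimes> (n \<otimes> h) \<in> ?R"
        then have "(s \<otimes> u \<otimes> s) \<otimes> (s \<otimes> (n \<otimes> h)) \<in> ?R" by (rule residue_stable[OF J h hsus])
        then show ?thesis unfolding 2 e2 by simp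
      qed
    qed
  qed
  \<comment> \<open>This yields the projection to the dihedral group: no wall in \<open>?D\<close>
    separates \<open>1\<close> from the shortest element \<open>c\<close> of the coset, so for
    \<open>k \<in> ?D\<close> the side of \<open>kc\<close> relative to such a wall is the side of
    \<open>k\<close>.\<close>
  obtain n where n: "n \<in> ?D" and min: "\<forall>k. k \<in> ?D \<longrightarrow> len (n \<otimes> h) \<le> len (k \<otimes> h)"
    using ex_has_least_nat[of "\<lambda>k. k \<in> ?D" \<one> "\<lambda>k. len (k \<otimes> h)"] generate.one by auto
  define c where "c = n \<otimes> h"
  have nc: "n \<in> carrier W" using special_closed[OF DS n] .
  have cc: "c \<in> carrier W" using nc h by (simp add: c_def)
  have noinv: "\<not> inversion c r" if r: "r \<in> ?D" for r
  proof
    assume "inversion c r"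
    moreover have rc: "r \<in> carrier W" using special_closed[OF DS r] .
    ultimately have "len (r \<otimes> c) < len c" using len_reflect_less cc by blast
    moreover have "r \<otimes> c = (r \<otimes> n) \<otimes> h" using rc nc h by (simp add: c_def m_assoc)
    moreover have "r \<otimes> n \<in> ?D" using r n by (rule generate.eng)
    ultimately show False using min unfolding c_def by (metis linorder_not_less)
  qed
  have us: "u \<otimes> s \<otimes> u \<noteq> s"
  proof
    assume e: "u \<otimes> s \<otimes> u = s"
    have "s \<otimes> u = (u \<otimes> s \<otimes> u) \<otimes> u" unfolding e ..
    also have "\<dots> = u \<otimes> s" using u sc uc by (simp add: m_assoc gen_sq)
    finally show False using ne by simp
  qed
  have su: "s \<noteq> u" using ne by auto
  have inv_us: "\<not> inversion (u \<otimes> s) s"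
  proof -
    have "inversion (u \<otimes> s) s \<longleftrightarrow> (s = u) \<noteq> (u \<otimes> s \<otimes> u = s)"
      using s u sc uc by (simp add: inversion_mult inversion_gen)
    then show ?thesis using su us by simp
  qed
  have one: "\<not> inversion c s" using noinv sD by simp
  have side: "inversion x s = inversion y s" if "x \<in> ?R" "y \<in> ?R" for x y
    using inversion_same_residue[OF J h sc ns that] .
  \<comment> \<open>Either \<open>c\<close> and \<open>(sus)c\<close>, or \<open>sc\<close> and
    \<open>u(sc)\<close>, both lie in the residue, and in each case the wall of \<open>s\<close>
    runs between them.\<close>
  have "c \<in> ?R \<or> s \<otimes> c \<in> ?R" using dich[OF n] by (simp add: c_def)
  then show False
  proof
    assume c: "c \<in> ?R"
    let ?k = "s \<otimes> u \<otimes> s"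
    have kD: "?k \<in> ?D" by (rule generate.eng[OF generate.eng[OF sD uD] sD])
    have kc: "?k \<in> carrier W" using sc uc by simp
    have ik: "inv ?k = ?k" using s u by (simp add: inv_mult_group m_assoc)
    have "inversion ?k s \<longleftrightarrow> True \<noteq> inversion (u \<otimes> s) s"
    proof -
      have "inversion (s \<otimes> (u \<otimes> s)) s = (inversion s s \<noteq> inversion (u \<otimes> s) (inv s \<otimes> s \<otimes> s))"
        using sc uc by (intro inversion_mult) simp_all
      then show ?thesis using s sc uc by (simp add: inversion_gen gen_sq m_assoc)
    qed
    then have 1: "inversion ?k s" using inv_us by simp
    have "inv ?k \<otimes> s \<otimes> ?k \<in> ?D" unfolding ik by (rule generate.eng[OF generate.eng[OF kD sD] kD])
    then have "inversion (?k \<otimes> c) s" using 1 noinv inversion_mult[OF kc cc sc] by simp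
    moreover have "?k \<otimes> c \<in> ?R" using c by (rule residue_stable[OF J h hsus])
    ultimately show False using side[OF c] one by simp
  next
    assume c: "s \<otimes> c \<in> ?R"
    have "inversion (s \<otimes> c) s"
      using s sc cc one by (simp add: inversion_mult inversion_gen gen_sq)
    moreover have "\<not> inversion (u \<otimes> s \<otimes> c) s"
    proof -
      have usD: "u \<otimes> s \<in> ?D" using uD sD by (rule generate.eng)
      have "inv (u \<otimes> s) \<otimes> s \<otimes> (u \<otimes> s) \<in> ?D"
        by (rule generate.eng[OF generate.eng[OF special_inv_closed[OF DS usD] sD] usD])
      then show ?thesis
        using noinv inv_us inversion_mult[of "u \<otimes> s" c s] sc uc cc by simp
    qed
    moreover have "u \<otimes> (s \<otimes> c) \<in> ?R" using c by (rule residue_stable[OF J h hu])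
    then have "u \<otimes> s \<otimes> c \<in> ?R" using sc uc cc by (simp add: m_assoc)
    ultimately show False using side[OF c] by simp
  qed
qed

text \<open>Finite index leaves only finitely many translates of the residue
  \<open>g\<langle>J\<rangle>\<close> under \<open>\<langle>D\<rangle>\<close>. A wall of
  \<open>\<langle>D\<rangle>\<close> that misses one translate separates it from its mirror image,
  hence separates \<open>1\<close> from one of finitely many residues; so the set \<open>F\<close>
  of these walls is finite. It is invariant under \<open>\<langle>D\<rangle>\<close>, so all walls
  of elements of \<open>\<langle>T\<rangle>\<close>, where \<open>T = D \<inter> F\<close>, lie in
  \<open>F\<close>, and this group is finite. By \<open>commute_of_residue\<close>, \<open>T\<close>
  commutes with the rest of \<open>D\<close>. Thus \<open>finite_part W D\<close> absorbs
  \<open>T\<close>, and the generators outside \<open>T\<close> preserve every translate.\<close>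

lemma essential_part_subset_conjugate:
  assumes finS: "finite S" and D: "D \<subseteq> S" and J: "J \<subseteq> S" and g: "g \<in> carrier W"
    and fi: "finite_index W (generate W D \<inter> conjugate W g (generate W J)) (generate W D)"
  shows "generate W (essential_part W D) \<subseteq> conjugate W g (generate W J)"
proof -
  let ?P = "generate W D" and ?J = "generate W J"
  let ?Q = "conjugate W g ?J"
  interpret P: subgroup ?P W using special_subgroup[OF D] .
  interpret J: subgroup ?J W using special_subgroup[OF J] .
  interpret Q: subgroup ?Q W using subgroup_conjugate[OF g special_subgroup[OF J]] .
  have PQ: "subgroup (?P \<inter> ?Q) W" by (intro subgroups_Inter_pair P.subgroup_axioms Q.subgroup_axioms)
  obtain F0 where F0: "finite F0" "F0 \<subseteq> ?P" "\<And>k. k \<in> ?P \<Longrightarrow> \<exists>a \<in> F0. k \<otimes> inv a \<in> ?P \<inter> ?Q"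
    by (rule finite_indexE[OF fi PQ P.subgroup_axioms]) blast+
  have conj_gen: "conjugate W (h \<otimes> j) ?J = conjugate W h ?J" if "h \<in> carrier W" "j \<in> ?J" for h j
    using that by (subst conjugate_mult) (simp_all add: conjugate_self[OF J.subgroup_axioms] J.subset)
  \<comment> \<open>The translate \<open>pg\<langle>J\<rangle>\<close> depends only on the coset of
    \<open>p^-1\<close>, so the representatives \<open>a^-1 g\<close> with \<open>a\<close> in the
    finite set \<open>F0\<close> suffice.\<close>
  have fin_orbit: "\<exists>a \<in> F0. \<exists>j \<in> ?J. inv a \<otimes> g = p \<otimes> g \<otimes> j" if p: "p \<in> ?P" for p
  proof -
    obtain a where a: "a \<in> F0" "inv p \<otimes> inv a \<in> ?P \<inter> ?Q" using F0(3)[of "inv p"] p by auto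
    then have ac: "a \<in> carrier W" using F0(2) P.subset by auto
    have "inv p \<otimes> inv a \<in> ?Q" using a(2) by simp
    then have j: "inv g \<otimes> (inv p \<otimes> inv a) \<otimes> g \<in> ?J"
      using mem_conjugate_iff[OF g J.subset, of "inv p \<otimes> inv a"] ac p by simp
    have "inv a \<otimes> g = p \<otimes> g \<otimes> (inv g \<otimes> (inv p \<otimes> inv a) \<otimes> g)"
      using g p ac by (simp add: m_assoc)
    then show ?thesis using a(1) j by (intro bexI)
  qed
  define R where "R = {t. \<exists>u \<in> ?P. \<exists>d \<in> D. t = u \<otimes> d \<otimes> inv u}"
  define F where "F = {t \<in> R. \<exists>p \<in> ?P. t \<notin> conjugate W (p \<otimes> g) ?J}"
  have RP: "t \<in> ?P" if tR: "t \<in> R" for t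
  proof -
    obtain u d where u: "u \<in> ?P" "d \<in> D" "t = u \<otimes> d \<otimes> inv u"
      using tR unfolding R_def by (elim CollectE bexE)
    then show ?thesis by (simp add: generate.incl)
  qed
  have Rinv: "inversion t t" if tR: "t \<in> R" for t
  proof -
    obtain u d where u: "u \<in> ?P" "d \<in> D" "t = u \<otimes> d \<otimes> inv u"
      using tR unfolding R_def by (elim CollectE bexE)
    then show ?thesis using D inversion_reflection[of u d] by auto
  qed
  have Rconj: "p \<otimes> t \<otimes> inv p \<in> R" if tR: "t \<in> R" and p: "p \<in> ?P" for t p
  proof -
    obtain u d where u: "u \<in> ?P" "d \<in> D" "t = u \<otimes> d \<otimes> inv u"
      using tR unfolding R_def by (elim CollectE bexE)
    have "d \<in> carrier W" using u(2) D by auto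
    then have "p \<otimes> t \<otimes> inv p = (p \<otimes> u) \<otimes> d \<otimes> inv (p \<otimes> u)"
      unfolding u(3) using u(1) p by (simp add: m_assoc inv_mult_group)
    moreover have "p \<otimes> u \<in> ?P" using u(1) p by simp
    ultimately show ?thesis unfolding R_def using u(2) by (intro CollectI bexI)
  qed
  have "F \<subseteq> (\<Union>a \<in> F0. inversions (inv a \<otimes> g))"
  proof
    fix t assume "t \<in> F"
    then obtain p where tR: "t \<in> R" and p: "p \<in> ?P" and np: "t \<notin> conjugate W (p \<otimes> g) ?J"
      unfolding F_def by (elim CollectE conjE bexE)
    have t: "t \<in> ?P" using RP[OF tR] .
    have pg: "p \<otimes> g \<in> carrier W" using p g by simp
    have tpg: "t \<otimes> p \<otimes> g \<in> carrier W" using t p g by simp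
    have ntp: "t \<notin> conjugate W (t \<otimes> p \<otimes> g) ?J"
    proof -
      have "inv (t \<otimes> p \<otimes> g) \<otimes> t \<otimes> (t \<otimes> p \<otimes> g) = inv (p \<otimes> g) \<otimes> t \<otimes> (p \<otimes> g)"
        using t p g by (simp add: m_assoc inv_mult_group)
      then show ?thesis
        using np mem_conjugate_iff[OF pg J.subset, of t] mem_conjugate_iff[OF tpg J.subset, of t] t
        by simp
    qed
    obtain a j where a: "a \<in> F0" "j \<in> ?J" "inv a \<otimes> g = p \<otimes> g \<otimes> j"
      using fin_orbit[OF p] by (elim bexE)
    obtain b k where b: "b \<in> F0" "k \<in> ?J" "inv b \<otimes> g = t \<otimes> p \<otimes> g \<otimes> k"
      using fin_orbit[OF P.m_closed[OF t p]] by (elim bexE)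
    \<comment> \<open>\<open>pg\<close> and its mirror image lie on opposite sides of the wall of
      \<open>t\<close>, and neither residue is cut by it; so one of the two representatives is
      separated from \<open>1\<close>.\<close>
    have "inversion (t \<otimes> (p \<otimes> g)) t = (inversion t t \<noteq> inversion (p \<otimes> g) (inv t \<otimes> t \<otimes> t))"
      using t pg by (intro inversion_mult) simp_all
    then have "inversion (t \<otimes> p \<otimes> g) t \<noteq> inversion (p \<otimes> g) t"
      using Rinv[OF tR] t p g by (simp add: m_assoc)
    then have "inversion (inv a \<otimes> g) t \<or> inversion (inv b \<otimes> g) t"
      unfolding a(3) b(3)
      using inversion_residue[OF J pg _ a(2) np] inversion_residue[OF J tpg _ b(2) ntp] t by auto
    then show "t \<in> (\<Union>a \<in> F0. inversions (inv a \<otimes> g))"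
      using a(1) b(1) t unfolding inversions_def by auto
  qed
  moreover have "finite (inversions (inv a \<otimes> g))" if "a \<in> F0" for a
    using that F0(2) P.subset g by (intro finite_inversions) auto
  ultimately have finF: "finite F" using F0(1) finite_subset by blast
  have Fconj: "p \<otimes> t \<otimes> inv p \<in> F" if t: "t \<in> F" and p: "p \<in> ?P" for t p
  proof -
    obtain q where tR: "t \<in> R" and q: "q \<in> ?P" and nq: "t \<notin> conjugate W (q \<otimes> g) ?J"
      using t unfolding F_def by (elim CollectE conjE bexE)
    have t: "t \<in> ?P" using RP[OF tR] .
    have "inv (p \<otimes> q \<otimes> g) \<otimes> (p \<otimes> t \<otimes> inv p) \<otimes> (p \<otimes> q \<otimes> g) = inv (q \<otimes> g) \<otimes> t \<otimes> (q \<otimes> g)"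
      using t p q g by (simp add: m_assoc inv_mult_group)
    then have "p \<otimes> t \<otimes> inv p \<notin> conjugate W (p \<otimes> q \<otimes> g) ?J"
      using nq mem_conjugate_iff[OF _ J.subset, of "q \<otimes> g" t] t p q g
        mem_conjugate_iff[OF _ J.subset, of "p \<otimes> q \<otimes> g" "p \<otimes> t \<otimes> inv p"] by simp
    moreover have "p \<otimes> q \<in> ?P" using p q by simp
    ultimately show ?thesis unfolding F_def using Rconj[OF tR p] by blast
  qed
  define T where "T = D \<inter> F"
  have TD: "T \<subseteq> D" and TS: "T \<subseteq> S" using D by (auto simp: T_def)
  have DR: "s \<in> R" if "s \<in> D" for s
  proof -
    have "s = \<one> \<otimes> s \<otimes> inv \<one>" using that D by auto
    then show ?thesis unfolding R_def using that generate.one by blast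
  qed
  have outside: "u \<in> conjugate W (p \<otimes> g) ?J" if "u \<in> R" "u \<notin> F" "p \<in> ?P" for u p
    using that unfolding F_def by blast
  have "finite (generate W T)"
  proof (rule inj_on_finite[where B = "Pow F"])
    show "inj_on inversions (generate W T)"
      by (rule inj_on_subset[OF inj_inversions]) (use special_closed[OF TS] in blast)
    show "inversions ` generate W T \<subseteq> Pow F"
    proof clarify
      fix w t assume w: "w \<in> generate W T" and "t \<in> inversions w"
      then have t: "t \<in> carrier W" "inversion w t" by (simp_all add: inversions_def)
      obtain u d where u: "u \<in> generate W T" "d \<in> T" "t = u \<otimes> d \<otimes> inv u"
        by (rule inversion_special[OF w TS t])
      have "u \<in> ?P" using u(1) mono_generate[OF TD] by blast
      then show "t \<in> F" unfolding u(3) using u(2) by (intro Fconj) (simp_all add: T_def)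
    qed
    show "finite (Pow F)" using finF by simp
  qed
  moreover have "u \<otimes> s = s \<otimes> u" if u: "u \<in> D - T" and s: "s \<in> T" for u s
  proof -
    \<comment> \<open>A translate missed by the wall of \<open>s\<close>. Both \<open>u\<close> and
      \<open>sus\<close> lie outside \<open>F\<close> and hence preserve it, as
      \<open>commute_of_residue\<close> requires.\<close>
    obtain p where p: "p \<in> ?P" and ns: "s \<notin> conjugate W (p \<otimes> g) ?J"
      using s unfolding T_def F_def by blast
    have uD: "u \<in> D" "u \<notin> F" and sD: "s \<in> D" using u s by (auto simp: T_def)
    have SS: "s \<in> S" "u \<in> S" using uD sD D by auto
    have sP: "s \<in> ?P" using sD by (rule generate.incl)
    have "s \<otimes> u \<otimes> s \<notin> F"
    proof
      assume "s \<otimes> u \<otimes> s \<in> F"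
      from Fconj[OF this sP] have "s \<otimes> (s \<otimes> u \<otimes> s) \<otimes> s \<in> F" using SS by simp
      then show False using uD(2) SS by (simp add: m_assoc gen_sq)
    qed
    moreover have "s \<otimes> u \<otimes> s \<in> R" using Rconj[OF DR[OF uD(1)] sP] SS by simp
    ultimately have "s \<otimes> u = u \<otimes> s"
      using p g ns SS outside[OF DR[OF uD(1)] uD(2) p] outside[OF _ _ p]
      by (intro commute_of_residue[OF J, of "p \<otimes> g"]) simp_all
    then show ?thesis by (rule HOL.sym)
  qed
  ultimately have "T \<subseteq> finite_part W D"
    using finite_part_greatest(2)[OF D finite_subset[OF D finS], of T] TD by blast
  then have "essential_part W D \<subseteq> D - T" by (auto simp: essential_part_def)
  also have "D - T \<subseteq> ?Q"
  proof
    fix s assume s: "s \<in> D - T"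
    then have "s \<in> conjugate W (\<one> \<otimes> g) ?J"
      by (intro outside DR generate.one) (simp_all add: T_def)
    then show "s \<in> ?Q" using g by simp
  qed
  finally show ?thesis by (rule generate_subgroup_incl) (rule Q.subgroup_axioms)
qed

text \<open>Replace \<open>g\<close> by an element \<open>h\<close> of least length in
  \<open>\<langle>J\<rangle>g\<langle>I\<rangle>\<close>. No wall in
  \<open>\<langle>J\<rangle>\<close> separates \<open>1\<close> from \<open>h\<close>, which forces
  \<open>h s h^-1\<close>, for \<open>s \<in> I\<close>, to have only one wall and so to be a
  generator. Conjugation by \<open>h\<close> therefore embeds \<open>I\<close> into
  \<open>J\<close>, and counting does the rest.\<close>

lemma conjugate_special_subset:
  assumes finS: "finite S" and I: "I \<subseteq> S" and J: "J \<subseteq> S" and g: "g \<in> carrier W"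
    and sub: "conjugate W g (generate W I) \<subseteq> generate W J"
  shows "card I \<le> card J" and "card J \<le> card I \<Longrightarrow> conjugate W g (generate W I) = generate W J"
proof -
  let ?I = "generate W I" and ?J = "generate W J"
  interpret I: subgroup ?I W using special_subgroup[OF I] .
  interpret J: subgroup ?J W using special_subgroup[OF J] .
  obtain x where x: "fst x \<in> ?J \<and> snd x \<in> ?I"
    and min: "\<forall>y. fst y \<in> ?J \<and> snd y \<in> ?I \<longrightarrow> len (fst x \<otimes> g \<otimes> snd x) \<le> len (fst y \<otimes> g \<otimes> snd y)"
    using ex_has_least_nat[of "\<lambda>y. fst y \<in> ?J \<and> snd y \<in> ?I" "(\<one>, \<one>)" "\<lambda>y. len (fst y \<otimes> g \<otimes> snd y)"]
      generate.one by auto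
  define j where "j = fst x"
  define i where "i = snd x"
  define h where "h = j \<otimes> g \<otimes> i"
  have j: "j \<in> ?J" and i: "i \<in> ?I" using x by (simp_all add: j_def i_def)
  have min: "len h \<le> len (j' \<otimes> g \<otimes> i')" if "j' \<in> ?J" "i' \<in> ?I" for j' i'
    using min[rule_format, of "(j', i')"] that by (simp add: h_def j_def i_def)
  have h: "h \<in> carrier W" using g j i by (simp add: h_def)
  have conj: "conjugate W h ?I = conjugate W j (conjugate W g ?I)"
    using g j i unfolding h_def
    by (simp add: conjugate_mult I.subset conjugate_self[OF I.subgroup_axioms])
  have mem: "h \<otimes> s \<otimes> inv h \<in> J" if s: "s \<in> I" for s
  proof -
    let ?t = "h \<otimes> s \<otimes> inv h"
    have sS: "s \<in> S" using s I by blast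
    have sc: "s \<in> carrier W" using sS by simp
    have tc: "?t \<in> carrier W" using h sc by simp
    have "?t \<in> conjugate W h ?I" using s by (simp add: conjugate_eq_image generate.incl)
    also have "\<dots> \<subseteq> conjugate W j ?J" unfolding conj using sub by (rule conjugate_mono)
    also have "\<dots> = ?J" using J.subgroup_axioms j by (rule conjugate_self)
    finally have tJ: "?t \<in> ?J" .
    have th: "?t \<otimes> h = h \<otimes> s" using h sc by (simp add: m_assoc)
    have noJ: "\<not> inversion h r" if r: "r \<in> ?J" for r
    proof
      assume "inversion h r"
      then have "len (r \<otimes> h) < len h" using h r by (intro len_reflect_less) simp_all
      moreover have "r \<otimes> h = (r \<otimes> j) \<otimes> g \<otimes> i" using r g j i by (simp add: h_def m_assoc)
      moreover have "len h \<le> len ((r \<otimes> j) \<otimes> g \<otimes> i)" using r j i by (intro min) simp_all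
      ultimately show False by simp
    qed
    \<comment> \<open>Inside \<open>\<langle>J\<rangle>\<close>, every wall of \<open>?t\<close> is
      one of \<open>?t \<otimes> h = h \<otimes> s\<close>, and there \<open>h \<otimes> s\<close>
      has at most the wall of \<open>?t\<close> itself.\<close>
    have "r = ?t" if r: "r \<in> carrier W" "inversion ?t r" for r
    proof -
      have rJ: "r \<in> ?J" using tJ J r by (rule inversion_special_mem)
      have "inversion (?t \<otimes> h) r = (inversion ?t r \<noteq> inversion h (inv ?t \<otimes> r \<otimes> ?t))"
        using tc h r by (intro inversion_mult)
      moreover have "inv ?t \<otimes> r \<otimes> ?t \<in> ?J" by (rule J.m_closed[OF J.m_closed[OF J.m_inv_closed[OF tJ] rJ] tJ])
      ultimately have "inversion (h \<otimes> s) r" unfolding th using r noJ by simp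
      then have "inv h \<otimes> r \<otimes> h = s"
        using noJ[OF rJ] h r sS sc by (simp add: inversion_mult inversion_gen)
      then have "h \<otimes> (inv h \<otimes> r \<otimes> h) \<otimes> inv h = ?t" by simp
      then show ?thesis using h r by (simp add: m_assoc)
    qed
    then have "inversions ?t \<subseteq> {?t}" by (auto simp: inversions_def)
    then have le: "len ?t \<le> 1" using card_mono[of "{?t}" "inversions ?t"] by simp
    obtain ls where ls: "ls \<in> lists J" "lprod ls = ?t" "length ls = len ?t"
      by (rule reduced_word[OF tJ J])
    have "ls \<noteq> []"
    proof
      assume "ls = []"
      then have "?t = \<one>" using ls(2) by simp
      then have "inv h \<otimes> ?t \<otimes> h = \<one>" using h by simp
      then have "s = \<one>" using h sc by (simp add: m_assoc)
      then show False using gen_ne_one[OF sS] by simp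
    qed
    then obtain d r where dr: "ls = d # r" by (cases ls) simp_all
    have "length ls \<le> 1" using ls(3) le by linarith
    then have "r = []" using dr by simp
    then have "lprod ls = d \<otimes> \<one>" "d \<in> J" using dr ls(1) by simp_all
    moreover have "d \<in> carrier W" using \<open>d \<in> J\<close> J by auto
    ultimately show ?thesis using ls(2) by simp
  qed
  let ?f = "\<lambda>s. h \<otimes> s \<otimes> inv h"
  have Ic: "I \<subseteq> carrier W" using I S_closed by blast
  have inj: "inj_on ?f I"
    using h Ic by (intro inj_onI) (simp add: subset_iff)
  have finJ: "finite J" using J finS by (rule finite_subset)
  have sub': "?f ` I \<subseteq> J" using mem by blast
  show "card I \<le> card J" using card_inj_on_le[OF inj sub' finJ] .
  assume "card J \<le> card I"
  then have "?f ` I = J" using card_image[OF inj] by (intro card_seteq[OF finJ sub']) simp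
  then have "conjugate W h ?I = ?J" using conjugate_generate[OF h Ic] by simp
  then have "conjugate W (inv j) (conjugate W j (conjugate W g ?I)) = conjugate W (inv j) ?J"
    using conj by simp
  moreover have "conjugate W (inv j) ?J = ?J" using j by (intro conjugate_self J.subgroup_axioms) simp
  moreover have "conjugate W (inv j) (conjugate W j (conjugate W g ?I)) = conjugate W g ?I"
    using g j conjugate_subset_carrier[OF g I.subset]
    by (simp add: conjugate_mult[symmetric] conjugate_one)
  ultimately show "conjugate W g ?I = ?J" by simp
qed

end


section \<open>The Bass-Serre tree\<close>

lemma (in group) l_coset_eq_iff:
  assumes C: "subgroup C G" and x: "x \<in> carrier G" and y: "y \<in> carrier G"
  shows "x <# C = y <# C \<longleftrightarrow> inv x \<otimes> y \<in> C"
proof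
  assume e: "x <# C = y <# C"
  have "y \<otimes> \<one> \<in> y <# C" using subgroup.one_closed[OF C] by (auto simp: l_coset_def)
  then have "y \<in> x <# C" using y e by simp
  then obtain c where c: "c \<in> C" "y = x \<otimes> c" unfolding l_coset_def by (elim UN_E singletonE)
  then show "inv x \<otimes> y \<in> C" using x subgroup.mem_carrier[OF C] by simp
next
  assume c: "inv x \<otimes> y \<in> C"
  then have "x \<otimes> (inv x \<otimes> y) \<in> x <# C" unfolding l_coset_def by (rule UN_I) (rule singletonI)
  then have "y \<in> x <# C" using x y by simp
  then show "x <# C = y <# C" using x C by (rule l_repr_independence)
qed

text \<open>The Bass-Serre tree of \<open>A *\<^sub>C B\<close> has the vertices \<open>gA\<close>, \<open>gB\<close> and the edges \<open>gC\<close>. Removing the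
  edge \<open>C\<close> leaves two half-trees; \<open>HA g\<close> and \<open>HB g\<close> say that the vertices \<open>gA\<close> and \<open>gB\<close>
  belong to the one which contains the vertex \<open>B\<close>.\<close>

locale half_tree = group G for G (structure) +
  fixes A B C :: "'a set" and HA HB :: "'a \<Rightarrow> bool"
  assumes subgroup_A: "subgroup A G" and subgroup_B: "subgroup B G" and subgroup_C: "subgroup C G"
    and C_subset: "C \<subseteq> A" "C \<subseteq> B"
    and generate_AB: "generate G (A \<union> B) = carrier G"
    and HA_mult: "g \<in> carrier G \<Longrightarrow> a \<in> A \<Longrightarrow> HA (g \<otimes> a) = HA g"
    and HB_mult: "g \<in> carrier G \<Longrightarrow> b \<in> B \<Longrightarrow> HB (g \<otimes> b) = HB g"
    and edge: "g \<in> carrier G \<Longrightarrow> HA g \<noteq> HB g \<longleftrightarrow> g \<in> C"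
    and HA_one: "\<not> HA \<one>"
begin

sublocale A: subgroup A G by (rule subgroup_A)
sublocale B: subgroup B G by (rule subgroup_B)
sublocale C: subgroup C G by (rule subgroup_C)

lemma HB_one: "HB \<one>"
  using edge[of \<one>] HA_one by simp

text \<open>The complementary half-tree belongs to the reversed edge, so the roles of
  \<open>A\<close> and \<open>B\<close> can be exchanged in what follows.\<close>

lemma swap: "half_tree G B A C (\<lambda>g. \<not> HB g) (\<lambda>g. \<not> HA g)"
proof unfold_locales
  show "generate G (B \<union> A) = carrier G" using generate_AB by (simp add: Un_commute)
  show "((\<not> HB g) \<noteq> (\<not> HA g)) = (g \<in> C)" if "g \<in> carrier G" for g
    using edge[OF that] by blast
qed (simp_all add: subgroup_A subgroup_B subgroup_C C_subset HA_mult HB_mult HB_one)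

text \<open>Connectedness of the tree: a function on the vertices, given by \<open>P\<close> on the \<open>gA\<close> and by \<open>Q\<close> on the
  \<open>gB\<close>, is constant if it takes the same value at both ends of every edge.\<close>

lemma connected:
  assumes P: "\<And>g a. g \<in> carrier G \<Longrightarrow> a \<in> A \<Longrightarrow> P (g \<otimes> a) = P g"
    and Q: "\<And>g b. g \<in> carrier G \<Longrightarrow> b \<in> B \<Longrightarrow> Q (g \<otimes> b) = Q g"
    and PQ: "\<And>g. g \<in> carrier G \<Longrightarrow> P g = Q g"
    and g: "g \<in> carrier G"
  shows "P g = P \<one>"
proof -
  have step: "P (h \<otimes> x) = P h" if "h \<in> carrier G" "x \<in> A \<union> B" for h x
    using that P[of h x] Q[of h x] PQ[of h] PQ[of "h \<otimes> x"] by auto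
  have "g \<in> generate G (A \<union> B)" using g generate_AB by simp
  then have "g \<in> carrier G \<and> (\<forall>h \<in> carrier G. P (h \<otimes> g) = P h)"
  proof induction
    case (inv x)
    then have "inv x \<in> A \<union> B" by auto
    then show ?case using step inv by auto
  next
    case (eng x y)
    then have "P (h \<otimes> (x \<otimes> y)) = P h" if "h \<in> carrier G" for h
      using that by (simp flip: m_assoc)
    then show ?case using eng by simp
  qed (use step in auto)
  then have "P (\<one> \<otimes> g) = P \<one>" by blast
  then show ?thesis using g by simp
qed

text \<open>\<open>c\<close> fixes the edge \<open>C\<close>. Whether \<open>c\<close> changes the
  side of a vertex is therefore the same at both ends of every edge, and the vertex \<open>A\<close>
  is fixed.\<close>

lemma C_invariant:
  assumes c: "c \<in> C" and g: "g \<in> carrier G"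
  shows "HA (c \<otimes> g) = HA g" and "HB (c \<otimes> g) = HB g"
proof -
  have cg: "c \<otimes> g \<in> C \<longleftrightarrow> g \<in> C" if "g \<in> carrier G" for g
  proof
    assume "c \<otimes> g \<in> C"
    then have "inv c \<otimes> (c \<otimes> g) \<in> C" by (rule C.m_closed[OF C.m_inv_closed[OF c]])
    then show "g \<in> C" using that c by simp
  qed (use c in simp)
  have PQ: "(HA (c \<otimes> g) \<noteq> HA g) = (HB (c \<otimes> g) \<noteq> HB g)" if "g \<in> carrier G" for g
    using edge[OF that] edge[of "c \<otimes> g"] cg[OF that] that c by auto
  have "(HA (c \<otimes> g) \<noteq> HA g) = (HA (c \<otimes> \<one>) \<noteq> HA \<one>)"
  proof (rule connected[OF _ _ PQ g])
    show "(HA (c \<otimes> (g \<otimes> a)) \<noteq> HA (g \<otimes> a)) = (HA (c \<otimes> g) \<noteq> HA g)"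
      if "g \<in> carrier G" "a \<in> A" for g a
      using that c HA_mult[of "c \<otimes> g" a] HA_mult[of g a] by (simp add: m_assoc)
    show "(HB (c \<otimes> (g \<otimes> b)) \<noteq> HB (g \<otimes> b)) = (HB (c \<otimes> g) \<noteq> HB g)"
      if "g \<in> carrier G" "b \<in> B" for g b
      using that c HB_mult[of "c \<otimes> g" b] HB_mult[of g b] by (simp add: m_assoc)
  qed
  moreover have "HA (\<one> \<otimes> c) = HA \<one>" using c C_subset by (intro HA_mult) auto
  ultimately show "HA (c \<otimes> g) = HA g" using c by simp
  then show "HB (c \<otimes> g) = HB g" using PQ[OF g] by simp
qed

text \<open>For distinct edges \<open>C\<close> and \<open>xC\<close>, the half-tree of \<open>C\<close> avoiding \<open>xC\<close> and the half-tree of \<open>xC\<close>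
  avoiding \<open>C\<close> are disjoint.\<close>

lemma nested:
  assumes x: "x \<in> carrier G" "x \<notin> C" and g: "g \<in> carrier G"
  shows "HA g = HA x \<or> HA (inv x \<otimes> g) = HA (inv x)"
proof -
  \<comment> \<open>Lying in both half-trees could change only across the edges \<open>C\<close> and
    \<open>xC\<close>, but across each of them one of the two conditions is false at both ends. It
    fails at the vertex \<open>A\<close>, hence everywhere.\<close>
  have PQ: "(HA g \<noteq> HA x \<and> HA (inv x \<otimes> g) \<noteq> HA (inv x)) =
      (HB g \<noteq> HA x \<and> HB (inv x \<otimes> g) \<noteq> HA (inv x))" if g: "g \<in> carrier G" for g
  proof -
    have ig: "inv x \<otimes> g \<in> carrier G" using x g by simp
    have xg: "x \<otimes> (inv x \<otimes> g) = g" using x g by simp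
    consider "g \<in> C" | "inv x \<otimes> g \<in> C" | "g \<notin> C" "inv x \<otimes> g \<notin> C" by blast
    then show ?thesis
    proof cases
      case 1
      have "inv x \<otimes> g \<notin> C"
      proof
        assume "inv x \<otimes> g \<in> C"
        then have "g \<otimes> inv (inv x \<otimes> g) \<in> C" using 1 by simp
        then show False using x g by (simp add: inv_mult_group flip: m_assoc)
      qed
      then have "HB (inv x \<otimes> g) = HA (inv x \<otimes> g)" using edge[OF ig] by simp
      moreover have "HA (inv x \<otimes> g) = HA (inv x)" using 1 C_subset x by (intro HA_mult) auto
      ultimately show ?thesis by simp
    next
      case 2
      have "g \<notin> C"
      proof
        assume "g \<in> C"
        then have "g \<otimes> inv (inv x \<otimes> g) \<in> C" using 2 by simp
        then show False using x g by (simp add: inv_mult_group flip: m_assoc)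
      qed
      then have "HB g = HA g" using edge[OF g] by simp
      moreover have "HA (x \<otimes> (inv x \<otimes> g)) = HA x" using 2 C_subset x by (intro HA_mult) auto
      ultimately show ?thesis using xg by simp
    next
      case 3
      then show ?thesis using edge[OF g] edge[OF ig] by simp
    qed
  qed
  have "(HA g \<noteq> HA x \<and> HA (inv x \<otimes> g) \<noteq> HA (inv x)) =
      (HA \<one> \<noteq> HA x \<and> HA (inv x \<otimes> \<one>) \<noteq> HA (inv x))"
  proof (rule connected[OF _ _ PQ g])
    show "(HA (g \<otimes> a) \<noteq> HA x \<and> HA (inv x \<otimes> (g \<otimes> a)) \<noteq> HA (inv x)) =
      (HA g \<noteq> HA x \<and> HA (inv x \<otimes> g) \<noteq> HA (inv x))" if "g \<in> carrier G" "a \<in> A" for g a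
      using that x HA_mult[of "inv x \<otimes> g" a] HA_mult[of g a] by (simp add: m_assoc)
    show "(HB (g \<otimes> b) \<noteq> HA x \<and> HB (inv x \<otimes> (g \<otimes> b)) \<noteq> HA (inv x)) =
      (HB g \<noteq> HA x \<and> HB (inv x \<otimes> g) \<noteq> HA (inv x))" if "g \<in> carrier G" "b \<in> B" for g b
      using that x HB_mult[of "inv x \<otimes> g" b] HB_mult[of g b] by (simp add: m_assoc)
  qed
  then show ?thesis using x by simp
qed

text \<open>By \<open>nested\<close>, \<open>s\<close> maps the half-tree \<open>HA\<close> into its
  complement and \<open>t\<close> maps the complement into \<open>HA\<close>.\<close>

lemma ping_pong:
  assumes s: "s \<in> carrier G" "s \<otimes> s = \<one>" "s \<notin> C" "\<not> HA s"
    and t: "t \<in> carrier G" "t \<otimes> t = \<one>" "t \<notin> C" "HA t" and n: "n > (0 :: nat)"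
  shows "(s \<otimes> t) [^] n \<noteq> \<one>"
proof
  have inv: "inv s = s" "inv t = t" using s t by (simp_all add: inv_equality)
  have S: "\<not> HA (s \<otimes> g)" if "HA g" "g \<in> carrier G" for g
    using nested[OF s(1,3) that(2)] that(1) s(4) inv by simp
  have T: "HA (t \<otimes> g)" if "\<not> HA g" "g \<in> carrier G" for g
    using nested[OF t(1,3) that(2)] that(1) t(4) inv by simp
  have pow: "(s \<otimes> t) [^] Suc k = s \<otimes> (t \<otimes> (s \<otimes> t) [^] k)" for k
    using nat_pow_Suc2[of "s \<otimes> t" k] s t by (simp add: m_assoc del: nat_pow_Suc)
  have neg: "\<not> HA ((s \<otimes> t) [^] k)" for k :: nat
  proof (induction k)
    case (Suc k)
    then have "HA (t \<otimes> (s \<otimes> t) [^] k)" using s t by (intro T) simp_all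
    then show ?case unfolding pow using s t by (intro S) simp_all
  qed (simp add: HA_one)
  \<comment> \<open>The side of \<open>(st)^n\<close> is that of \<open>1\<close> and gives no
    contradiction; cancelling one factor \<open>s\<close> equates \<open>t(st)^(n-1)\<close> with
    \<open>s\<close>, and these are on different sides.\<close>
  assume e: "(s \<otimes> t) [^] n = \<one>"
  obtain k where k: "n = Suc k" using n gr0_implies_Suc by blast
  have c: "t \<otimes> (s \<otimes> t) [^] k \<in> carrier G" using s t by simp
  have "s \<otimes> (s \<otimes> (t \<otimes> (s \<otimes> t) [^] k)) = s" using e s unfolding k pow by simp
  then have "t \<otimes> (s \<otimes> t) [^] k = s" using s c by (simp flip: m_assoc)
  moreover have "HA (t \<otimes> (s \<otimes> t) [^] k)" using neg s t by (intro T) simp_all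
  ultimately show False using s by simp
qed

text \<open>If \<open>s\<close> lies in the half-tree and \<open>t\<close> does not, reversing the
  edge restores the configuration of \<open>ping_pong\<close>; off \<open>C\<close> the predicates
  \<open>HA\<close> and \<open>HB\<close> agree.\<close>

lemma opposite_sides_pow:
  assumes s: "s \<in> carrier G" "s \<otimes> s = \<one>" "s \<notin> C" and t: "t \<in> carrier G" "t \<otimes> t = \<one>" "t \<notin> C"
    and "HA s \<noteq> HA t" and n: "n > (0 :: nat)"
  shows "(s \<otimes> t) [^] n \<noteq> \<one>"
proof (cases "HA s")
  case False
  then show ?thesis using assms by (intro ping_pong) simp_all
next
  case True
  then have "HB s" "\<not> HB t" using edge[OF s(1)] edge[OF t(1)] s t assms(7) by auto
  then show ?thesis using half_tree.ping_pong[OF swap s _ t _ n] by simp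
qed

text \<open>Supplies the edge across which \<open>descent_step\<close> moves: the first one on the
  path from \<open>A\<close> to \<open>hA\<close>, which has the form \<open>aC\<close>.\<close>

lemma first_edge:
  assumes h: "h \<in> carrier G" "h \<notin> A"
  obtains a where "a \<in> A" "HA (inv a \<otimes> h)"
proof -
  let ?U = "\<lambda>g. \<forall>a \<in> A. \<not> HA (inv a \<otimes> g)"
  \<comment> \<open>\<open>?U\<close> changes only across the edges at the vertex \<open>A\<close>,
    where equality with that vertex changes as well, so their exclusive or is constant. On the
    vertices \<open>gB\<close>, which all differ from \<open>A\<close>, the second term is false and
    drops out.\<close>
  have PQ: "(?U g \<noteq> (g \<in> A)) = (\<forall>a \<in> A. \<not> HB (inv a \<otimes> g))" if g: "g \<in> carrier G" for g
  proof (cases "g \<in> A")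
    case True
    have "HA (\<one> \<otimes> (inv a \<otimes> g)) = HA \<one>" if "a \<in> A" for a using that True by (intro HA_mult) simp_all
    then have "?U g" using g HA_one by simp
    moreover have "HB (inv g \<otimes> g)" using HB_one g by simp
    ultimately show ?thesis using True by blast
  next
    case False
    have "HA (inv a \<otimes> g) = HB (inv a \<otimes> g)" if a: "a \<in> A" for a
    proof -
      have "inv a \<otimes> g \<notin> C"
      proof
        assume "inv a \<otimes> g \<in> C"
        then have "inv a \<otimes> g \<in> A" using C_subset by blast
        then have "a \<otimes> (inv a \<otimes> g) \<in> A" by (rule A.m_closed[OF a])
        then show False using False a g by simp
      qed
      then show ?thesis using edge[of "inv a \<otimes> g"] a g by simp
    qed
    then show ?thesis using False by simp
  qed
  have mem: "g \<otimes> a \<in> A \<longleftrightarrow> g \<in> A" if "g \<in> carrier G" "a \<in> A" for g a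
  proof
    assume "g \<otimes> a \<in> A"
    then have "g \<otimes> a \<otimes> inv a \<in> A" using that(2) by simp
    then show "g \<in> A" using that by (simp add: m_assoc)
  qed (use that in simp)
  have one: "?U \<one>"
  proof
    fix a assume "a \<in> A"
    then have "HA (\<one> \<otimes> inv a) = HA \<one>" by (intro HA_mult) simp_all
    then show "\<not> HA (inv a \<otimes> \<one>)" using HA_one \<open>a \<in> A\<close> by simp
  qed
  have "(?U h \<noteq> (h \<in> A)) = (?U \<one> \<noteq> (\<one> \<in> A))"
  proof (rule connected[OF _ _ PQ h(1)])
    fix g a assume ga: "g \<in> carrier G" "a \<in> A"
    have "HA (inv a' \<otimes> (g \<otimes> a)) = HA (inv a' \<otimes> g)" if "a' \<in> A" for a'
      using that ga HA_mult[of "inv a' \<otimes> g" a] by (simp add: m_assoc)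
    then show "(?U (g \<otimes> a) \<noteq> (g \<otimes> a \<in> A)) = (?U g \<noteq> (g \<in> A))" using mem[OF ga] by simp
  next
    fix g b assume gb: "g \<in> carrier G" "b \<in> B"
    have "HB (inv a' \<otimes> (g \<otimes> b)) = HB (inv a' \<otimes> g)" if "a' \<in> A" for a'
      using that gb HB_mult[of "inv a' \<otimes> g" b] by (simp add: m_assoc)
    then show "(\<forall>a \<in> A. \<not> HB (inv a \<otimes> (g \<otimes> b))) = (\<forall>a \<in> A. \<not> HB (inv a \<otimes> g))" by simp
  qed
  then have "\<not> ?U h" using h(2) one by simp
  then show ?thesis using that by blast
qed

text \<open>With \<open>H = HA\<close> (\<open>H = HB\<close>), these are the edges separating the vertices \<open>gA\<close> and \<open>hA\<close> (\<open>gB\<close> and \<open>hB\<close>).\<close>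

definition separating :: "('a \<Rightarrow> bool) \<Rightarrow> 'a \<Rightarrow> 'a \<Rightarrow> 'a set set" where
  "separating H g h = (\<lambda>y. y <# C) ` {y \<in> carrier G. H (inv y \<otimes> g) \<noteq> H (inv y \<otimes> h)}"

text \<open>Moving \<open>h\<close> across one edge alters the set by at most that edge, so
  finiteness is constant on the tree; for \<open>h = g\<close> the set is empty.\<close>

lemma finite_separating:
  assumes g: "g \<in> carrier G" and h: "h \<in> carrier G"
  shows "finite (separating HA g h)"
proof -
  let ?P = "\<lambda>h. finite ((\<lambda>y. y <# C) ` {y \<in> carrier G. HA (inv y \<otimes> g) \<noteq> HA (inv y \<otimes> h)})"
  let ?Q = "\<lambda>h. finite ((\<lambda>y. y <# C) ` {y \<in> carrier G. HA (inv y \<otimes> g) \<noteq> HB (inv y \<otimes> h)})"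
  have const: "?P h = ?P \<one>" if "h \<in> carrier G" for h
  proof (rule connected[OF _ _ _ that, where Q = ?Q])
    fix h a assume ha: "h \<in> carrier G" "a \<in> A"
    have "HA (inv y \<otimes> (h \<otimes> a)) = HA (inv y \<otimes> h)" if "y \<in> carrier G" for y
      using that ha HA_mult[of "inv y \<otimes> h" a] by (simp add: m_assoc)
    then show "?P (h \<otimes> a) = ?P h" by (simp cong: conj_cong)
  next
    fix h b assume hb: "h \<in> carrier G" "b \<in> B"
    have "HB (inv y \<otimes> (h \<otimes> b)) = HB (inv y \<otimes> h)" if "y \<in> carrier G" for y
      using that hb HB_mult[of "inv y \<otimes> h" b] by (simp add: m_assoc)
    then show "?Q (h \<otimes> b) = ?Q h" by (simp cong: conj_cong)
  next
    fix h assume h: "h \<in> carrier G"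
    have e: "y <# C = h <# C" if "y \<in> carrier G" "HA (inv y \<otimes> h) \<noteq> HB (inv y \<otimes> h)" for y
      using that h edge[of "inv y \<otimes> h"] l_coset_eq_iff[OF subgroup_C that(1) h] by simp
    show "?P h = ?Q h"
    proof
      assume "?P h"
      then show "?Q h"
        by (rule finite_subset[rotated, OF finite.insertI[of _ "h <# C"]]) (use e in auto)
    next
      assume "?Q h"
      then show "?P h"
        by (rule finite_subset[rotated, OF finite.insertI[of _ "h <# C"]]) (use e in auto)
    qed
  qed
  have "?P g" by simp
  then show ?thesis using const[OF g] const[OF h] by (simp add: separating_def)
qed

text \<open>The vertex \<open>gA\<close> is moved by \<open>s\<close>, so the path to its image
  starts with an edge \<open>xC\<close>, where \<open>xA = gA\<close>. By \<open>side\<close> every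
  generator that moves this edge moves it to the half-tree beyond it. Crossing to \<open>xB\<close>
  thus reduces the displacement by these generators, while those fixing the edge fix
  \<open>xB\<close>.\<close>

lemma descent_step:
  fixes S :: "'a set"
  defines "f \<equiv> \<lambda>H g. \<Sum>s \<in> S. card (separating H g (s \<otimes> g))"
  assumes finS: "finite S" and S: "S \<subseteq> carrier G" "\<And>s. s \<in> S \<Longrightarrow> s \<otimes> s = \<one>"
    and side: "\<And>x s t. x \<in> carrier G \<Longrightarrow> s \<in> S \<Longrightarrow> t \<in> S \<Longrightarrow> inv x \<otimes> s \<otimes> x \<notin> C \<Longrightarrow>
      inv x \<otimes> t \<otimes> x \<notin> C \<Longrightarrow> HA (inv x \<otimes> s \<otimes> x) = HA (inv x \<otimes> t \<otimes> x)"
    and g: "g \<in> carrier G" and s: "s \<in> S" "inv g \<otimes> s \<otimes> g \<notin> A"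
  obtains x where "x \<in> carrier G" "f HB x < f HA g"
proof -
  have sc: "s \<in> carrier G" using s S by blast
  obtain a where a: "a \<in> A" "HA (inv a \<otimes> (inv g \<otimes> s \<otimes> g))"
    using first_edge[of "inv g \<otimes> s \<otimes> g"] s(2) sc g by auto
  define x where "x = g \<otimes> a"
  have x: "x \<in> carrier G" using g a by (simp add: x_def)
  have xs: "inv x \<otimes> s \<otimes> x = inv a \<otimes> (inv g \<otimes> s \<otimes> g) \<otimes> a"
    using g a sc by (simp add: x_def inv_mult_group m_assoc)
  have Hs: "HA (inv x \<otimes> s \<otimes> x)" unfolding xs using a g sc by (simp add: HA_mult)
  have nC: "inv x \<otimes> s \<otimes> x \<notin> C"
  proof
    assume "inv x \<otimes> s \<otimes> x \<in> C"
    then have "a \<otimes> (inv x \<otimes> s \<otimes> x) \<otimes> inv a \<in> A" using C_subset a by auto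
    then show False using s(2) g a sc unfolding xs by (simp add: m_assoc)
  qed
  have sepA: "separating HA g (t \<otimes> g) = separating HA x (t \<otimes> x)" if t: "t \<in> carrier G" for t
  proof -
    have "HA (inv y \<otimes> x) = HA (inv y \<otimes> g)" if "y \<in> carrier G" for y
      using that g a HA_mult[of "inv y \<otimes> g" a] by (simp add: x_def m_assoc)
    moreover have "HA (inv y \<otimes> (t \<otimes> x)) = HA (inv y \<otimes> (t \<otimes> g))" if "y \<in> carrier G" for y
      using that g a t HA_mult[of "inv y \<otimes> (t \<otimes> g)" a] by (simp add: x_def m_assoc)
    ultimately show ?thesis by (simp add: separating_def cong: conj_cong)
  qed
  have stable: "card (separating HB x (t \<otimes> x)) \<le> card (separating HA g (t \<otimes> g))"
    if t: "t \<in> S" "inv x \<otimes> t \<otimes> x \<in> C" for t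
  proof -
    have tc: "t \<in> carrier G" using t S by blast
    have "HB (inv y \<otimes> (t \<otimes> x)) = HB (inv y \<otimes> x)" if y: "y \<in> carrier G" for y
    proof -
      have "HB (inv y \<otimes> x \<otimes> (inv x \<otimes> t \<otimes> x)) = HB (inv y \<otimes> x)"
        using x y t C_subset by (intro HB_mult) auto
      then show ?thesis using x y tc by (simp add: m_assoc)
    qed
    then have "separating HB x (t \<otimes> x) = {}" by (auto simp: separating_def)
    then show ?thesis by simp
  qed
  have moved: "card (separating HB x (t \<otimes> x)) < card (separating HA g (t \<otimes> g))"
    if t: "t \<in> S" "inv x \<otimes> t \<otimes> x \<notin> C" for t
  proof -
    have tc: "t \<in> carrier G" using t S by blast
    let ?t = "inv x \<otimes> t \<otimes> x"
    have t'c: "?t \<in> carrier G" using x tc by simp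
    have Ht: "HA ?t" using side[OF x s(1) t(1) nC t(2)] Hs by simp
    then have HBt: "HB ?t" using edge[OF t'c] t(2) by simp
    have mem: "x <# C \<in> separating HA x (t \<otimes> x)"
      unfolding separating_def using x tc HA_one Ht
      by (intro imageI) (simp add: m_assoc)
    \<comment> \<open>Passing from the ends \<open>xA\<close>, \<open>txA\<close> to
      \<open>xB\<close>, \<open>txB\<close> matters only for the edges \<open>xC\<close> and
      \<open>txC\<close>, and neither of these separates \<open>xB\<close> from
      \<open>txB\<close>.\<close>
    have "separating HB x (t \<otimes> x) \<subseteq> separating HA x (t \<otimes> x) - {x <# C}"
    proof
      fix e assume "e \<in> separating HB x (t \<otimes> x)"
      then obtain y where y: "y \<in> carrier G" "HB (inv y \<otimes> x) \<noteq> HB (inv y \<otimes> (t \<otimes> x))" "e = y <# C"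
        unfolding separating_def by (elim imageE CollectE conjE)
      have c1: "inv y \<otimes> x \<in> carrier G" and c2: "inv y \<otimes> (t \<otimes> x) \<in> carrier G"
        using x y tc by simp_all
      have 1: "inv y \<otimes> x \<notin> C"
      proof
        assume c: "inv y \<otimes> x \<in> C"
        have "inv y \<otimes> (t \<otimes> x) = (inv y \<otimes> x) \<otimes> ?t" using x y tc by (simp add: m_assoc)
        then have "HB (inv y \<otimes> (t \<otimes> x))" using C_invariant(2)[OF c t'c] HBt by simp
        moreover have "HB (inv y \<otimes> x)" using C_invariant(2)[OF c one_closed] HB_one c1 by simp
        ultimately show False using y(2) by simp
      qed
      have 2: "inv y \<otimes> (t \<otimes> x) \<notin> C"
      proof
        assume c: "inv y \<otimes> (t \<otimes> x) \<in> C"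
        have "t \<otimes> (t \<otimes> x) = x" using S(2)[OF t(1)] tc x by (simp flip: m_assoc)
        then have "inv y \<otimes> x = (inv y \<otimes> (t \<otimes> x)) \<otimes> ?t" using x y tc by (simp add: m_assoc)
        then have "HB (inv y \<otimes> x)" using C_invariant(2)[OF c t'c] HBt by simp
        moreover have "HB (inv y \<otimes> (t \<otimes> x))" using C_invariant(2)[OF c one_closed] HB_one c2 by simp
        ultimately show False using y(2) by simp
      qed
      have "HA (inv y \<otimes> x) \<noteq> HA (inv y \<otimes> (t \<otimes> x))"
        using y(2) edge[OF c1] edge[OF c2] 1 2 by simp
      then have "e \<in> separating HA x (t \<otimes> x)" unfolding separating_def y(3) using y(1) by simp
      moreover have "e \<noteq> x <# C" unfolding y(3) using l_coset_eq_iff[OF subgroup_C y(1) x] 1 by simp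
      ultimately show "e \<in> separating HA x (t \<otimes> x) - {x <# C}" by simp
    qed
    then have "separating HB x (t \<otimes> x) \<subset> separating HA x (t \<otimes> x)" using mem by blast
    moreover have "finite (separating HA x (t \<otimes> x))" using x tc by (intro finite_separating) simp_all
    ultimately show ?thesis unfolding sepA[OF tc] by (intro psubset_card_mono)
  qed
  have "f HB x < f HA g"
    unfolding f_def
  proof (rule sum_strict_mono_ex1[OF finS])
    show "\<forall>t \<in> S. card (separating HB x (t \<otimes> x)) \<le> card (separating HA g (t \<otimes> g))"
      using stable moved less_imp_le by blast
    show "\<exists>t \<in> S. card (separating HB x (t \<otimes> x)) < card (separating HA g (t \<otimes> g))"
      using moved[OF s(1) nC] s(1) by blast
  qed
  then show ?thesis using that x by blast
qed

text \<open>Vertices of both types compete for least displacement; the flag \<open>snd v\<close>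
  tells them apart. For type \<open>B\<close> the step is taken in the swapped tree, where negating
  the half-tree predicate leaves \<open>separating\<close> unchanged.\<close>

lemma fixed_vertex:
  assumes finS: "finite S" and S: "S \<subseteq> carrier G" "\<And>s. s \<in> S \<Longrightarrow> s \<otimes> s = \<one>"
    and side: "\<And>x s t. x \<in> carrier G \<Longrightarrow> s \<in> S \<Longrightarrow> t \<in> S \<Longrightarrow> inv x \<otimes> s \<otimes> x \<notin> C \<Longrightarrow>
      inv x \<otimes> t \<otimes> x \<notin> C \<Longrightarrow> HA (inv x \<otimes> s \<otimes> x) = HA (inv x \<otimes> t \<otimes> x)"
  obtains g where "g \<in> carrier G"
    "(\<forall>s \<in> S. inv g \<otimes> s \<otimes> g \<in> A) \<or> (\<forall>s \<in> S. inv g \<otimes> s \<otimes> g \<in> B)"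
proof -
  interpret swap: half_tree G B A C "\<lambda>g. \<not> HB g" "\<lambda>g. \<not> HA g" by (rule swap)
  define f where "f = (\<lambda>H g. \<Sum>s \<in> S. card (separating H g (s \<otimes> g)))"
  have sep_neg: "separating (\<lambda>g. \<not> H g) = separating H" for H
    by (intro ext) (simp add: separating_def)
  have side': "(\<not> HB (inv x \<otimes> s \<otimes> x)) = (\<not> HB (inv x \<otimes> t \<otimes> x))"
    if "x \<in> carrier G" "s \<in> S" "t \<in> S" "inv x \<otimes> s \<otimes> x \<notin> C" "inv x \<otimes> t \<otimes> x \<notin> C" for x s t
  proof -
    have "s \<in> carrier G" "t \<in> carrier G" using that S by auto
    then show ?thesis
      using side[OF that] edge[of "inv x \<otimes> s \<otimes> x"] edge[of "inv x \<otimes> t \<otimes> x"] that by simp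
  qed
  obtain v where v: "fst v \<in> carrier G" and
    min: "\<forall>w. fst w \<in> carrier G \<longrightarrow>
      f (if snd v then HA else HB) (fst v) \<le> f (if snd w then HA else HB) (fst w)"
    using ex_has_least_nat[of "\<lambda>w. fst w \<in> carrier G" "(\<one>, True)"
        "\<lambda>w. f (if snd w then HA else HB) (fst w)"] by auto
  show ?thesis
  proof (cases "snd v")
    case True
    have "inv (fst v) \<otimes> s \<otimes> fst v \<in> A" if s: "s \<in> S" for s
    proof (rule ccontr)
      assume "inv (fst v) \<otimes> s \<otimes> fst v \<notin> A"
      then obtain x where "x \<in> carrier G" "f HB x < f HA (fst v)"
        using descent_step[OF finS S side v s] unfolding f_def by blast
      then show False using min[rule_format, of "(x, False)"] True by simp
    qed
    then show ?thesis using that v by blast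
  next
    case False
    have "inv (fst v) \<otimes> s \<otimes> fst v \<in> B" if s: "s \<in> S" for s
    proof (rule ccontr)
      assume "inv (fst v) \<otimes> s \<otimes> fst v \<notin> B"
      then obtain x where "x \<in> carrier G" "f HA x < f HB (fst v)"
        using swap.descent_step[OF finS S side' v s] unfolding f_def sep_neg by blast
      then show False using min[rule_format, of "(x, True)"] False by simp
    qed
    then show ?thesis using that v by blast
  qed
qed

lemma Int_eq: "A \<inter> B = C"
proof
  show "A \<inter> B \<subseteq> C"
  proof
    fix x assume "x \<in> A \<inter> B"
    then have x: "x \<in> A" "x \<in> B" by auto
    then have "HA x = HA \<one>" "HB x = HB \<one>" using HA_mult[of \<one> x] HB_mult[of \<one> x] by simp_all
    then show "x \<in> C" using edge[of x] x HA_one HB_one by simp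
  qed
qed (use C_subset in blast)

end

text \<open>\<open>N g y\<close> is designed to say that the edge \<open>yC\<close> separates the
  vertices \<open>A\<close> and \<open>gA\<close>. An element of \<open>A\<close> fixes the vertex
  \<open>A\<close>, and the path from \<open>A\<close> to \<open>bA\<close> through \<open>B\<close>
  runs along \<open>C\<close> and \<open>bC\<close>; this prescribes \<open>n\<close> on the
  generators. For \<open>c \<in> C\<close> these two edges coincide and cancel, so both
  prescriptions agree.\<close>

lemma half_tree_of_amalgamated_product:
  fixes G :: "('a, 'b) monoid_scheme"
  assumes "amalgamated_product G A C B"
  obtains HA HB where "half_tree G A B C HA HB"
proof -
  let ?X = "A <+> B"
  have A: "subgroup A G" and B: "subgroup B G" and C: "subgroup C G" and sub: "C \<subseteq> A" "C \<subseteq> B"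
    and pres: "presents G (case_sum id id) ?X
       (mult_table_relators G Inl A \<union> mult_table_relators G Inr B \<union>
        {[(Inl c, True), (Inr c, False)] | c. c \<in> C})"
    using assms by (auto simp: amalgamated_product_def)
  interpret group G using pres by (simp add: presents_def)
  interpret A: subgroup A G by (rule A)
  interpret B: subgroup B G by (rule B)
  interpret C: subgroup C G by (rule C)
  define n :: "'a + 'a \<Rightarrow> 'a \<Rightarrow> bool"
    where "n = case_sum (\<lambda>a y. False) (\<lambda>b y. (y \<in> C) \<noteq> (inv\<^bsub>G\<^esub> b \<otimes>\<^bsub>G\<^esub> y \<in> C))"
  have Cmult: "inv\<^bsub>G\<^esub> c \<otimes>\<^bsub>G\<^esub> y \<in> C \<longleftrightarrow> y \<in> C" if "c \<in> C" "y \<in> carrier G" for c y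
  proof
    assume "inv\<^bsub>G\<^esub> c \<otimes>\<^bsub>G\<^esub> y \<in> C"
    then have "c \<otimes>\<^bsub>G\<^esub> (inv\<^bsub>G\<^esub> c \<otimes>\<^bsub>G\<^esub> y) \<in> C" by (rule C.m_closed[OF that(1)])
    then show "y \<in> C" using that by simp
  qed (use that in simp)
  have rel: "\<not> word_cocycle G (case_sum id id) (\<otimes>\<^bsub>G\<^esub>) n r y"
    if y: "y \<in> carrier G" and r: "r \<in> mult_table_relators G Inl A \<union> mult_table_relators G Inr B \<union>
        {[(Inl c, True), (Inr c, False)] | c. c \<in> C}" for r y
  proof -
    from r consider (a) a a' where "a \<in> A" "a' \<in> A" "r = [(Inl a, True), (Inl a', True), (Inl (a \<otimes>\<^bsub>G\<^esub> a'), False)]"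
      | (b) b b' where "b \<in> B" "b' \<in> B" "r = [(Inr b, True), (Inr b', True), (Inr (b \<otimes>\<^bsub>G\<^esub> b'), False)]"
      | (c) c where "c \<in> C" "r = [(Inl c, True), (Inr c, False)]"
      unfolding mult_table_relators_def by blast
    then show ?thesis
    proof cases
      case a
      then show ?thesis by (simp add: n_def)
    next
      case b
      then show ?thesis using y by (auto simp: n_def m_assoc inv_mult_group)
    next
      case c
      then have "c \<in> carrier G" by auto
      then show ?thesis using c y Cmult by (simp add: n_def)
    qed
  qed
  obtain N where N: "\<And>g h y. g \<in> carrier G \<Longrightarrow> h \<in> carrier G \<Longrightarrow> y \<in> carrier G \<Longrightarrow>
        N (g \<otimes>\<^bsub>G\<^esub> h) y = (N g y \<noteq> N h (inv\<^bsub>G\<^esub> g \<otimes>\<^bsub>G\<^esub> y))"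
      "\<And>x y. x \<in> ?X \<Longrightarrow> y \<in> carrier G \<Longrightarrow> N (case_sum id id x) y = n x y"
    by (rule presents_cocycle[OF pres, where act = "\<lambda>g y. g \<otimes>\<^bsub>G\<^esub> y" and n = n and M = "carrier G"])
      (use rel in \<open>auto simp: m_assoc\<close>)
  have NA: "\<not> N a y" if "a \<in> A" "y \<in> carrier G" for a y
    using N(2)[OF InlI[OF that(1)] that(2)] by (simp add: n_def)
  have NB: "N b y \<longleftrightarrow> (y \<in> C) \<noteq> (inv\<^bsub>G\<^esub> b \<otimes>\<^bsub>G\<^esub> y \<in> C)" if "b \<in> B" "y \<in> carrier G" for b y
    using N(2)[OF InrI[OF that(1)] that(2)] by (simp add: n_def)
  have invC: "inv\<^bsub>G\<^esub> y \<in> C \<longleftrightarrow> y \<in> C" if "y \<in> carrier G" for y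
    using that C.m_inv_closed[of y] C.m_inv_closed[of "inv\<^bsub>G\<^esub> y"] by auto
  \<comment> \<open>Evaluated at the edge \<open>C\<close>. The vertices \<open>gA\<close> and
    \<open>gB\<close> are joined by \<open>gC\<close>, so \<open>C\<close> separates them exactly
    for \<open>g \<in> C\<close>; hence the second predicate.\<close>
  have "half_tree G A B C (\<lambda>g. N g \<one>\<^bsub>G\<^esub>) (\<lambda>g. N g \<one>\<^bsub>G\<^esub> \<noteq> (g \<in> C))"
  proof unfold_locales
    have "case_sum id id ` ?X = A \<union> B" by (force simp: image_iff)
    then show "generate G (A \<union> B) = carrier G" using pres by (simp add: presents_def)
    show "N (g \<otimes>\<^bsub>G\<^esub> a) \<one>\<^bsub>G\<^esub> = N g \<one>\<^bsub>G\<^esub>" if "g \<in> carrier G" "a \<in> A" for g a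
      using that by (simp add: N(1) NA)
    show "(N (g \<otimes>\<^bsub>G\<^esub> b) \<one>\<^bsub>G\<^esub> \<noteq> (g \<otimes>\<^bsub>G\<^esub> b \<in> C)) = (N g \<one>\<^bsub>G\<^esub> \<noteq> (g \<in> C))"
      if "g \<in> carrier G" "b \<in> B" for g b
    proof -
      have "inv\<^bsub>G\<^esub> b \<otimes>\<^bsub>G\<^esub> inv\<^bsub>G\<^esub> g \<in> C \<longleftrightarrow> g \<otimes>\<^bsub>G\<^esub> b \<in> C"
        using that invC[of "g \<otimes>\<^bsub>G\<^esub> b"] by (simp add: inv_mult_group)
      then show ?thesis using that invC[of g] by (auto simp: N(1) NB)
    qed
    show "\<not> N \<one>\<^bsub>G\<^esub> \<one>\<^bsub>G\<^esub>" by (simp add: NA)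
  qed (use sub in auto)
  then show ?thesis by (rule that)
qed


section \<open>Splittings of Coxeter groups\<close>

context coxeter
begin

text \<open>An HNN extension maps onto the integers, but \<open>W\<close> is generated by involutions.\<close>

lemma not_HNN_extension: "\<not> HNN_extension W A C \<phi> t"
proof
  assume H: "HNN_extension W A C \<phi> t"
  let ?X = "A <+> {()}"
  let ?R = "mult_table_relators W Inl A \<union>
        {[(Inr (), False), (Inl c, True), (Inr (), True), (Inl (\<phi> c), False)] | c. c \<in> C}"
  let ?f = "case_sum id (\<lambda>_. t)"
  have presH: "presents W ?f ?X ?R" using H by (simp add: HNN_extension_def)
  have f: "?f \<in> ?X \<rightarrow> carrier W" using presH by (simp add: presents_def)
  \<comment> \<open>The exponent sum of the stable letter, which is zero on every relator.\<close>
  define e :: "('a + unit) word \<Rightarrow> int" where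
    "e w = (\<Sum>(x, b) \<leftarrow> w. case x of Inl _ \<Rightarrow> 0 | Inr _ \<Rightarrow> if b then 1 else - 1)" for w
  have e_append: "e (u @ v) = e u + e v" for u v by (simp add: e_def)
  have e_eq: "e u = e v" if "word_eq ?X ?R u v" for u v
    using that
  proof induction
    case (cancel u v x b)
    have "e [(x, b), (x, \<not> b)] = 0" by (cases x) (simp_all add: e_def)
    then show ?case by (simp only: e_append)
  next
    case (relator u v r)
    then have "e r = 0" by (auto simp: mult_table_relators_def e_def)
    then show ?case by (simp only: e_append)
  qed simp_all
  have "\<exists>u \<in> words ?X. word_val W ?f u = w \<and> e u = 0" if "w \<in> generate W S" for w
    using that subset_refl
  proof (induction rule: special_induct)
    case one
    show ?case by (intro bexI[of _ "[]"]) (simp_all add: e_def)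
  next
    case (mult s w)
    from mult(3) obtain v where v: "v \<in> words ?X" "word_val W ?f v = w" "e v = 0" by (elim bexE conjE)
    obtain u where u: "u \<in> words ?X" "word_val W ?f u = s"
      using presents_surj[OF presH gen_closed[OF mult(1)]] .
    \<comment> \<open>The square of a word for an involution is trivial, so twice its exponent sum
      vanishes.\<close>
    have "word_val W ?f (u @ u) = word_val W ?f []"
      using word_val_append[OF f u(1) u(1)] u(2) gen_sq[OF mult(1)] by simp
    moreover have "u @ u \<in> words ?X" using u(1) by simp
    ultimately have "word_eq ?X ?R (u @ u) []" using presents_word_eq_iff[OF presH, of "u @ u" "[]"] by simp
    from e_eq[OF this] have "e u + e u = e []" unfolding e_append .
    then have "e u = 0" by (simp add: e_def[of "[]"])
    then have "e (u @ v) = 0" using v(3) by (simp add: e_append)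
    moreover have "word_val W ?f (u @ v) = s \<otimes> w" using word_val_append[OF f u(1) v(1)] u(2) v(2) by simp
    moreover have "u @ v \<in> words ?X" using u(1) v(1) by simp
    ultimately show ?case by blast
  qed
  moreover have t: "t \<in> carrier W" using H by (simp add: HNN_extension_def)
  ultimately obtain u where u: "u \<in> words ?X" "word_val W ?f u = t" "e u = 0"
    using generate_S by blast
  have "word_val W ?f [(Inr (), True)] = t" using t by simp
  then have "word_eq ?X ?R u [(Inr (), True)]"
    using presents_word_eq_iff[OF presH u(1), of "[(Inr (), True)]"] u(2) InrI[of "()" "{()}" A] by simp
  from e_eq[OF this] show False using u(3) by (simp add: e_def)
qed

lemma splits_over_iff:
  "splits_over W K \<longleftrightarrow> (\<exists>A B. amalgamated_product W A K B \<and> A \<noteq> K \<and> K \<noteq> B)"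
  using not_HNN_extension by (simp add: splits_over_def)

lemma separates_diagram_subset: "separates_diagram S m D \<Longrightarrow> D \<subseteq> S"
  by (simp add: separates_diagram_def)

lemma diagram_edges_sym: "(s, t) \<in> diagram_edges S m \<Longrightarrow> (t, s) \<in> diagram_edges S m"
  using coxeter by (auto simp: diagram_edges_def coxeter_system_def coxeter_matrix_def)

text \<open>No diagram edge joins the component \<open>X\<close> to a vertex outside
  \<open>X \<union> D\<close>, so every relator is spelled in \<open>X1\<close> or in
  \<open>X2\<close>, and these sets meet in \<open>D\<close>. The conjugate is included because
  minimality of \<open>C\<close> is later tested against
  \<open>w\<langle>D\<rangle>w^-1\<close>.\<close>

lemma separates_diagram_splits:
  assumes sep: "separates_diagram S m D" and w: "w \<in> carrier W"
  shows "splits_over W (conjugate W w (generate W D))"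
proof -
  define V where "V = S - D"
  define E where "E = diagram_edges S m \<inter> V \<times> V"
  define r where "r = E\<^sup>* \<inter> V \<times> V"
  have D: "D \<subseteq> S" using sep by (rule separates_diagram_subset)
  have "sym E" using diagram_edges_sym by (auto simp: E_def intro!: symI)
  then have "sym r" using sym_rtrancl[of E] by (auto simp: r_def sym_def)
  moreover have "refl_on V r" by (auto simp: r_def refl_on_def)
  moreover have "trans r" by (auto simp: r_def trans_def)
  moreover have "r \<subseteq> V \<times> V" by (simp add: r_def)
  ultimately have eq: "equiv V r" by (simp add: equiv_def)
  obtain X Y where X: "X \<in> V // r" and Y: "Y \<in> V // r" and XY: "X \<noteq> Y"
    using sep by (auto simp: separates_diagram_def components_on_def V_def E_def r_def)
  have XV: "X \<subseteq> V" and YV: "Y \<subseteq> V"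
    using in_quotient_imp_subset[OF eq X] in_quotient_imp_subset[OF eq Y] by auto
  have disj: "X \<inter> Y = {}" using quotient_disj[OF eq X Y] XY by blast
  obtain x where x: "x \<in> X" using in_quotient_imp_non_empty[OF eq X] by blast
  obtain y where y: "y \<in> Y" using in_quotient_imp_non_empty[OF eq Y] by blast
  have closed: "t \<in> X" if "s \<in> X" "t \<in> V" "s \<noteq> t" "m s t < \<infinity>" for s t
  proof -
    have "(s, t) \<in> E" using that XV by (auto simp: E_def V_def diagram_edges_def)
    then have "(s, t) \<in> r" using that XV by (auto simp: r_def)
    then show ?thesis using in_quotient_imp_closed[OF eq X that(1)] by blast
  qed
  define X1 where "X1 = X \<union> D"
  define X2 where "X2 = S - X"
  have X1S: "X1 \<subseteq> S" and X2S: "X2 \<subseteq> S" and U: "X1 \<union> X2 = S" and I: "X1 \<inter> X2 = D"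
    using XV D by (auto simp: X1_def X2_def V_def)
  have rel: "coxeter_relators S m \<subseteq> words X1 \<union> words X2"
  proof
    fix q assume "q \<in> coxeter_relators S m"
    then obtain s t n where q: "q = concat (replicate n [(s, True), (t, True)])"
      and st: "s \<in> S" "t \<in> S" "m s t = enat n"
      unfolding coxeter_relators_def by blast
    have fin: "m s t < \<infinity>" "m t s < \<infinity>"
      using st coxeter by (auto simp: coxeter_system_def coxeter_matrix_def)
    have "s \<in> X1 \<and> t \<in> X1 \<or> s \<in> X2 \<and> t \<in> X2"
      using closed[of s t] closed[of t s] fin st by (auto simp: X1_def X2_def V_def)
    moreover have "q \<in> words Z" if "s \<in> Z" "t \<in> Z" for Z
      unfolding q by (induction n) (use that in simp_all)
    ultimately show "q \<in> words X1 \<union> words X2" by blast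
  qed
  let ?c = "\<lambda>x. w \<otimes> id x \<otimes> inv w"
  have pres': "presents W ?c (X1 \<union> X2) (coxeter_relators S m)"
    using presents_conjugate[OF pres w] U by simp
  have conj: "generate W (?c ` Z) = conjugate W w (generate W Z)" if "Z \<subseteq> S" for Z
    using conjugate_generate[OF w, of Z] that S_closed by (simp add: subset_trans)
  have "amalgamated_product W (conjugate W w (generate W X1)) (conjugate W w (generate W D))
      (conjugate W w (generate W X2))"
    using amalgamated_product_of_presentation[OF pres' rel] conj[OF X1S] conj[OF X2S] conj[OF D] I
    by simp
  moreover have ne: "conjugate W w (generate W Z) \<noteq> conjugate W w (generate W D)"
    if z: "z \<in> Z" "z \<notin> D" and Z: "Z \<subseteq> S" for z Z
  proof
    assume e: "conjugate W w (generate W Z) = conjugate W w (generate W D)"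
    have zS: "z \<in> S" using z Z by blast
    have "w \<otimes> z \<otimes> inv w \<in> conjugate W w (generate W Z)"
      using z(1) by (simp add: conjugate_eq_image generate.incl)
    then have "inv w \<otimes> (w \<otimes> z \<otimes> inv w) \<otimes> w \<in> generate W D"
      unfolding e using mem_conjugate_iff[OF w, of "generate W D" "w \<otimes> z \<otimes> inv w"]
        special_closed[OF D] w zS by (simp add: subset_iff)
    then have "z \<in> generate W D" using w zS by (simp add: m_assoc)
    then show False using gen_mem_special[OF zS _ D] z(2) by blast
  qed
  moreover have "x \<in> X1" "x \<notin> D" using x XV by (auto simp: X1_def V_def)
  moreover have "y \<in> X2" "y \<notin> D" using y YV disj by (auto simp: X2_def V_def)
  ultimately show ?thesis
    unfolding splits_over_iff using X1S X2S by metis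
qed

lemma conjugate_pow:
  assumes "x \<in> carrier W" "g \<in> carrier W"
  shows "(inv x \<otimes> g \<otimes> x) [^] (n :: nat) = inv x \<otimes> g [^] n \<otimes> x"
  using assms by (induction n) (simp_all add: m_assoc)

text \<open>An edge of the Bass-Serre tree such that some generators move it towards one side and some
  towards the other has a stabiliser which contains a separating subset of the diagram. If there is
  no such edge, all generators fix a common vertex.\<close>

lemma amalgamated_product_separates_diagram:
  assumes amal: "amalgamated_product W A C B" and ne: "A \<noteq> C" "C \<noteq> B" and finS: "finite S"
  obtains D x where "separates_diagram S m D" "x \<in> carrier W" "conjugate W x (generate W D) \<subseteq> C"
proof -
  obtain HA HB where ht: "half_tree W A B C HA HB"
    by (rule half_tree_of_amalgamated_product[OF amal])
  interpret half_tree W A B C HA HB by (rule ht)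
  have "\<exists>x \<in> carrier W. \<exists>s \<in> S. \<exists>t \<in> S. inv x \<otimes> s \<otimes> x \<notin> C \<and> inv x \<otimes> t \<otimes> x \<notin> C \<and>
      HA (inv x \<otimes> s \<otimes> x) \<noteq> HA (inv x \<otimes> t \<otimes> x)"
  proof (rule ccontr)
    assume "\<not> ?thesis"
    then have side: "HA (inv x \<otimes> s \<otimes> x) = HA (inv x \<otimes> t \<otimes> x)"
      if "x \<in> carrier W" "s \<in> S" "t \<in> S" "inv x \<otimes> s \<otimes> x \<notin> C" "inv x \<otimes> t \<otimes> x \<notin> C" for x s t
      using that by blast
    obtain g where g: "g \<in> carrier W"
      and fixed: "(\<forall>s \<in> S. inv g \<otimes> s \<otimes> g \<in> A) \<or> (\<forall>s \<in> S. inv g \<otimes> s \<otimes> g \<in> B)"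
      by (rule fixed_vertex[OF finS S_closed gen_sq side])
    have all: "H = carrier W" if H: "subgroup H W" and S: "\<forall>s \<in> S. inv g \<otimes> s \<otimes> g \<in> H" for H
    proof -
      have Hc: "H \<subseteq> carrier W" using H by (rule subgroup.subset)
      have "S \<subseteq> conjugate W g H" using S mem_conjugate_iff[OF g Hc] by auto
      then have "generate W S \<subseteq> conjugate W g H"
        by (rule generate_subgroup_incl) (rule subgroup_conjugate[OF g H])
      then have c: "carrier W \<subseteq> conjugate W g H" using generate_S by simp
      have "x \<in> H" if x: "x \<in> carrier W" for x
      proof -
        have y: "g \<otimes> x \<otimes> inv g \<in> carrier W" using g x by simp
        then have "inv g \<otimes> (g \<otimes> x \<otimes> inv g) \<otimes> g \<in> H" using c mem_conjugate_iff[OF g Hc y] by blast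
        then show ?thesis using g x by (simp add: m_assoc)
      qed
      then show ?thesis using Hc by blast
    qed
    \<comment> \<open>If one factor were all of \<open>W\<close>, the intersection
      \<open>A \<inter> B = C\<close> would be the other factor.\<close>
    have "A = carrier W \<or> B = carrier W" using all[OF subgroup_A] all[OF subgroup_B] fixed by blast
    then show False using Int_eq ne A.subset B.subset by blast
  qed
  then obtain x s t where x: "x \<in> carrier W" and st: "s \<in> S" "t \<in> S"
    and nC: "inv x \<otimes> s \<otimes> x \<notin> C" "inv x \<otimes> t \<otimes> x \<notin> C"
    and opp: "HA (inv x \<otimes> s \<otimes> x) \<noteq> HA (inv x \<otimes> t \<otimes> x)" by (elim bexE conjE)
  \<comment> \<open>\<open>u\<close> fixes the edge \<open>xC\<close> exactly when
    \<open>x^-1 u x \<in> C\<close>; so the conjugating element in the end is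
    \<open>inv x\<close>.\<close>
  define D where "D = {u \<in> S. inv x \<otimes> u \<otimes> x \<in> C}"
  have DS: "D \<subseteq> S" by (simp add: D_def)
  define V where "V = S - D"
  define E where "E = diagram_edges S m \<inter> V \<times> V"
  have same: "HA (inv x \<otimes> u \<otimes> x) = HA (inv x \<otimes> v \<otimes> x)" if uv: "(u, v) \<in> E" for u v
  proof (rule ccontr)
    assume ne: "HA (inv x \<otimes> u \<otimes> x) \<noteq> HA (inv x \<otimes> v \<otimes> x)"
    have uS: "u \<in> S" "v \<in> S" "u \<noteq> v" "m u v < \<infinity>" and uC: "inv x \<otimes> u \<otimes> x \<notin> C" "inv x \<otimes> v \<otimes> x \<notin> C"
      using uv by (auto simp: E_def V_def D_def diagram_edges_def)
    obtain n where n: "m u v = enat n" using uS(4) by (cases "m u v") auto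
    have "2 \<le> m u v" using uS coxeter by (auto simp: coxeter_system_def coxeter_matrix_def)
    then have n0: "n > 0" unfolding n by (simp add: numeral_eq_enat)
    have c: "u \<in> carrier W" "v \<in> carrier W" using uS by simp_all
    have sq: "inv x \<otimes> a \<otimes> x \<otimes> (inv x \<otimes> a \<otimes> x) = \<one>" if "a \<in> S" for a
      using that x by (simp add: m_assoc)
    have "(inv x \<otimes> u \<otimes> x \<otimes> (inv x \<otimes> v \<otimes> x)) [^] n \<noteq> \<one>"
      using x c uC ne n0 sq[OF uS(1)] sq[OF uS(2)] by (intro opposite_sides_pow) simp_all
    moreover have "inv x \<otimes> u \<otimes> x \<otimes> (inv x \<otimes> v \<otimes> x) = inv x \<otimes> (u \<otimes> v) \<otimes> x"
      using x c by (simp add: m_assoc)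
    ultimately have "inv x \<otimes> (u \<otimes> v) [^] n \<otimes> x \<noteq> \<one>" using conjugate_pow[OF x, of "u \<otimes> v" n] c by simp
    then show False using gen_mult_pow[OF uS(1,2) n] x by simp
  qed
  have path: "HA (inv x \<otimes> u \<otimes> x) = HA (inv x \<otimes> v \<otimes> x)" if "(u, v) \<in> E\<^sup>*" for u v
    using that by induction (simp_all add: same)
  have sV: "s \<in> V" "t \<in> V" using st nC by (auto simp: V_def D_def)
  let ?r = "E\<^sup>* \<inter> V \<times> V"
  have "?r `` {s} \<in> components_on V (diagram_edges S m)" "?r `` {t} \<in> components_on V (diagram_edges S m)"
    using sV by (auto simp: components_on_def E_def intro: quotientI)
  moreover have "t \<in> ?r `` {t}" "t \<notin> ?r `` {s}" using sV opp path[of s t] by auto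
  then have "?r `` {s} \<noteq> ?r `` {t}" by metis
  ultimately have sep: "separates_diagram S m D"
    using DS unfolding separates_diagram_def V_def by (intro conjI bexI)
  have Dc: "D \<subseteq> carrier W" using DS S_closed by blast
  have ix: "inv x \<in> carrier W" using x by simp
  have "(\<lambda>u. inv x \<otimes> u \<otimes> inv (inv x)) ` D \<subseteq> C" using x by (auto simp: D_def)
  then have "conjugate W (inv x) (generate W D) \<subseteq> C"
    unfolding conjugate_generate[OF ix Dc] by (rule generate_subgroup_incl) (rule subgroup_C)
  with sep ix show ?thesis by (rule that)
qed

lemma essential_part_subset: "essential_part W D \<subseteq> D"
  by (auto simp: essential_part_def)

text \<open>Up to finite index \<open>K\<close> lies in \<open>\<langle>D\<rangle>\<close>, hence in
  \<open>\<langle>E(D)\<rangle>\<close>. Its subgroup \<open>v\<langle>D'\<rangle>v^-1\<close>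
  therefore meets \<open>\<langle>E(D)\<rangle>\<close> in finite index, and after conjugation by
  \<open>v^-1\<close> the lemma \<open>essential_part_subset_conjugate\<close> makes this virtual
  containment an actual one.\<close>

lemma virtual_containment:
  assumes finS: "finite S" and K: "subgroup K W"
    and fi: "finite_index W (K \<inter> generate W D) K" and D: "D \<subseteq> S"
    and D': "D' \<subseteq> S" and v: "v \<in> carrier W" and sub: "conjugate W v (generate W D') \<subseteq> K"
  shows "conjugate W v (generate W (essential_part W D')) \<subseteq> generate W (essential_part W D)"
proof -
  let ?D = "generate W D" and ?P = "generate W D'"
  let ?E = "generate W (essential_part W D)" and ?E' = "generate W (essential_part W D')"
  have ED: "essential_part W D \<subseteq> S" and ED': "essential_part W D' \<subseteq> S"
    using essential_part_subset[of D] essential_part_subset[of D'] D D' by blast+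
  note sg = special_subgroup[OF D] special_subgroup[OF D'] special_subgroup[OF ED]
    special_subgroup[OF ED'] K
  have Pc: "?P \<subseteq> carrier W" and Ec: "?E \<subseteq> carrier W" and Ec': "?E' \<subseteq> carrier W"
    using sg by (simp_all add: subgroup.subset)
  have iv: "inv v \<in> carrier W" using v by simp
  have EsD: "?E \<subseteq> ?D" using essential_part_subset by (rule mono_generate)
  have KD: "subgroup (K \<inter> ?D) W" by (rule subgroups_Inter_pair[OF K sg(1)])
  have EKD: "subgroup (?E \<inter> (K \<inter> ?D)) W" by (rule subgroups_Inter_pair[OF sg(3) KD])
  have vP: "subgroup (conjugate W v ?P) W" by (rule subgroup_conjugate[OF v sg(2)])
  define L where "L = ?E \<inter> (K \<inter> ?D) \<inter> conjugate W v ?P"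
  have sgL: "subgroup L W" unfolding L_def by (rule subgroups_Inter_pair[OF EKD vP])
  have "finite_index W ?E ?D" using D finite_subset[OF D finS] by (rule essential_part_finite_index)
  then have "finite_index W (?E \<inter> (K \<inter> ?D)) (K \<inter> ?D)"
    using sg(3,1) KD EsD Int_lower2 by (rule finite_index_Int)
  then have fiK: "finite_index W (?E \<inter> (K \<inter> ?D)) K"
    using fi EKD KD K Int_lower2 Int_lower1 by (rule finite_index_trans)
  have "?E \<inter> (K \<inter> ?D) \<subseteq> K" by blast
  then have fiL: "finite_index W L (conjugate W v ?P)"
    unfolding L_def using sub by (rule finite_index_Int[OF fiK EKD K vP])
  have vL: "conjugate W (inv v) (conjugate W v ?P) = ?P"
    using v Pc by (simp add: conjugate_mult[symmetric] conjugate_one)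
  have LP: "L \<subseteq> conjugate W v ?P" and LE: "L \<subseteq> ?E" by (auto simp: L_def)
  have fiL': "finite_index W (conjugate W (inv v) L) ?P"
    using finite_index_conjugate[OF fiL sgL vP LP iv] unfolding vL .
  have LPE: "conjugate W (inv v) L \<subseteq> ?P \<inter> conjugate W (inv v) ?E"
    using conjugate_mono[OF LP, of "inv v"] conjugate_mono[OF LE, of "inv v"] unfolding vL by blast
  have "subgroup (?P \<inter> conjugate W (inv v) ?E) W"
    by (rule subgroups_Inter_pair[OF sg(2) subgroup_conjugate[OF iv sg(3)]])
  then have "finite_index W (?P \<inter> conjugate W (inv v) ?E) ?P"
    by (rule finite_index_mono[OF fiL' subgroup_conjugate[OF iv sgL] _ sg(2) LPE Int_lower1])
  then have "?E' \<subseteq> conjugate W (inv v) ?E"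
    by (rule essential_part_subset_conjugate[OF finS D' ED iv])
  then have "conjugate W v ?E' \<subseteq> conjugate W v (conjugate W (inv v) ?E)" by (rule conjugate_mono)
  also have "\<dots> = ?E" using v Ec by (simp add: conjugate_mult[symmetric] conjugate_one)
  finally show ?thesis .
qed

end

section \<open>Minimality of the chosen splitting subgroup\<close>

theorem proposition24:
  fixes W :: "('a, 'b) monoid_scheme"
    and S :: "'a set" and m :: "'a \<Rightarrow> 'a \<Rightarrow> enat"
    and A B C :: "'a set"
  assumes "coxeter_system W S m" and "finite S"
    and "amalgamated_product W A C B" and "A \<noteq> C" and "C \<noteq> B"
  shows "\<exists>D w. D \<subseteq> S \<and> w \<in> carrier W \<and>
           generate W D \<in> minimal_splitting_subgroups W \<and>
           separates_diagram S m D \<and>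
           conjugate W w (generate W (essential_part W D)) \<subseteq> C \<and>
           finite_index W (conjugate W w (generate W D) \<inter> C) (conjugate W w (generate W D)) \<and>
           (C \<in> minimal_splitting_subgroups W \<longrightarrow>
              finite_index W (conjugate W w (generate W (essential_part W D))) C)"
proof -
  have "group W" using assms(1) by (simp add: coxeter_system_def presents_def)
  then interpret coxeter W S m using assms(1) by (intro coxeter.intro coxeter_axioms.intro)
  note finS = assms(2)
  let ?ess = "\<lambda>D. generate W (essential_part W D)"
  \<comment> \<open>The conjugating element is part of the choice: the competitor found below comes
    with \<open>w \<otimes> v\<close> instead of \<open>w\<close>.\<close>
  define good where "good = (\<lambda>p. separates_diagram S m (fst p) \<and> snd p \<in> carrier W \<and>
    conjugate W (snd p) (?ess (fst p)) \<subseteq> C)"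
  have C: "subgroup C W" using assms(3) by (simp add: amalgamated_product_def)
  obtain D0 x where D0: "separates_diagram S m D0" "x \<in> carrier W" "conjugate W x (generate W D0) \<subseteq> C"
    by (rule amalgamated_product_separates_diagram[OF assms(3,4,5) finS])
  have "conjugate W x (?ess D0) \<subseteq> conjugate W x (generate W D0)"
    by (intro conjugate_mono mono_generate essential_part_subset)
  then have "good (D0, x)" using D0 by (simp add: good_def)
  from ex_has_least_nat[of good, OF this, of "\<lambda>q. card (essential_part W (fst q))"]
  obtain p where p: "good p"
    and min: "\<forall>q. good q \<longrightarrow> card (essential_part W (fst p)) \<le> card (essential_part W (fst q))"
    by (elim exE conjE)
  define D where "D = fst p"
  define w where "w = snd p"
  have sepD: "separates_diagram S m D" and w: "w \<in> carrier W" and wE: "conjugate W w (?ess D) \<subseteq> C"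
    using p by (simp_all add: good_def D_def w_def)
  have D: "D \<subseteq> S" using sepD by (rule separates_diagram_subset)
  have E: "essential_part W D \<subseteq> S" using essential_part_subset[of D] D by blast
  have sgD: "subgroup (generate W D) W" and sgE: "subgroup (?ess D) W"
    using special_subgroup[OF D] special_subgroup[OF E] .
  have ED: "?ess D \<subseteq> generate W D" by (intro mono_generate essential_part_subset)
  have fiE: "finite_index W (?ess D) (generate W D)"
    using D finite_subset[OF D finS] by (rule essential_part_finite_index)
  have min_split: "\<not> smaller W K (generate W D)" if K: "splits_over W K" for K
  proof
    assume "smaller W K (generate W D)"
    then have fi: "finite_index W (K \<inter> generate W D) K"
      and nfi: "\<not> finite_index W (K \<inter> generate W D) (generate W D)" by (simp_all add: smaller_def)
    obtain A' B' where amal: "amalgamated_product W A' K B'" "A' \<noteq> K" "K \<noteq> B'"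
      using K unfolding splits_over_iff by blast
    then have sgK: "subgroup K W" by (simp add: amalgamated_product_def)
    obtain D' v where D': "separates_diagram S m D'" "v \<in> carrier W" "conjugate W v (generate W D') \<subseteq> K"
      by (rule amalgamated_product_separates_diagram[OF amal finS])
    have D'S: "D' \<subseteq> S" using D'(1) by (rule separates_diagram_subset)
    have E': "essential_part W D' \<subseteq> S" using essential_part_subset[of D'] D'S by blast
    have E'c: "?ess D' \<subseteq> carrier W" using special_subgroup[OF E'] by (rule subgroup.subset)
    have sub: "conjugate W v (?ess D') \<subseteq> ?ess D"
      using finS sgK fi D D'S D'(2,3) by (rule virtual_containment)
    have "conjugate W (w \<otimes>\<^bsub>W\<^esub> v) (?ess D') = conjugate W w (conjugate W v (?ess D'))"
      using w D'(2) E'c by (rule conjugate_mult)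
    also have "\<dots> \<subseteq> conjugate W w (?ess D)" using sub by (rule conjugate_mono)
    finally have "good (D', w \<otimes>\<^bsub>W\<^esub> v)" using wE D'(1,2) w by (simp add: good_def)
    \<comment> \<open>With the containment \<open>sub\<close>, this forces the conjugate by
      \<open>v\<close> of \<open>?ess D'\<close> to be all of \<open>?ess D\<close>. So
      \<open>K\<close> contains \<open>?ess D\<close>, which has finite index in
      \<open>\<langle>D\<rangle>\<close>.\<close>
    then have "card (essential_part W D) \<le> card (essential_part W D')"
      using min[rule_format, of "(D', w \<otimes>\<^bsub>W\<^esub> v)"] by (simp add: D_def)
    then have "conjugate W v (?ess D') = ?ess D"
      by (rule conjugate_special_subset(2)[OF finS E' E D'(2) sub])
    moreover have "conjugate W v (?ess D') \<subseteq> conjugate W v (generate W D')"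
      by (intro conjugate_mono mono_generate essential_part_subset)
    ultimately have "?ess D \<subseteq> K \<inter> generate W D" using D'(3) ED by blast
    moreover have "subgroup (K \<inter> generate W D) W" using sgK sgD by (rule subgroups_Inter_pair)
    ultimately have "finite_index W (K \<inter> generate W D) (generate W D)"
      using finite_index_mono[OF fiE sgE _ sgD] by blast
    then show False using nfi by blast
  qed
  have "splits_over W (conjugate W \<one>\<^bsub>W\<^esub> (generate W D))"
    by (rule separates_diagram_splits[OF sepD one_closed])
  then have "splits_over W (generate W D)" using conjugate_one[OF subgroup.subset[OF sgD]] by simp
  then have minD: "generate W D \<in> minimal_splitting_subgroups W"
    using min_split by (auto simp: minimal_splitting_subgroups_def)
  let ?wD = "conjugate W w (generate W D)" and ?wE = "conjugate W w (?ess D)"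
  have sgwD: "subgroup ?wD W" and sgwE: "subgroup ?wE W"
    using subgroup_conjugate[OF w sgD] subgroup_conjugate[OF w sgE] .
  have fiw: "finite_index W ?wE ?wD" using fiE sgE sgD ED w by (rule finite_index_conjugate)
  have wED: "?wE \<subseteq> ?wD \<inter> C" using wE conjugate_mono[OF ED] by blast
  have sgI: "subgroup (?wD \<inter> C) W" using sgwD C by (rule subgroups_Inter_pair)
  have fiI: "finite_index W (?wD \<inter> C) ?wD"
    using fiw sgwE sgI sgwD wED by (rule finite_index_mono) simp
  have "finite_index W ?wE C" if "C \<in> minimal_splitting_subgroups W"
  proof -
    \<comment> \<open>Being itself a splitting subgroup virtually contained in \<open>C\<close>, the
      conjugate of \<open>\<langle>D\<rangle>\<close> cannot be smaller than \<open>C\<close>; so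
      its intersection with \<open>C\<close> has finite index on both sides.\<close>
    have "splits_over W ?wD" by (rule separates_diagram_splits[OF sepD w])
    then have "\<not> smaller W ?wD C" using that by (auto simp: minimal_splitting_subgroups_def)
    then have fiC: "finite_index W (?wD \<inter> C) C" using fiI by (simp add: smaller_def)
    have "finite_index W (?wE \<inter> (?wD \<inter> C)) (?wD \<inter> C)"
      using fiw sgwE sgwD sgI conjugate_mono[OF ED] by (rule finite_index_Int) simp
    then have "finite_index W ?wE (?wD \<inter> C)" using wED by (simp add: Int_absorb2)
    then show ?thesis using fiC sgwE sgI C wED by (rule finite_index_trans) simp
  qed
  then show ?thesis using D w minD sepD wE fiI by blast
qed

end
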